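(* Let $\mathcal R$ be a semisimple based root datum, $b\in\mathcal B_{gm}$, $C\subset\mathcal Q_b^{reg}$ a connected component, $\mathbf v_0\in\partial C$, and let $\mathfrak C$ be a curve through $\mathbf v_0$ meeting $C$ as described in the context. Then $\epsilon(b,C)\,\mathrm{Ind}_D(b,C;\mathbf v_0)$, the limit at $\mathbf v_0$ of the family of discrete series characters $\epsilon(b;\mathbf v)\mathrm{Ind}_D(b;\mathbf v)$ along $\mathfrak C$ from $C$, is a genuine tempered character of $\mathcal H_{\mathbf v_0}$.
   Context: **Affine Hecke algebra.** $\mathcal R=(X,R_0,Y,R_0^\vee,F_0)$: based semisimple root datum ($R_0$ reduced, spanning $X\otimes\mathbb Q$); $W_0=W(R_0)$ with longest element $w_0$; $W=W_0\ltimes X$ with its usual length function $l$; $S\subset W$ the affine simple reflections. $\Lambda$ is the complex Laurent polynomial ring in invertible indeterminates $v(\mathbf s)$, $\mathbf s\in S$, with $v(\mathbf s)=v(\mathbf s')$ iff $\mathbf s,\mathbf s'$ are $W$-conjugate; $v(\cdot)$ extends to all reflections in $W$, and $v(w_0)$ is the product over a reduced expression. $\mathcal Q_{\mathbb C}$ is the complex torus of characters of $\Lambda$; $\mathcal Q$ its positive points ($\mathbf v(\mathbf s)>0$); $\mathbf v^\epsilon(\mathbf s)=\mathbf v(\mathbf s)^\epsilon$. $\mathcal H_\Lambda$ has $\Lambda$-basis $N_w$, $N_wN_{w'}=N_{ww'}$ if $l(ww')=l(w)+l(w')$, $(N_{\mathbf s}-v(\mathbf s))(N_{\mathbf s}+v(\mathbf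 s)^{-1})=0$; $\mathcal H_{\mathbf v}$ is its specialization, $\mathcal H_{\mathbf v=1}=\mathbb C[W]$; $\mathcal H_A=\mathcal H_\Lambda\otimes_\Lambda A$ for a $\Lambda$-algebra $A$. The elements $\theta_x$ ($x\in X$) satisfy $\theta_{x+y}=\theta_x\theta_y$ and $\theta_x=N_x$ for dominant $x$; they span $\mathcal A\simeq\mathbb C[X]$; the center is $\mathcal A^{W_0}$. $T=\mathrm{Hom}(X,\mathbb C^\times)=T_uT_v$ (unitary and real positive parts); central characters are $W_0$-orbits in $T$. A finite dimensional $\mathcal H_{\mathbf v}$-module ($\mathbf v\in\mathcal Q$) is tempered if $|x(t)|\le1$ for all its generalized $\mathcal A$-weights $t$ and all dominant $x\in X$; an irreducible module is a discrete series if $|x(t)|<1$ for all dominant $x\ne0$. $\mathrm{fdeg}$ is the Plancherel mass for the trace $\tau(N_w)=\delta_{w,e}$ and antilinear involution $N_w^*=N_{w^{-1}}$. **Elliptic characters and scaling map.** $\overline{\mathcal R}_{\mathbb Z}(\mathcal H_{\mathbf v})$ is the image of the Grothendieck group of finite dimensional modules in the quotient of its complexification by the span of representations induced from the subalgebras generated by $\mathcal A$ and $N_{s_\alpha}$, $\alpha\in P\subsetneq F_0$; at $\mathbf v=1$ this is $\overline{\mathcal R}_{\mathbb Z}(W)$, with positive definite pairing $EP(U,V)=\sum_i(-1)^i\dim\mathrm{Ext}_W^i(U,V)$. For $\alpha\in R_0$ with $\alpha^\vee\in 2Y$ let $s_\alpha'\in W$ be the reflection $x\mapsto s_\alpha(x)+\alpha$,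 $P_\alpha=v(s_\alpha)v(s'_\alpha)$, $D_\alpha=v(s_\alpha)/v(s'_\alpha)$. Put $c_\alpha=\frac{1-v(s_\alpha)^{-2}\theta_{-\alpha}}{1-\theta_{-\alpha}}$ if $\alpha^\vee\notin2Y$, $c_\alpha=\frac{(1+D_\alpha^{-1}\theta_{-\alpha})(1-P_\alpha^{-1}\theta_{-\alpha})}{1-\theta_{-2\alpha}}$ if $\alpha^\vee\in2Y$, and define $\iota_\alpha$ ($\alpha\in F_0$) by $1+\iota_\alpha=(1+v(s_\alpha)N_{s_\alpha})(v(s_\alpha)^2c_\alpha)^{-1}$. For a module $\pi$ with central character $W_0t$, $t=sc\in T_uT_v$, let $U=W_0(t\exp B)$ with $B$ a small $W_0$-stable ball around $0$ in $\mathrm{Lie}(T)$, $\sigma_\epsilon(w(sc\exp\beta))=w(sc^\epsilon\exp(\epsilon\beta))$, and let $j_\epsilon:\mathcal H_{\mathbf v}^{an}(U)\to\mathcal H^{an}_{\mathbf v^\epsilon}(\sigma_\epsilon(U))$ ($0<\epsilon\le1$) be the isomorphism of analytic localizations (extension of scalars by $W_0$-invariant analytic functions) with $f\mapsto f\circ\sigma_\epsilon^{-1}$, $\iota_\alpha\mapsto\iota_\alpha$. With $\pi_{\mathbf v^\epsilon}=\pi\circ j_\epsilon^{-1}$, the operators $\pi_{\mathbf v^\epsilon}(N_w)$ converge for $\epsilon\to0$ to a representation of $W$; this defines an isometry $\mathrm{sp}_{\mathbf v}:\overline{\mathcal R}_{\mathbb Z}(\mathcal H_{\mathbf v})\to\overline{\mathcal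 R}_{\mathbb Z}(W)$. **$\mathcal B_{gm}$ and Dirac induction.** $\mathcal Y_{gm}\subset\overline{\mathcal R}_{\mathbb Z}(W)$ is the lattice generated by all $\mathrm{sp}_{\mathbf v}(\overline\pi)$, $\mathbf v\in\mathcal Q$, $\pi$ a discrete series of $\mathcal H_{\mathbf v}$; it has an orthonormal basis $\mathcal B_{gm}$ (unique up to signs). For $b\in\mathcal B_{gm}$, $\mathcal Q_b^{reg}$ is the set of $\mathbf v\in\mathcal Q$ such that $\mathrm{sp}_{\mathbf v}(\overline\pi)=\pm b$ for some irreducible discrete series $\pi$ of $\mathcal H_{\mathbf v}$; $\mathrm{Ind}_D(b;\mathbf v)$ is the unique virtual discrete series character with image $b$ under $\mathrm{sp}_{\mathbf v}$; $\epsilon(b;\mathbf v)\in\{\pm1\}$ is the sign making $\epsilon(b;\mathbf v)\mathrm{Ind}_D(b;\mathbf v)$ an irreducible discrete series character; it is constant on each component $C$ of $\mathcal Q_b^{reg}$, with value $\epsilon(b,C)$. **Generic residual points.** Let $R_1=\{\alpha\in R_0\mid\alpha^\vee\notin2Y\}\cup\{2\alpha\mid\alpha\in R_0,\alpha^\vee\in2Y\}$. For $r\in\mathrm{Hom}(X,\Lambda^\times)$ let $$m_{W_0r}=v(w_0)^{-2}\frac{\prod'_{\alpha\in R_1}(\alpha(r)^{-1}-1)}{\prod'_{\alpha\in R_0,\alpha^\vee\notin2Y}(v(s_\alpha)^{-2}\alpha(r)^{-1}-1)\prod'_{\alpha\in R_0,\alpha^\vee\in2Y}(D_\alpha^{-1}\alpha(r)^{-1}+1)\prod'_{\alpha\in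 R_0,\alpha^\vee\in2Y}(P_\alpha^{-1}\alpha(r)^{-1}-1)}$$ (identically zero factors omitted); $r$ is generic residual if the number of omitted denominator factors minus omitted numerator factors is $\mathrm{rank}\,X$. $W_0r_b$ is the orbit of generic residual points with $W_0r_b(\mathbf v)$ the central character of $\mathrm{Ind}_D(b;\mathbf v)$ for all $\mathbf v\in\mathcal Q_b^{reg}=\{\mathbf v\in\mathcal Q\mid m_{W_0r_b}(\mathbf v)\neq0\}$. **The curve and the algebraic model.** Put $W_0r=W_0r_b$. $\mathfrak C\subset\mathcal Q_{\mathbb C}$ is an irreducible affine algebraic curve defined over $\mathbb R$, complexifying a connected real curve $\mathfrak C_r=\mathfrak C\cap\mathcal Q$ which meets $C$ and contains $\mathbf v_0$; $\mathfrak C$ is not contained in $\bigcup_{W_0r'}\{m_{W_0r'}=0\}$ (over all orbits of generic residual points), and $\mathfrak C\cap\overline C$ consists of smooth points. For $\mathbf v\in C$ let $\mathrm{DS}_{W_0r,\mathbf v}$ be the set of characters $\chi_{\mathbf v}=\epsilon(b';\mathbf v)\mathrm{Ind}_D(b';\mathbf v)$ with $b'\in\mathcal B_{gm}$, $W_0r_{b'}=W_0r$, and $c_{\chi,C}=\mathrm{fdeg}(\chi_{\mathbf v})/|m_{W_0r}(\mathbf v)|\in\mathbb Q_{>0}$, which is constant on $C$. For $h$ in $\mathcal H_\Lambda$, the function $\mathbf v\mapsto\sum_{\chi\in\mathrm{DS}_{W_0r,\mathbf v}}c_{\chi,C}\chi_{\mathbf v}(h)$ on $\mathfrak C\cap C$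 extends to a rational function $\Sigma(h)$ on $\mathfrak C$, and there is a smooth Zariski-open neighborhood $\mathfrak U\subset\mathfrak C$ of $\mathfrak C\cap\overline C$ on which all $\Sigma(h)$ are regular. Let $\mathfrak R(\mathfrak U)$ be the ring of regular functions on $\mathfrak U$, $\mathfrak K$ its quotient field, and $M\subset\mathrm{Hom}_{\mathfrak R(\mathfrak U)}(\mathcal H_{\mathfrak R(\mathfrak U)},\mathfrak R(\mathfrak U))$ the sub-bimodule generated by $\Sigma$ (bimodule structure $(afb)(h)=f(bha)$), with the algebra structure for which $h\mapsto h\Sigma$ is an algebra homomorphism. $M\otimes\mathfrak K$ is a direct sum of matrix algebras over finite extensions $\mathfrak K_i$ of $\mathfrak K$; $\mathfrak L$ is the compositum of (all conjugates of) the $\mathfrak K_i$, $\phi:\tilde{\mathfrak U}\to\mathfrak U$ the normalization of $\mathfrak U$ in $\mathfrak L$, $\tilde{\mathfrak R}(\mathfrak U)$ its ring of regular functions. Then $M\otimes\mathfrak L\simeq\bigoplus_i\mathrm{End}_{\mathfrak L}(\mathfrak L^{d_i})$, and one chooses $\tilde{\mathfrak R}(\mathfrak U)$-lattices $L_i\subset\mathfrak L^{d_i}$ with $M\otimes\tilde{\mathfrak R}(\mathfrak U)\subset\bigoplus_i\mathrm{End}_{\tilde{\mathfrak R}(\mathfrak U)}(L_i)$, so each $L_i$ is an $\mathcal H_{\tilde{\mathfrak R}(\mathfrak U)}$-module; $\phi$ is unramified over $\mathfrak C\cap C$, and for $\tilde{\mathbf v}$ above $\mathbf v\in\mathfrak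 C\cap C$ the specializations $L_{i,\tilde{\mathbf v}}$ realize the elements of $\mathrm{DS}_{W_0r,\mathbf v}$ bijectively. **Limit.** Choose $\mathbf v\in\mathfrak C\cap C$ in the same connected component of $\mathfrak C\cap\overline C$ as $\mathbf v_0$ and $\tilde{\mathbf v}$ above $\mathbf v$; let $L_b$ be the unique $L_i$ whose specialization at $\tilde{\mathbf v}$ has character $\epsilon(b;\mathbf v)\mathrm{Ind}_D(b;\mathbf v)$. Lift the interval of $\mathfrak C_r$ from $\mathbf v$ to $\mathbf v_0$ to a path in $\tilde{\mathfrak U}$ starting at $\tilde{\mathbf v}$, with endpoint $\tilde{\mathbf v}_0$ above $\mathbf v_0$. $\mathrm{Ind}_D(b,C;\mathbf v_0)$ is the virtual character of $\mathcal H_{\mathbf v_0}$ such that $\epsilon(b,C)\mathrm{Ind}_D(b,C;\mathbf v_0)$ is the character of $L_{b,\tilde{\mathbf v}_0}=L_b\otimes\mathbb C_{\tilde{\mathbf v}_0}$. *)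

theory Defs
  imports "HOL-Analysis.Analysis" "HOL-Computational_Algebra.Polynomial"
    "Jordan_Normal_Form.Matrix"
begin

unbundle no vec_syntax
hide_const (open) Finite_Cartesian_Product.mat Finite_Cartesian_Product.vec

section \<open>Root data and affine Weyl groups\<close>

text \<open>Both lattices are \<open>int ^ 'n\<close>, put in duality by the standard form (a choice of dual bases
  of \<open>X\<close> and \<open>Y\<close>); the rank is \<open>CARD('n)\<close>.  \<open>W\<close> is realised faithfully
  as a group of affine transformations of \<open>X\<close>.\<close>

type_synonym 'n lat = "int ^ 'n"
type_synonym 'n aff = "int ^ 'n \<Rightarrow> int ^ 'n"

text \<open>A point of the parameter torus is the function giving the values \<open>v(s)\<close> on reflections.\<close>
type_synonym 'n pt = "(int ^ 'n \<Rightarrow> int ^ 'n) \<Rightarrow> complex"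

definition pairing :: "int ^ 'n::finite \<Rightarrow> int ^ 'n \<Rightarrow> int" where
  "pairing x y = (\<Sum>i\<in>UNIV. vec_nth x i * vec_nth y i)"

record ('n::finite) root_datum =
  roots :: "(int ^ 'n) set"
  coroot :: "int ^ 'n \<Rightarrow> int ^ 'n"
  simples :: "(int ^ 'n) set"

definition refl :: "('n::finite, 'z) root_datum_scheme \<Rightarrow> 'n lat \<Rightarrow> 'n aff" where
  "refl D \<alpha> = (\<lambda>x. x - pairing x (coroot D \<alpha>) *s \<alpha>)"

definition pos_roots :: "('n::finite, 'z) root_datum_scheme \<Rightarrow> 'n lat set" where
  "pos_roots D = {\<alpha> \<in> roots D. \<exists>c :: 'n lat \<Rightarrow> nat. \<alpha> = (\<Sum>\<beta>\<in>simples D. int (c \<beta>) *s \<beta>)}"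

definition semisimple_based_root_datum :: "('n::finite, 'z) root_datum_scheme \<Rightarrow> bool" where
  "semisimple_based_root_datum D \<longleftrightarrow>
     finite (roots D) \<and> inj_on (coroot D) (roots D) \<and>
     (\<forall>\<alpha>\<in>roots D. pairing \<alpha> (coroot D \<alpha>) = 2) \<and>
     (\<forall>\<alpha>\<in>roots D. \<forall>\<beta>\<in>roots D. refl D \<alpha> \<beta> \<in> roots D \<and>
        coroot D (refl D \<alpha> \<beta>) = coroot D \<beta> - pairing \<alpha> (coroot D \<beta>) *s coroot D \<alpha>) \<and>
     (\<forall>\<alpha>\<in>roots D. \<forall>\<beta>\<in>roots D. \<forall>m n :: int. m \<noteq> 0 \<and> m *s \<alpha> = n *s \<beta> \<longrightarrow> \<beta> = \<alpha> \<or> \<beta> = - \<alpha>) \<and>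
     (\<forall>x. \<exists>(m::int) c. m \<noteq> 0 \<and> m *s x = (\<Sum>\<alpha>\<in>roots D. c \<alpha> *s \<alpha>)) \<and>
     simples D \<subseteq> roots D \<and>
     (\<forall>c :: 'n lat \<Rightarrow> int. (\<Sum>\<alpha>\<in>simples D. c \<alpha> *s \<alpha>) = 0 \<longrightarrow> (\<forall>\<alpha>\<in>simples D. c \<alpha> = 0)) \<and>
     (\<forall>\<alpha>\<in>roots D. \<alpha> \<in> pos_roots D \<or> - \<alpha> \<in> pos_roots D)"

text \<open>\<open>\<alpha>\<^sup>\<vee> \<in> 2Y\<close>\<close>
definition coroot_even :: "('n::finite, 'z) root_datum_scheme \<Rightarrow> 'n lat \<Rightarrow> bool" where
  "coroot_even D \<alpha> \<longleftrightarrow> (\<exists>y. coroot D \<alpha> = 2 *s y)"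

definition dominant :: "('n::finite, 'z) root_datum_scheme \<Rightarrow> 'n lat \<Rightarrow> bool" where
  "dominant D x \<longleftrightarrow> (\<forall>\<alpha>\<in>simples D. pairing x (coroot D \<alpha>) \<ge> 0)"

inductive_set W0 :: "('n::finite, 'z) root_datum_scheme \<Rightarrow> 'n aff set" for D where
  W0_id: "id \<in> W0 D"
| W0_refl: "\<alpha> \<in> roots D \<Longrightarrow> w \<in> W0 D \<Longrightarrow> refl D \<alpha> \<circ> w \<in> W0 D"

abbreviation ginv :: "('a \<Rightarrow> 'a) \<Rightarrow> 'a \<Rightarrow> 'a" where
  "ginv \<equiv> inv_into UNIV"

definition transl :: "'n lat \<Rightarrow> ('n::finite) aff" where
  "transl y = (\<lambda>x. x + y)"

definition Wgrp :: "('n::finite, 'z) root_datum_scheme \<Rightarrow> 'n aff set" where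
  "Wgrp D = {transl y \<circ> w | y w. w \<in> W0 D}"

text \<open>The affine root \<open>\<alpha>\<^sup>\<vee> + k\<close> as an affine function on \<open>X\<close>, and its reflection.\<close>
definition aroot :: "('n::finite, 'z) root_datum_scheme \<Rightarrow> 'n lat \<Rightarrow> int \<Rightarrow> 'n lat \<Rightarrow> int" where
  "aroot D \<alpha> k = (\<lambda>x. pairing x (coroot D \<alpha>) + k)"

definition arefl :: "('n::finite, 'z) root_datum_scheme \<Rightarrow> 'n lat \<Rightarrow> int \<Rightarrow> 'n aff" where
  "arefl D \<alpha> k = (\<lambda>x. x - aroot D \<alpha> k x *s \<alpha>)"

definition pos_aroots :: "('n::finite, 'z) root_datum_scheme \<Rightarrow> ('n lat \<Rightarrow> int) set" where
  "pos_aroots D = {aroot D \<alpha> k | \<alpha> k. \<alpha> \<in> roots D \<and> (k > 0 \<or> k = 0 \<and> \<alpha> \<in> pos_roots D)}"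

definition len :: "('n::finite, 'z) root_datum_scheme \<Rightarrow> 'n aff \<Rightarrow> nat" where
  "len D w = card {a \<in> pos_aroots D. (\<lambda>x. - a (ginv w x)) \<in> pos_aroots D}"

definition reflections :: "('n::finite, 'z) root_datum_scheme \<Rightarrow> 'n aff set" where
  "reflections D = {arefl D \<alpha> k | \<alpha> k. \<alpha> \<in> roots D}"

definition simple_refls :: "('n::finite, 'z) root_datum_scheme \<Rightarrow> 'n aff set" where
  "simple_refls D = {s \<in> reflections D. len D s = 1}"

text \<open>\<open>s'\<^sub>\<alpha> : x \<mapsto> s\<^sub>\<alpha>(x) + \<alpha>\<close>\<close>
definition refl' :: "('n::finite, 'z) root_datum_scheme \<Rightarrow> 'n lat \<Rightarrow> 'n aff" where
  "refl' D \<alpha> = (\<lambda>x. refl D \<alpha> x + \<alpha>)"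

section \<open>Parameters\<close>

text \<open>Characters of \<open>\<Lambda>\<close>: invertible \<open>W\<close>-conjugation invariant functions on reflections (every
  reflection is conjugate to a simple one), normalised to 1 elsewhere.\<close>
definition QC :: "('n::finite, 'z) root_datum_scheme \<Rightarrow> 'n pt set" where
  "QC D = {p. (\<forall>s\<in>reflections D. p s \<noteq> 0) \<and>
              (\<forall>s\<in>reflections D. \<forall>w\<in>Wgrp D. p (w \<circ> s \<circ> ginv w) = p s) \<and>
              (\<forall>g. g \<notin> reflections D \<longrightarrow> p g = 1)}"

definition Qpos :: "('n::finite, 'z) root_datum_scheme \<Rightarrow> 'n pt set" where
  "Qpos D = {p \<in> QC D. \<forall>s\<in>reflections D. \<exists>r>0. p s = complex_of_real r}"

definition one_pt :: "('n::finite) pt" where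
  "one_pt = (\<lambda>_. 1)"

definition pt_powr :: "('n::finite) pt \<Rightarrow> real \<Rightarrow> 'n pt" where
  "pt_powr v \<epsilon> = (\<lambda>s. complex_of_real (Re (v s) powr \<epsilon>))"

definition on_set :: "'a set \<Rightarrow> ('a \<Rightarrow> complex) \<Rightarrow> 'a \<Rightarrow> complex" where
  "on_set U f = (\<lambda>p. if p \<in> U then f p else 0)"

text \<open>Laurent polynomials with coefficients in \<open>K\<close>, as functions on the torus (0 off the torus).\<close>
inductive_set laurent :: "('n::finite, 'z) root_datum_scheme \<Rightarrow> complex set \<Rightarrow> ('n pt \<Rightarrow> complex) set"
  for D K where
  "c \<in> K \<Longrightarrow> on_set (QC D) (\<lambda>_. c) \<in> laurent D K"
| "s \<in> reflections D \<Longrightarrow> on_set (QC D) (\<lambda>p. p s) \<in> laurent D K"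
| "s \<in> reflections D \<Longrightarrow> on_set (QC D) (\<lambda>p. inverse (p s)) \<in> laurent D K"
| "f \<in> laurent D K \<Longrightarrow> g \<in> laurent D K \<Longrightarrow> (\<lambda>p. f p + g p) \<in> laurent D K"
| "f \<in> laurent D K \<Longrightarrow> g \<in> laurent D K \<Longrightarrow> (\<lambda>p. f p * g p) \<in> laurent D K"

abbreviation Lam :: "('n::finite, 'z) root_datum_scheme \<Rightarrow> ('n pt \<Rightarrow> complex) set" where
  "Lam D \<equiv> laurent D UNIV"

section \<open>The affine Hecke algebra\<close>

text \<open>\<open>\<H>\<^sub>\<Lambda>\<close> is the free \<open>\<Lambda>\<close>-module on \<open>N\<^sub>w\<close>; \<open>mulc x y u\<close> is the coefficient of \<open>N\<^sub>u\<close> in \<open>N\<^sub>x N\<^sub>y\<close>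
  and \<open>theta x w\<close> that of \<open>N\<^sub>w\<close> in \<open>\<theta>\<^sub>x\<close>.  Both are determined by the relations below.\<close>
record ('n::finite) affine_hecke = "'n root_datum" +
  mulc :: "(int ^ 'n \<Rightarrow> int ^ 'n) \<Rightarrow> (int ^ 'n \<Rightarrow> int ^ 'n) \<Rightarrow> (int ^ 'n \<Rightarrow> int ^ 'n) \<Rightarrow>
           ((int ^ 'n \<Rightarrow> int ^ 'n) \<Rightarrow> complex) \<Rightarrow> complex"
  theta :: "int ^ 'n \<Rightarrow> (int ^ 'n \<Rightarrow> int ^ 'n) \<Rightarrow> ((int ^ 'n \<Rightarrow> int ^ 'n) \<Rightarrow> complex) \<Rightarrow> complex"

definition Nb :: "'w \<Rightarrow> 'w \<Rightarrow> 'a::zero_neq_one" where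
  "Nb w = (\<lambda>u. if u = w then 1 else 0)"

definition hmul :: "('w \<Rightarrow> 'w \<Rightarrow> 'w \<Rightarrow> 'a) \<Rightarrow> ('w \<Rightarrow> 'a) \<Rightarrow> ('w \<Rightarrow> 'a) \<Rightarrow> 'w \<Rightarrow> 'a::comm_ring_1" where
  "hmul c a b = (\<lambda>u. \<Sum>x\<in>{x. a x \<noteq> 0}. \<Sum>y\<in>{y. b y \<noteq> 0}. a x * b y * c x y u)"

definition hcarrier :: "('n::finite, 'z) root_datum_scheme \<Rightarrow> 'a::zero set \<Rightarrow> ('n aff \<Rightarrow> 'a) set" where
  "hcarrier D A = {a. finite {w. a w \<noteq> 0} \<and> {w. a w \<noteq> 0} \<subseteq> Wgrp D \<and> range a \<subseteq> A}"

definition mulc_at :: "('n::finite) affine_hecke \<Rightarrow> 'n pt \<Rightarrow> 'n aff \<Rightarrow> 'n aff \<Rightarrow> 'n aff \<Rightarrow> complex" where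
  "mulc_at H v = (\<lambda>x y u. mulc H x y u v)"

definition theta_at :: "('n::finite) affine_hecke \<Rightarrow> 'n pt \<Rightarrow> 'n lat \<Rightarrow> 'n aff \<Rightarrow> complex" where
  "theta_at H v x = (\<lambda>w. theta H x w v)"

definition is_affine_hecke :: "('n::finite) affine_hecke \<Rightarrow> bool" where
  "is_affine_hecke H \<longleftrightarrow>
     semisimple_based_root_datum H \<and>
     (\<forall>x\<in>Wgrp H. \<forall>y\<in>Wgrp H. (\<forall>u. mulc H x y u \<in> Lam H) \<and>
        finite {u. mulc H x y u \<noteq> (\<lambda>_. 0)} \<and> {u. mulc H x y u \<noteq> (\<lambda>_. 0)} \<subseteq> Wgrp H) \<and>
     (\<forall>x. (\<forall>u. theta H x u \<in> Lam H) \<and>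
        finite {u. theta H x u \<noteq> (\<lambda>_. 0)} \<and> {u. theta H x u \<noteq> (\<lambda>_. 0)} \<subseteq> Wgrp H) \<and>
     (\<forall>v\<in>QC H.
        (\<forall>x\<in>Wgrp H. \<forall>y\<in>Wgrp H. \<forall>z\<in>Wgrp H.
           hmul (mulc_at H v) (hmul (mulc_at H v) (Nb x) (Nb y)) (Nb z) =
           hmul (mulc_at H v) (Nb x) (hmul (mulc_at H v) (Nb y) (Nb z))) \<and>
        (\<forall>x\<in>Wgrp H. hmul (mulc_at H v) (Nb id) (Nb x) = Nb x \<and>
                     hmul (mulc_at H v) (Nb x) (Nb id) = Nb x) \<and>
        (\<forall>x\<in>Wgrp H. \<forall>y\<in>Wgrp H. len H (x \<circ> y) = len H x + len H y \<longrightarrow>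
           hmul (mulc_at H v) (Nb x) (Nb y) = Nb (x \<circ> y)) \<and>
        (\<forall>s\<in>simple_refls H.
           hmul (mulc_at H v) (\<lambda>u. Nb s u - v s * Nb id u)
                              (\<lambda>u. Nb s u + inverse (v s) * Nb id u) = (\<lambda>_. 0)) \<and>
        (\<forall>x y. hmul (mulc_at H v) (theta_at H v x) (theta_at H v y) = theta_at H v (x + y)) \<and>
        (\<forall>x. dominant H x \<longrightarrow> theta_at H v x = Nb (transl x)))"

section \<open>Finite dimensional modules\<close>

definition mtrace :: "'a::comm_monoid_add mat \<Rightarrow> 'a" where
  "mtrace A = (\<Sum>i<dim_row A. A $$ (i, i))"

text \<open>Representations on \<open>\<complex>\<^sup>d\<close> of a unital subalgebra \<open>B\<close> of \<open>\<H>\<^sub>v\<close>.\<close>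
definition alg_rep ::
  "('n::finite) affine_hecke \<Rightarrow> 'n pt \<Rightarrow> ('n aff \<Rightarrow> complex) set \<Rightarrow> nat \<Rightarrow> (('n aff \<Rightarrow> complex) \<Rightarrow> complex mat) \<Rightarrow> bool" where
  "alg_rep H v B d \<rho> \<longleftrightarrow>
     (\<forall>a\<in>B. \<rho> a \<in> carrier_mat d d) \<and>
     (\<forall>a\<in>B. \<forall>b\<in>B. \<rho> (\<lambda>w. a w + b w) = \<rho> a + \<rho> b) \<and>
     (\<forall>a\<in>B. \<forall>c. \<rho> (\<lambda>w. c * a w) = c \<cdot>\<^sub>m \<rho> a) \<and>
     (\<forall>a\<in>B. \<forall>b\<in>B. \<rho> (hmul (mulc_at H v) a b) = \<rho> a * \<rho> b) \<and>
     \<rho> (Nb id) = 1\<^sub>m d"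

definition rep ::
  "('n::finite) affine_hecke \<Rightarrow> 'n pt \<Rightarrow> nat \<Rightarrow> (('n aff \<Rightarrow> complex) \<Rightarrow> complex mat) \<Rightarrow> bool" where
  "rep H v d \<rho> \<longleftrightarrow> alg_rep H v (hcarrier H UNIV) d \<rho>"

text \<open>Characters are recorded by their values on the basis \<open>N\<^sub>w\<close>.\<close>
definition chr :: "('n::finite) affine_hecke \<Rightarrow> (('n aff \<Rightarrow> complex) \<Rightarrow> complex mat) \<Rightarrow> 'n aff \<Rightarrow> complex" where
  "chr H \<rho> = (\<lambda>w. if w \<in> Wgrp H then mtrace (\<rho> (Nb w)) else 0)"

definition irreducible_rep ::
  "('n::finite) affine_hecke \<Rightarrow> 'n pt \<Rightarrow> nat \<Rightarrow> (('n aff \<Rightarrow> complex) \<Rightarrow> complex mat) \<Rightarrow> bool" where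
  "irreducible_rep H v d \<rho> \<longleftrightarrow> rep H v d \<rho> \<and> d > 0 \<and>
     (\<forall>V \<subseteq> carrier_vec d.
        0\<^sub>v d \<in> V \<and> (\<forall>x\<in>V. \<forall>y\<in>V. x + y \<in> V) \<and> (\<forall>c. \<forall>x\<in>V. c \<cdot>\<^sub>v x \<in> V) \<and>
        (\<forall>h\<in>hcarrier H UNIV. \<forall>x\<in>V. \<rho> h *\<^sub>v x \<in> V) \<longrightarrow> V = {0\<^sub>v d} \<or> V = carrier_vec d)"

definition torus :: "('n::finite lat \<Rightarrow> complex) set" where
  "torus = {t. t 0 = 1 \<and> (\<forall>x y. t (x + y) = t x * t y)}"

definition W0_orbit :: "('n::finite, 'z) root_datum_scheme \<Rightarrow> ('n lat \<Rightarrow> 'b) \<Rightarrow> ('n lat \<Rightarrow> 'b) set" where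
  "W0_orbit D t = {\<lambda>x. t (ginv w x) | w. w \<in> W0 D}"

definition weight ::
  "('n::finite) affine_hecke \<Rightarrow> 'n pt \<Rightarrow> nat \<Rightarrow> (('n aff \<Rightarrow> complex) \<Rightarrow> complex mat) \<Rightarrow> ('n lat \<Rightarrow> complex) \<Rightarrow> bool" where
  "weight H v d \<rho> t \<longleftrightarrow> t \<in> torus \<and>
     (\<exists>u\<in>carrier_vec d. u \<noteq> 0\<^sub>v d \<and>
        (\<forall>x. \<exists>k. ((\<rho> (theta_at H v x) - t x \<cdot>\<^sub>m 1\<^sub>m d) ^\<^sub>m k) *\<^sub>v u = 0\<^sub>v d))"

definition tempered ::
  "('n::finite) affine_hecke \<Rightarrow> 'n pt \<Rightarrow> nat \<Rightarrow> (('n aff \<Rightarrow> complex) \<Rightarrow> complex mat) \<Rightarrow> bool" where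
  "tempered H v d \<rho> \<longleftrightarrow> rep H v d \<rho> \<and>
     (\<forall>t. weight H v d \<rho> t \<longrightarrow> (\<forall>x. dominant H x \<longrightarrow> cmod (t x) \<le> 1))"

definition discrete_series ::
  "('n::finite) affine_hecke \<Rightarrow> 'n pt \<Rightarrow> nat \<Rightarrow> (('n aff \<Rightarrow> complex) \<Rightarrow> complex mat) \<Rightarrow> bool" where
  "discrete_series H v d \<rho> \<longleftrightarrow> irreducible_rep H v d \<rho> \<and>
     (\<forall>t. weight H v d \<rho> t \<longrightarrow> (\<forall>x. dominant H x \<and> x \<noteq> 0 \<longrightarrow> cmod (t x) < 1))"

definition ds_char :: "('n::finite) affine_hecke \<Rightarrow> 'n pt \<Rightarrow> ('n aff \<Rightarrow> complex) \<Rightarrow> bool" where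
  "ds_char H v \<chi> \<longleftrightarrow> (\<exists>d \<rho>. discrete_series H v d \<rho> \<and> \<chi> = chr H \<rho>)"

definition tempered_char :: "('n::finite) affine_hecke \<Rightarrow> 'n pt \<Rightarrow> ('n aff \<Rightarrow> complex) \<Rightarrow> bool" where
  "tempered_char H v \<chi> \<longleftrightarrow> (\<exists>d \<rho>. tempered H v d \<rho> \<and> \<chi> = chr H \<rho>)"

text \<open>The element of \<open>\<A> \<simeq> \<complex>[X]\<close> with coefficients \<open>a\<close>.\<close>
definition theta_comb ::
  "('n::finite) affine_hecke \<Rightarrow> 'n pt \<Rightarrow> ('n lat \<Rightarrow> complex) \<Rightarrow> 'n aff \<Rightarrow> complex" where
  "theta_comb H v a = (\<lambda>w. \<Sum>x\<in>{x. a x \<noteq> 0}. a x * theta_at H v x w)"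

text \<open>Central character \<open>W\<^sub>0t\<close>: the center \<open>\<A>\<^bsup>W\<^sub>0\<^esup>\<close> acts by evaluation at \<open>t\<close>.\<close>
definition central_char ::
  "('n::finite) affine_hecke \<Rightarrow> 'n pt \<Rightarrow> nat \<Rightarrow> (('n aff \<Rightarrow> complex) \<Rightarrow> complex mat) \<Rightarrow> ('n lat \<Rightarrow> complex) \<Rightarrow> bool" where
  "central_char H v d \<rho> t \<longleftrightarrow> t \<in> torus \<and>
     (\<forall>a. finite {x. a x \<noteq> 0} \<and> (\<forall>w\<in>W0 H. a \<circ> w = a) \<longrightarrow>
        \<rho> (theta_comb H v a) = (\<Sum>x\<in>{x. a x \<noteq> 0}. a x * t x) \<cdot>\<^sub>m 1\<^sub>m d)"

section \<open>Formal degrees\<close>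

definition unitary_irr_chars :: "('n::finite) affine_hecke \<Rightarrow> 'n pt \<Rightarrow> ('n aff \<Rightarrow> complex) set" where
  "unitary_irr_chars H v = {chr H \<rho> | d \<rho>. irreducible_rep H v d \<rho> \<and>
     (\<forall>w\<in>Wgrp H. \<forall>i<d. \<forall>j<d. \<rho> (Nb (ginv w)) $$ (i, j) = cnj (\<rho> (Nb w) $$ (j, i)))}"

text \<open>The unique measure on the unitary dual (identified with its set of characters) that decomposes
  \<open>\<tau>\<close> as an integral of irreducible characters.\<close>
definition plancherel_measure ::
  "('n::finite) affine_hecke \<Rightarrow> 'n pt \<Rightarrow> ('n aff \<Rightarrow> complex) measure \<Rightarrow> bool" where
  "plancherel_measure H v \<mu> \<longleftrightarrow>
     space \<mu> = unitary_irr_chars H v \<and>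
     sets \<mu> = sigma_sets (unitary_irr_chars H v)
        {{\<chi> \<in> unitary_irr_chars H v. \<chi> w \<in> E} | w E. w \<in> Wgrp H \<and> E \<in> sets borel} \<and>
     (\<forall>w\<in>Wgrp H. integrable \<mu> (\<lambda>\<chi>. \<chi> w) \<and> (LINT \<chi>|\<mu>. \<chi> w) = (if w = id then 1 else 0))"

definition fdeg :: "('n::finite) affine_hecke \<Rightarrow> 'n pt \<Rightarrow> ('n aff \<Rightarrow> complex) \<Rightarrow> real" where
  "fdeg H v \<chi> = measure (THE \<mu>. plancherel_measure H v \<mu>) {\<chi>}"

section \<open>Elliptic characters\<close>

inductive_set parabolic_subalg ::
  "('n::finite) affine_hecke \<Rightarrow> 'n pt \<Rightarrow> 'n lat set \<Rightarrow> ('n aff \<Rightarrow> complex) set" for H v P where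
  "theta_at H v x \<in> parabolic_subalg H v P"
| "\<alpha> \<in> P \<Longrightarrow> Nb (refl H \<alpha>) \<in> parabolic_subalg H v P"
| "a \<in> parabolic_subalg H v P \<Longrightarrow> b \<in> parabolic_subalg H v P \<Longrightarrow> (\<lambda>w. a w + b w) \<in> parabolic_subalg H v P"
| "a \<in> parabolic_subalg H v P \<Longrightarrow> (\<lambda>w. c * a w) \<in> parabolic_subalg H v P"
| "a \<in> parabolic_subalg H v P \<Longrightarrow> b \<in> parabolic_subalg H v P \<Longrightarrow>
     hmul (mulc_at H v) a b \<in> parabolic_subalg H v P"

text \<open>\<open>\<rho>\<close> is the induced module \<open>\<H> \<otimes>\<^bsub>\<H>\<^sup>P\<^esub> \<sigma>\<close>, through its universal property; as the induced module is
  finite dimensional, finite dimensional test modules suffice.\<close>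
definition is_induced ::
  "('n::finite) affine_hecke \<Rightarrow> 'n pt \<Rightarrow> 'n lat set \<Rightarrow> nat \<Rightarrow> (('n aff \<Rightarrow> complex) \<Rightarrow> complex mat) \<Rightarrow>
   nat \<Rightarrow> (('n aff \<Rightarrow> complex) \<Rightarrow> complex mat) \<Rightarrow> bool" where
  "is_induced H v P d \<sigma> e \<rho> \<longleftrightarrow>
     alg_rep H v (parabolic_subalg H v P) d \<sigma> \<and> rep H v e \<rho> \<and>
     (\<exists>J\<in>carrier_mat e d. (\<forall>h\<in>parabolic_subalg H v P. J * \<sigma> h = \<rho> h * J) \<and>
        (\<forall>m \<tau> F. rep H v m \<tau> \<and> F \<in> carrier_mat m d \<and>
             (\<forall>h\<in>parabolic_subalg H v P. F * \<sigma> h = \<tau> h * F) \<longrightarrow>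
           (\<exists>!G. G \<in> carrier_mat m e \<and> (\<forall>h\<in>hcarrier H UNIV. G * \<rho> h = \<tau> h * G) \<and> G * J = F)))"

inductive_set ind_span :: "('n::finite) affine_hecke \<Rightarrow> 'n pt \<Rightarrow> ('n aff \<Rightarrow> complex) set" for H v where
  "(\<lambda>_. 0) \<in> ind_span H v"
| "f \<in> ind_span H v \<Longrightarrow> P \<subset> simples H \<Longrightarrow> is_induced H v P d \<sigma> e \<rho> \<Longrightarrow>
     (\<lambda>w. f w + c * chr H \<rho> w) \<in> ind_span H v"

text \<open>Elements of \<open>\<R>\<close>-bar are cosets modulo the span of induced characters.  (Characters of
  inequivalent irreducible modules are linearly independent, so the complexified Grothendieck group is
  the span of the characters.)\<close>
definition ell_class :: "('n::finite) affine_hecke \<Rightarrow> 'n pt \<Rightarrow> ('n aff \<Rightarrow> complex) \<Rightarrow> ('n aff \<Rightarrow> complex) set" where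
  "ell_class H v f = {g. (\<lambda>w. g w - f w) \<in> ind_span H v}"

definition cls_diff :: "('w \<Rightarrow> complex) set \<Rightarrow> ('w \<Rightarrow> complex) set \<Rightarrow> ('w \<Rightarrow> complex) set" where
  "cls_diff A B = {\<lambda>w. f w - g w | f g. f \<in> A \<and> g \<in> B}"

definition cls_neg :: "('w \<Rightarrow> complex) set \<Rightarrow> ('w \<Rightarrow> complex) set" where
  "cls_neg A = {\<lambda>w. - f w | f. f \<in> A}"

text \<open>\<open>Ext\<^sub>W\<^sup>n(U,V)\<close> from the bar resolution: cochains are functions \<open>W\<^sup>n \<rightarrow> Hom\<^sub>\<complex>(U,V)\<close>.\<close>
definition cochains :: "('n::finite) affine_hecke \<Rightarrow> nat \<Rightarrow> nat \<Rightarrow> nat \<Rightarrow> ('n aff list \<Rightarrow> complex mat) set" where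
  "cochains H d1 d2 n = {f. \<forall>gs. if length gs = n \<and> set gs \<subseteq> Wgrp H
      then f gs \<in> carrier_mat d2 d1 else f gs = 0\<^sub>m d2 d1}"

definition bar_merge :: "nat \<Rightarrow> ('n::finite) aff list \<Rightarrow> 'n aff list" where
  "bar_merge k gs = take k gs @ [gs ! k \<circ> gs ! Suc k] @ drop (k + 2) gs"

definition coboundary ::
  "('n::finite) affine_hecke \<Rightarrow> nat \<Rightarrow> (('n aff \<Rightarrow> complex) \<Rightarrow> complex mat) \<Rightarrow>
   nat \<Rightarrow> (('n aff \<Rightarrow> complex) \<Rightarrow> complex mat) \<Rightarrow> nat \<Rightarrow> ('n aff list \<Rightarrow> complex mat) \<Rightarrow> 'n aff list \<Rightarrow> complex mat" where
  "coboundary H d1 U d2 V n f = (\<lambda>gs. if length gs = Suc n \<and> set gs \<subseteq> Wgrp H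
     then Matrix.mat d2 d1 (\<lambda>ij. (V (Nb (hd gs)) * f (tl gs)) $$ ij
            + (\<Sum>k<n. (- 1) ^ Suc k * f (bar_merge k gs) $$ ij)
            + (- 1) ^ Suc n * (f (butlast gs) * U (Nb (last gs))) $$ ij)
     else 0\<^sub>m d2 d1)"

definition cocycles ::
  "('n::finite) affine_hecke \<Rightarrow> nat \<Rightarrow> (('n aff \<Rightarrow> complex) \<Rightarrow> complex mat) \<Rightarrow>
   nat \<Rightarrow> (('n aff \<Rightarrow> complex) \<Rightarrow> complex mat) \<Rightarrow> nat \<Rightarrow> ('n aff list \<Rightarrow> complex mat) set" where
  "cocycles H d1 U d2 V n = {f \<in> cochains H d1 d2 n. coboundary H d1 U d2 V n f = (\<lambda>_. 0\<^sub>m d2 d1)}"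

definition coboundaries ::
  "('n::finite) affine_hecke \<Rightarrow> nat \<Rightarrow> (('n aff \<Rightarrow> complex) \<Rightarrow> complex mat) \<Rightarrow>
   nat \<Rightarrow> (('n aff \<Rightarrow> complex) \<Rightarrow> complex mat) \<Rightarrow> nat \<Rightarrow> ('n aff list \<Rightarrow> complex mat) set" where
  "coboundaries H d1 U d2 V n = (case n of 0 \<Rightarrow> {\<lambda>_. 0\<^sub>m d2 d1}
     | Suc k \<Rightarrow> coboundary H d1 U d2 V k ` cochains H d1 d2 k)"

definition ext_dim ::
  "('n::finite) affine_hecke \<Rightarrow> nat \<Rightarrow> (('n aff \<Rightarrow> complex) \<Rightarrow> complex mat) \<Rightarrow>
   nat \<Rightarrow> (('n aff \<Rightarrow> complex) \<Rightarrow> complex mat) \<Rightarrow> nat \<Rightarrow> nat" where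
  "ext_dim H d1 U d2 V n = (THE m. \<exists>bs. length bs = m \<and> set bs \<subseteq> cocycles H d1 U d2 V n \<and>
     (\<forall>z\<in>cocycles H d1 U d2 V n. \<exists>!cs. length cs = m \<and>
        (\<lambda>gs. Matrix.mat d2 d1 (\<lambda>ij. z gs $$ ij - (\<Sum>k<m. cs ! k * (bs ! k) gs $$ ij)))
          \<in> coboundaries H d1 U d2 V n))"

text \<open>Almost all terms vanish, \<open>\<complex>[W]\<close> having finite global dimension.\<close>
definition EP_mod ::
  "('n::finite) affine_hecke \<Rightarrow> nat \<Rightarrow> (('n aff \<Rightarrow> complex) \<Rightarrow> complex mat) \<Rightarrow>
   nat \<Rightarrow> (('n aff \<Rightarrow> complex) \<Rightarrow> complex mat) \<Rightarrow> int" where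
  "EP_mod H d1 U d2 V =
     (\<Sum>n\<in>{n. ext_dim H d1 U d2 V n \<noteq> 0}. (- 1) ^ n * int (ext_dim H d1 U d2 V n))"

text \<open>\<open>EP\<close> on classes of virtual \<open>W\<close>-modules, written as differences \<open>U - U'\<close> and \<open>V - V'\<close>.\<close>
definition EP :: "('n::finite) affine_hecke \<Rightarrow> ('n aff \<Rightarrow> complex) set \<Rightarrow> ('n aff \<Rightarrow> complex) set \<Rightarrow> int" where
  "EP H A B = (THE m. \<exists>d U d' U' e V e' V'.
     rep H one_pt d U \<and> rep H one_pt d' U' \<and> rep H one_pt e V \<and> rep H one_pt e' V' \<and>
     A = ell_class H one_pt (\<lambda>w. chr H U w - chr H U' w) \<and>
     B = ell_class H one_pt (\<lambda>w. chr H V w - chr H V' w) \<and>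
     m = EP_mod H d U e V - EP_mod H d' U' e V - EP_mod H d U e' V' + EP_mod H d' U' e' V')"

section \<open>The scaling map\<close>

text \<open>\<open>t exp \<beta>\<close> for \<open>\<beta> \<in> Lie(T) = \<complex>\<^sup>n\<close>\<close>
definition texp :: "('n::finite lat \<Rightarrow> complex) \<Rightarrow> complex ^ 'n \<Rightarrow> 'n lat \<Rightarrow> complex" where
  "texp t \<beta> = (\<lambda>x. t x * exp (\<Sum>i\<in>UNIV. of_int (vec_nth x i) * vec_nth \<beta> i))"

text \<open>\<open>sc \<mapsto> sc\<^sup>\<epsilon>\<close> for \<open>s \<in> T\<^sub>u\<close>, \<open>c \<in> T\<^sub>v\<close>, and \<open>\<sigma>\<^sub>\<epsilon>(t exp \<beta>)\<close> for \<open>t\<close> in the orbit of the central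
  character and \<open>\<beta> \<in> B\<close>\<close>
definition polar_scale :: "real \<Rightarrow> ('n::finite lat \<Rightarrow> complex) \<Rightarrow> 'n lat \<Rightarrow> complex" where
  "polar_scale \<epsilon> t = (\<lambda>x. sgn (t x) * complex_of_real (cmod (t x) powr \<epsilon>))"

definition sigma :: "real \<Rightarrow> ('n::finite lat \<Rightarrow> complex) \<Rightarrow> complex ^ 'n \<Rightarrow> 'n lat \<Rightarrow> complex" where
  "sigma \<epsilon> t \<beta> = texp (polar_scale \<epsilon> t) (complex_of_real \<epsilon> *s \<beta>)"

definition holomorphic_near_0 :: "(complex ^ 'n::finite \<Rightarrow> complex) \<Rightarrow> bool" where
  "holomorphic_near_0 f \<longleftrightarrow> (\<exists>\<delta>>0. \<forall>\<beta>. norm \<beta> < \<delta> \<longrightarrow>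
     (\<exists>D. (f has_derivative D) (at \<beta>) \<and> (\<forall>c u. D (c *s u) = c * D u)))"

text \<open>\<open>U = W\<^sub>0(t exp B)\<close> is a disjoint union of small balls around the points of \<open>W\<^sub>0t\<close>, so an analytic
  function on \<open>U\<close> is given by a family \<open>f\<close>, \<open>f t' \<beta>\<close> being its value at \<open>t' exp \<beta>\<close>.  Here \<open>M\<close> is its
  action in the extension of \<open>\<rho>\<close> (with central character \<open>W\<^sub>0t\<close>) to the analytic localization: it acts as any
  \<open>a \<in> \<complex>[X]\<close> having the same Taylor expansion below order \<open>d = dim \<rho>\<close> at the points of \<open>W\<^sub>0t\<close>.\<close>
definition analytic_action ::
  "('n::finite) affine_hecke \<Rightarrow> 'n pt \<Rightarrow> nat \<Rightarrow> (('n aff \<Rightarrow> complex) \<Rightarrow> complex mat) \<Rightarrow> ('n lat \<Rightarrow> complex) \<Rightarrow>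
   (('n lat \<Rightarrow> complex) \<Rightarrow> complex ^ 'n \<Rightarrow> complex) \<Rightarrow> complex mat \<Rightarrow> bool" where
  "analytic_action H v d \<rho> t f M \<longleftrightarrow>
     (\<forall>t'\<in>W0_orbit H t. holomorphic_near_0 (f t')) \<and>
     (\<exists>a. finite {x. a x \<noteq> 0} \<and> M = \<rho> (theta_comb H v a) \<and>
        (\<forall>t'\<in>W0_orbit H t. \<exists>K. \<exists>\<delta>>0. \<forall>\<beta>. norm \<beta> < \<delta> \<longrightarrow>
           cmod ((\<Sum>x\<in>{x. a x \<noteq> 0}. a x * texp t' \<beta> x) - f t' \<beta>) \<le> K * norm \<beta> ^ d))"

definition Pp :: "('n::finite, 'z) root_datum_scheme \<Rightarrow> 'n pt \<Rightarrow> 'n lat \<Rightarrow> complex" where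
  "Pp D v \<alpha> = v (refl D \<alpha>) * v (refl' D \<alpha>)"

definition Dp :: "('n::finite, 'z) root_datum_scheme \<Rightarrow> 'n pt \<Rightarrow> 'n lat \<Rightarrow> complex" where
  "Dp D v \<alpha> = v (refl D \<alpha>) / v (refl' D \<alpha>)"

text \<open>Numerator and denominator of \<open>c\<^sub>\<alpha>\<close> at the point \<open>u \<in> T\<close>.\<close>
definition c_num :: "('n::finite, 'z) root_datum_scheme \<Rightarrow> 'n pt \<Rightarrow> 'n lat \<Rightarrow> ('n lat \<Rightarrow> complex) \<Rightarrow> complex" where
  "c_num D v \<alpha> u = (if coroot_even D \<alpha>
     then (1 + inverse (Dp D v \<alpha>) * u (- \<alpha>)) * (1 - inverse (Pp D v \<alpha>) * u (- \<alpha>))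
     else 1 - inverse ((v (refl D \<alpha>))\<^sup>2) * u (- \<alpha>))"

definition c_den :: "('n::finite, 'z) root_datum_scheme \<Rightarrow> 'n lat \<Rightarrow> ('n lat \<Rightarrow> complex) \<Rightarrow> complex" where
  "c_den D \<alpha> u = (if coroot_even D \<alpha> then 1 - u (- (2 *s \<alpha>)) else 1 - u (- \<alpha>))"

text \<open>\<open>\<rho>\<epsilon> = \<rho> \<circ> j\<^sub>\<epsilon>\<inverse>\<close>.  The first clause is \<open>j\<^sub>\<epsilon>(f) = f \<circ> \<sigma>\<^sub>\<epsilon>\<inverse>\<close> for \<open>f = x \<circ> \<sigma>\<^sub>\<epsilon>\<close>, \<open>x \<in> X\<close>.  The second is
  \<open>j\<^sub>\<epsilon>(\<iota>\<^sub>\<alpha>) = \<iota>\<^sub>\<alpha>\<close>: since \<open>1 + v N = (1 + \<iota>\<^sub>\<alpha>) v\<^sup>2 c\<^sub>\<alpha>\<close>, it says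
  \<open>j\<^sub>\<epsilon>(1 + v N) = (1 + v\<^sup>\<epsilon> N) (g \<circ> \<sigma>\<^sub>\<epsilon>\<inverse>)\<close> with the analytic function
  \<open>g = v\<^sup>2 c\<^sub>\<alpha> / (v\<^sup>2\<^sup>\<epsilon> c\<^sub>\<alpha>\<^sup>\<epsilon> \<circ> \<sigma>\<^sub>\<epsilon>)\<close>, defined below by clearing denominators.\<close>
definition scaled_rep ::
  "('n::finite) affine_hecke \<Rightarrow> 'n pt \<Rightarrow> nat \<Rightarrow> (('n aff \<Rightarrow> complex) \<Rightarrow> complex mat) \<Rightarrow> ('n lat \<Rightarrow> complex) \<Rightarrow>
   real \<Rightarrow> (('n aff \<Rightarrow> complex) \<Rightarrow> complex mat) \<Rightarrow> bool" where
  "scaled_rep H v d \<rho> t \<epsilon> \<rho>\<epsilon> \<longleftrightarrow>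
     rep H (pt_powr v \<epsilon>) d \<rho>\<epsilon> \<and>
     (\<forall>x. analytic_action H v d \<rho> t (\<lambda>t' \<beta>. sigma \<epsilon> t' \<beta> x) (\<rho>\<epsilon> (theta_at H (pt_powr v \<epsilon>) x))) \<and>
     (\<forall>\<alpha>\<in>simples H. \<exists>g G. analytic_action H v d \<rho> t g G \<and>
        (\<forall>t'\<in>W0_orbit H t. \<exists>\<delta>>0. \<forall>\<beta>. norm \<beta> < \<delta> \<longrightarrow>
           g t' \<beta> * ((pt_powr v \<epsilon> (refl H \<alpha>))\<^sup>2 * c_num H (pt_powr v \<epsilon>) \<alpha> (sigma \<epsilon> t' \<beta>) * c_den H \<alpha> (texp t' \<beta>))
           = (v (refl H \<alpha>))\<^sup>2 * c_num H v \<alpha> (texp t' \<beta>) * c_den H \<alpha> (sigma \<epsilon> t' \<beta>)) \<and>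
        \<rho> (\<lambda>u. Nb id u + v (refl H \<alpha>) * Nb (refl H \<alpha>) u) =
        \<rho>\<epsilon> (\<lambda>u. Nb id u + pt_powr v \<epsilon> (refl H \<alpha>) * Nb (refl H \<alpha>) u) * G)"

definition scaling_limit ::
  "('n::finite) affine_hecke \<Rightarrow> 'n pt \<Rightarrow> nat \<Rightarrow> (('n aff \<Rightarrow> complex) \<Rightarrow> complex mat) \<Rightarrow>
   (('n aff \<Rightarrow> complex) \<Rightarrow> complex mat) \<Rightarrow> bool" where
  "scaling_limit H v d \<rho> \<rho>0 \<longleftrightarrow> rep H v d \<rho> \<and> rep H one_pt d \<rho>0 \<and>
     (\<exists>t R. central_char H v d \<rho> t \<and> (\<forall>\<epsilon>\<in>{0<..1}. scaled_rep H v d \<rho> t \<epsilon> (R \<epsilon>)) \<and>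
        (\<forall>w\<in>Wgrp H. \<forall>i<d. \<forall>j<d.
           ((\<lambda>\<epsilon>. R \<epsilon> (Nb w) $$ (i, j)) \<longlongrightarrow> \<rho>0 (Nb w) $$ (i, j)) (at_right 0)))"

text \<open>Graph of \<open>sp\<^sub>v\<close> on virtual characters: additive extension from modules with central character.\<close>
inductive sp :: "('n::finite) affine_hecke \<Rightarrow> 'n pt \<Rightarrow> ('n aff \<Rightarrow> complex) \<Rightarrow> ('n aff \<Rightarrow> complex) set \<Rightarrow> bool"
  for H v where
  "scaling_limit H v d \<rho> \<rho>0 \<Longrightarrow> sp H v (chr H \<rho>) (ell_class H one_pt (chr H \<rho>0))"
| "sp H v f A \<Longrightarrow> sp H v g B \<Longrightarrow> sp H v (\<lambda>w. f w - g w) (cls_diff A B)"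

section \<open>The basis \<open>B\<^sub>g\<^sub>m\<close> and Dirac induction\<close>

inductive_set lattice_gen ::
  "('n::finite) affine_hecke \<Rightarrow> ('n aff \<Rightarrow> complex) set set \<Rightarrow> ('n aff \<Rightarrow> complex) set set" for H G where
  "ell_class H one_pt (\<lambda>_. 0) \<in> lattice_gen H G"
| "A \<in> G \<Longrightarrow> A \<in> lattice_gen H G"
| "A \<in> lattice_gen H G \<Longrightarrow> B \<in> lattice_gen H G \<Longrightarrow> cls_diff A B \<in> lattice_gen H G"

definition Ygm :: "('n::finite) affine_hecke \<Rightarrow> ('n aff \<Rightarrow> complex) set set" where
  "Ygm H = lattice_gen H {A. \<exists>v\<in>Qpos H. \<exists>\<chi>. ds_char H v \<chi> \<and> sp H v \<chi> A}"

definition is_Bgm :: "('n::finite) affine_hecke \<Rightarrow> ('n aff \<Rightarrow> complex) set set \<Rightarrow> bool" where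
  "is_Bgm H B \<longleftrightarrow> B \<subseteq> Ygm H \<and> lattice_gen H B = Ygm H \<and>
     (\<forall>b\<in>B. \<forall>b'\<in>B. EP H b b' = (if b = b' then 1 else 0))"

definition Qreg :: "('n::finite) affine_hecke \<Rightarrow> ('n aff \<Rightarrow> complex) set \<Rightarrow> 'n pt set" where
  "Qreg H b = {v \<in> Qpos H. \<exists>\<chi>. ds_char H v \<chi> \<and> (sp H v \<chi> b \<or> sp H v \<chi> (cls_neg b))}"

inductive_set virtual_ds :: "('n::finite) affine_hecke \<Rightarrow> 'n pt \<Rightarrow> ('n aff \<Rightarrow> complex) set" for H v where
  "(\<lambda>_. 0) \<in> virtual_ds H v"
| "f \<in> virtual_ds H v \<Longrightarrow> ds_char H v \<chi> \<Longrightarrow> (\<lambda>w. f w + \<chi> w) \<in> virtual_ds H v"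
| "f \<in> virtual_ds H v \<Longrightarrow> ds_char H v \<chi> \<Longrightarrow> (\<lambda>w. f w - \<chi> w) \<in> virtual_ds H v"

text \<open>\<open>eps b v\<close> and \<open>Ind b v\<close> are \<open>\<epsilon>(b;v)\<close> and \<open>Ind\<^sub>D(b;v)\<close>.\<close>
definition is_dirac_induction ::
  "('n::finite) affine_hecke \<Rightarrow> ('n aff \<Rightarrow> complex) set set \<Rightarrow>
   (('n aff \<Rightarrow> complex) set \<Rightarrow> 'n pt \<Rightarrow> 'n aff \<Rightarrow> complex) \<Rightarrow> (('n aff \<Rightarrow> complex) set \<Rightarrow> 'n pt \<Rightarrow> int) \<Rightarrow> bool" where
  "is_dirac_induction H B Ind eps \<longleftrightarrow> (\<forall>b\<in>B. \<forall>v\<in>Qreg H b.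
     Ind b v \<in> virtual_ds H v \<and> sp H v (Ind b v) b \<and>
     eps b v \<in> {1, - 1} \<and> ds_char H v (\<lambda>w. of_int (eps b v) * Ind b v w))"

section \<open>Generic residual points\<close>

text \<open>\<open>r \<in> Hom(X, \<Lambda>\<^sup>\<times>)\<close>; \<open>r x v\<close> is the value at \<open>v\<close> of \<open>x(r)\<close>.\<close>
definition generic_points :: "('n::finite, 'z) root_datum_scheme \<Rightarrow> ('n lat \<Rightarrow> 'n pt \<Rightarrow> complex) set" where
  "generic_points D = {r. (\<forall>x. r x \<in> Lam D) \<and> r 0 = on_set (QC D) (\<lambda>_. 1) \<and>
     (\<forall>x y. r (x + y) = (\<lambda>p. r x p * r y p))}"

definition R1 :: "('n::finite, 'z) root_datum_scheme \<Rightarrow> 'n lat set" where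
  "R1 D = {\<alpha> \<in> roots D. \<not> coroot_even D \<alpha>} \<union> {2 *s \<alpha> | \<alpha>. \<alpha> \<in> roots D \<and> coroot_even D \<alpha>}"

definition fac_num :: "('n::finite lat \<Rightarrow> 'n pt \<Rightarrow> complex) \<Rightarrow> 'n lat \<Rightarrow> 'n pt \<Rightarrow> complex" where
  "fac_num r \<alpha> = (\<lambda>p. r (- \<alpha>) p - 1)"

definition fac_den1 :: "('n::finite, 'z) root_datum_scheme \<Rightarrow> ('n lat \<Rightarrow> 'n pt \<Rightarrow> complex) \<Rightarrow> 'n lat \<Rightarrow> 'n pt \<Rightarrow> complex" where
  "fac_den1 D r \<alpha> = (\<lambda>p. inverse ((p (refl D \<alpha>))\<^sup>2) * r (- \<alpha>) p - 1)"

definition fac_den2 :: "('n::finite, 'z) root_datum_scheme \<Rightarrow> ('n lat \<Rightarrow> 'n pt \<Rightarrow> complex) \<Rightarrow> 'n lat \<Rightarrow> 'n pt \<Rightarrow> complex" where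
  "fac_den2 D r \<alpha> = (\<lambda>p. inverse (Dp D p \<alpha>) * r (- \<alpha>) p + 1)"

definition fac_den3 :: "('n::finite, 'z) root_datum_scheme \<Rightarrow> ('n lat \<Rightarrow> 'n pt \<Rightarrow> complex) \<Rightarrow> 'n lat \<Rightarrow> 'n pt \<Rightarrow> complex" where
  "fac_den3 D r \<alpha> = (\<lambda>p. inverse (Pp D p \<alpha>) * r (- \<alpha>) p - 1)"

definition zero_on_QC :: "('n::finite, 'z) root_datum_scheme \<Rightarrow> ('n pt \<Rightarrow> complex) \<Rightarrow> bool" where
  "zero_on_QC D f \<longleftrightarrow> (\<forall>p\<in>QC D. f p = 0)"

definition odd_roots :: "('n::finite, 'z) root_datum_scheme \<Rightarrow> 'n lat set" where
  "odd_roots D = {\<alpha> \<in> roots D. \<not> coroot_even D \<alpha>}"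

definition even_roots :: "('n::finite, 'z) root_datum_scheme \<Rightarrow> 'n lat set" where
  "even_roots D = {\<alpha> \<in> roots D. coroot_even D \<alpha>}"

definition generic_residual :: "('n::finite, 'z) root_datum_scheme \<Rightarrow> ('n lat \<Rightarrow> 'n pt \<Rightarrow> complex) \<Rightarrow> bool" where
  "generic_residual D r \<longleftrightarrow> r \<in> generic_points D \<and>
     int (card {\<alpha> \<in> odd_roots D. zero_on_QC D (fac_den1 D r \<alpha>)}
        + card {\<alpha> \<in> even_roots D. zero_on_QC D (fac_den2 D r \<alpha>)}
        + card {\<alpha> \<in> even_roots D. zero_on_QC D (fac_den3 D r \<alpha>)})
     - int (card {\<alpha> \<in> R1 D. zero_on_QC D (fac_num r \<alpha>)}) = int CARD('n)"

definition longest :: "('n::finite, 'z) root_datum_scheme \<Rightarrow> 'n aff" where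
  "longest D = (THE w. w \<in> W0 D \<and> (\<forall>u\<in>W0 D. len D u \<le> len D w))"

text \<open>\<open>v(w)\<close>, multiplicatively along a reduced expression\<close>
definition v_of :: "('n::finite, 'z) root_datum_scheme \<Rightarrow> 'n pt \<Rightarrow> 'n aff \<Rightarrow> complex" where
  "v_of D v w = (THE c. \<exists>ss. set ss \<subseteq> simple_refls D \<and> foldr (\<circ>) ss id = w \<and>
     length ss = len D w \<and> c = prod_list (map v ss))"

definition mass_num :: "('n::finite, 'z) root_datum_scheme \<Rightarrow> ('n lat \<Rightarrow> 'n pt \<Rightarrow> complex) \<Rightarrow> 'n pt \<Rightarrow> complex" where
  "mass_num D r p = (\<Prod>\<alpha>\<in>{\<alpha> \<in> R1 D. \<not> zero_on_QC D (fac_num r \<alpha>)}. fac_num r \<alpha> p)"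

definition mass_den :: "('n::finite, 'z) root_datum_scheme \<Rightarrow> ('n lat \<Rightarrow> 'n pt \<Rightarrow> complex) \<Rightarrow> 'n pt \<Rightarrow> complex" where
  "mass_den D r p = (v_of D p (longest D))\<^sup>2 *
     (\<Prod>\<alpha>\<in>{\<alpha> \<in> odd_roots D. \<not> zero_on_QC D (fac_den1 D r \<alpha>)}. fac_den1 D r \<alpha> p) *
     (\<Prod>\<alpha>\<in>{\<alpha> \<in> even_roots D. \<not> zero_on_QC D (fac_den2 D r \<alpha>)}. fac_den2 D r \<alpha> p) *
     (\<Prod>\<alpha>\<in>{\<alpha> \<in> even_roots D. \<not> zero_on_QC D (fac_den3 D r \<alpha>)}. fac_den3 D r \<alpha> p)"

text \<open>The rational function \<open>m\<^bsub>W\<^sub>0r\<^esub>\<close> is regular at \<open>p\<close> with value \<open>c\<close>.  Numerator and denominator may have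
  common zeros at \<open>p\<close>, hence the passage to another representative \<open>f/g\<close>.\<close>
definition mass_value :: "('n::finite, 'z) root_datum_scheme \<Rightarrow> ('n lat \<Rightarrow> 'n pt \<Rightarrow> complex) \<Rightarrow> 'n pt \<Rightarrow> complex \<Rightarrow> bool" where
  "mass_value D r p c \<longleftrightarrow> p \<in> QC D \<and> (\<exists>f\<in>Lam D. \<exists>g\<in>Lam D. g p \<noteq> 0 \<and>
     (\<forall>q\<in>QC D. mass_num D r q * g q = f q * mass_den D r q) \<and> c = f p / g p)"

definition mass :: "('n::finite, 'z) root_datum_scheme \<Rightarrow> ('n lat \<Rightarrow> 'n pt \<Rightarrow> complex) \<Rightarrow> 'n pt \<Rightarrow> complex" where
  "mass D r p = (THE c. mass_value D r p c)"

text \<open>\<open>rb b\<close> represents the orbit \<open>W\<^sub>0r\<^sub>b\<close>.\<close>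
definition is_generic_cc ::
  "('n::finite) affine_hecke \<Rightarrow> ('n aff \<Rightarrow> complex) set set \<Rightarrow>
   (('n aff \<Rightarrow> complex) set \<Rightarrow> 'n pt \<Rightarrow> 'n aff \<Rightarrow> complex) \<Rightarrow> (('n aff \<Rightarrow> complex) set \<Rightarrow> 'n pt \<Rightarrow> int) \<Rightarrow>
   (('n aff \<Rightarrow> complex) set \<Rightarrow> 'n lat \<Rightarrow> 'n pt \<Rightarrow> complex) \<Rightarrow> bool" where
  "is_generic_cc H B Ind eps rb \<longleftrightarrow> (\<forall>b\<in>B.
     generic_residual H (rb b) \<and>
     Qreg H b = {v \<in> Qpos H. \<exists>c. c \<noteq> 0 \<and> mass_value H (rb b) v c} \<and>
     (\<forall>v\<in>Qreg H b. \<forall>d \<rho>. discrete_series H v d \<rho> \<and> chr H \<rho> = (\<lambda>w. of_int (eps b v) * Ind b v w) \<longrightarrow>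
        central_char H v d \<rho> (\<lambda>x. rb b x v)))"

definition DS ::
  "('n::finite) affine_hecke \<Rightarrow> ('n aff \<Rightarrow> complex) set set \<Rightarrow>
   (('n aff \<Rightarrow> complex) set \<Rightarrow> 'n pt \<Rightarrow> 'n aff \<Rightarrow> complex) \<Rightarrow> (('n aff \<Rightarrow> complex) set \<Rightarrow> 'n pt \<Rightarrow> int) \<Rightarrow>
   (('n aff \<Rightarrow> complex) set \<Rightarrow> 'n lat \<Rightarrow> 'n pt \<Rightarrow> complex) \<Rightarrow> ('n lat \<Rightarrow> 'n pt \<Rightarrow> complex) \<Rightarrow>
   'n pt \<Rightarrow> ('n aff \<Rightarrow> complex) set" where
  "DS H B Ind eps rb r v = {\<lambda>w. of_int (eps b v) * Ind b v w | b.
     b \<in> B \<and> W0_orbit H (rb b) = W0_orbit H r \<and> v \<in> Qreg H b}"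

section \<open>The curve\<close>

definition zeros :: "('n::finite, 'z) root_datum_scheme \<Rightarrow> ('n pt \<Rightarrow> complex) set \<Rightarrow> 'n pt set" where
  "zeros D F = {p \<in> QC D. \<forall>f\<in>F. f p = 0}"

definition zariski_closed :: "('n::finite, 'z) root_datum_scheme \<Rightarrow> 'n pt set \<Rightarrow> bool" where
  "zariski_closed D Z \<longleftrightarrow> (\<exists>F \<subseteq> Lam D. Z = zeros D F)"

text \<open>Dimension one: infinite, with all proper closed subsets finite.\<close>
definition irreducible_curve :: "('n::finite, 'z) root_datum_scheme \<Rightarrow> 'n pt set \<Rightarrow> bool" where
  "irreducible_curve D Z \<longleftrightarrow> zariski_closed D Z \<and>
     (\<forall>Z1 Z2. zariski_closed D Z1 \<and> zariski_closed D Z2 \<and> Z = Z1 \<union> Z2 \<longrightarrow> Z = Z1 \<or> Z = Z2) \<and>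
     infinite Z \<and> (\<forall>Z'. zariski_closed D Z' \<and> Z' \<subset> Z \<longrightarrow> finite Z')"

text \<open>Jacobian criterion: the Zariski tangent space at \<open>p\<close> (in logarithmic coordinates \<open>p exp(z \<xi>)\<close> on the
  torus) is a line.\<close>
definition tangent :: "('n::finite, 'z) root_datum_scheme \<Rightarrow> 'n pt set \<Rightarrow> 'n pt \<Rightarrow> 'n pt set" where
  "tangent D Z p = {\<xi>. (\<forall>s\<in>reflections D. \<forall>w\<in>Wgrp D. \<xi> (w \<circ> s \<circ> ginv w) = \<xi> s) \<and>
     (\<forall>g. g \<notin> reflections D \<longrightarrow> \<xi> g = 0) \<and>
     (\<forall>f\<in>Lam D. (\<forall>q\<in>Z. f q = 0) \<longrightarrow>
        ((\<lambda>z. f (\<lambda>s. p s * exp (z * \<xi> s))) has_field_derivative 0) (at (0::complex)))}"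

definition smooth_point :: "('n::finite, 'z) root_datum_scheme \<Rightarrow> 'n pt set \<Rightarrow> 'n pt \<Rightarrow> bool" where
  "smooth_point D Z p \<longleftrightarrow> p \<in> Z \<and> (\<exists>\<xi>0. \<xi>0 \<noteq> (\<lambda>_. 0) \<and> tangent D Z p = {\<lambda>s. c * \<xi>0 s | c. True})"

text \<open>Closure and boundary inside \<open>Q\<close>, whose topology is induced by the product topology.\<close>
definition closure_Q :: "('n::finite, 'z) root_datum_scheme \<Rightarrow> 'n pt set \<Rightarrow> 'n pt set" where
  "closure_Q D C = Qpos D \<inter> closure C"

definition boundary_Q :: "('n::finite, 'z) root_datum_scheme \<Rightarrow> 'n pt set \<Rightarrow> 'n pt set" where
  "boundary_Q D C = closure_Q D C \<inter> closure_Q D (Qpos D - C)"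

definition admissible_curve ::
  "('n::finite) affine_hecke \<Rightarrow> 'n pt set \<Rightarrow> 'n pt \<Rightarrow> 'n pt set \<Rightarrow> bool" where
  "admissible_curve H C v0 Z \<longleftrightarrow>
     irreducible_curve H Z \<and>
     (\<exists>F \<subseteq> laurent H \<real>. Z = zeros H F) \<and>
     connected (Z \<inter> Qpos H) \<and> (\<forall>Z'. zariski_closed H Z' \<and> Z \<inter> Qpos H \<subseteq> Z' \<longrightarrow> Z \<subseteq> Z') \<and>
     Z \<inter> C \<noteq> {} \<and> v0 \<in> Z \<and>
     \<not> Z \<subseteq> (\<Union>r'\<in>{r'. generic_residual H r'}. {p. mass_value H r' p 0}) \<and>
     (\<forall>p\<in>Z \<inter> closure_Q H C. smooth_point H Z p)"

definition smooth_open_nbhd ::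
  "('n::finite) affine_hecke \<Rightarrow> 'n pt set \<Rightarrow> 'n pt set \<Rightarrow> 'n pt set \<Rightarrow> bool" where
  "smooth_open_nbhd H C Z U \<longleftrightarrow> U \<subseteq> Z \<and> zariski_closed H (Z - U) \<and> Z \<inter> closure_Q H C \<subseteq> U \<and>
     (\<forall>p\<in>U. smooth_point H Z p)"

definition regular_functions :: "('n::finite, 'z) root_datum_scheme \<Rightarrow> 'n pt set \<Rightarrow> ('n pt \<Rightarrow> complex) set" where
  "regular_functions D U = {f. (\<forall>p. p \<notin> U \<longrightarrow> f p = 0) \<and>
     (\<forall>u\<in>U. \<exists>g\<in>Lam D. \<exists>h\<in>Lam D. h u \<noteq> 0 \<and> (\<forall>p\<in>U. h p \<noteq> 0 \<longrightarrow> f p = g p / h p))}"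

text \<open>\<open>Sg w\<close> is the function \<open>\<Sigma>(N\<^sub>w)\<close>, by linearity these determine \<open>\<Sigma>\<close>; the coefficient is \<open>c\<^bsub>\<chi>,C\<^esub>\<close>.\<close>
definition is_Sigma ::
  "('n::finite) affine_hecke \<Rightarrow> ('n aff \<Rightarrow> complex) set set \<Rightarrow>
   (('n aff \<Rightarrow> complex) set \<Rightarrow> 'n pt \<Rightarrow> 'n aff \<Rightarrow> complex) \<Rightarrow> (('n aff \<Rightarrow> complex) set \<Rightarrow> 'n pt \<Rightarrow> int) \<Rightarrow>
   (('n aff \<Rightarrow> complex) set \<Rightarrow> 'n lat \<Rightarrow> 'n pt \<Rightarrow> complex) \<Rightarrow> ('n lat \<Rightarrow> 'n pt \<Rightarrow> complex) \<Rightarrow>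
   'n pt set \<Rightarrow> 'n pt set \<Rightarrow> 'n pt set \<Rightarrow> ('n aff \<Rightarrow> 'n pt \<Rightarrow> complex) \<Rightarrow> bool" where
  "is_Sigma H B Ind eps rb r C Z U Sg \<longleftrightarrow>
     (\<forall>w\<in>Wgrp H. Sg w \<in> regular_functions H U \<and>
        (\<forall>v\<in>Z \<inter> C. Sg w v =
           (\<Sum>\<chi>\<in>DS H B Ind eps rb r v. complex_of_real (fdeg H v \<chi> / cmod (mass H r v)) * \<chi> w)))"

section \<open>The algebraic model\<close>

text \<open>\<open>\<kappa>\<close> embeds the ring of regular functions on \<open>U\<close> into an algebraically closed field, inside which
  all field extensions are taken.\<close>
definition ring_embedding ::
  "('n::finite, 'z) root_datum_scheme \<Rightarrow> 'n pt set \<Rightarrow> (('n pt \<Rightarrow> complex) \<Rightarrow> 'l::field) \<Rightarrow> bool" where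
  "ring_embedding D U \<kappa> \<longleftrightarrow> inj_on \<kappa> (regular_functions D U) \<and> \<kappa> (on_set U (\<lambda>_. 1)) = 1 \<and>
     (\<forall>f\<in>regular_functions D U. \<forall>g\<in>regular_functions D U.
        \<kappa> (\<lambda>p. f p + g p) = \<kappa> f + \<kappa> g \<and> \<kappa> (\<lambda>p. f p * g p) = \<kappa> f * \<kappa> g)"

definition reg_ring ::
  "('n::finite, 'z) root_datum_scheme \<Rightarrow> 'n pt set \<Rightarrow> (('n pt \<Rightarrow> complex) \<Rightarrow> 'l::field) \<Rightarrow> 'l set" where
  "reg_ring D U \<kappa> = \<kappa> ` regular_functions D U"

definition fraction_field :: "'l::field set \<Rightarrow> 'l set" where
  "fraction_field R = {a / b | a b. a \<in> R \<and> b \<in> R \<and> b \<noteq> 0}"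

definition is_subfield :: "'l::field set \<Rightarrow> bool" where
  "is_subfield F \<longleftrightarrow> 0 \<in> F \<and> 1 \<in> F \<and>
     (\<forall>x\<in>F. \<forall>y\<in>F. x + y \<in> F \<and> x * y \<in> F) \<and> (\<forall>x\<in>F. - x \<in> F \<and> inverse x \<in> F)"

definition finite_extension :: "'l::field set \<Rightarrow> 'l set \<Rightarrow> bool" where
  "finite_extension K F \<longleftrightarrow> is_subfield F \<and> K \<subseteq> F \<and>
     (\<exists>bs. finite bs \<and> bs \<subseteq> F \<and> (\<forall>x\<in>F. \<exists>c. (\<forall>b\<in>bs. c b \<in> K) \<and> x = (\<Sum>b\<in>bs. c b * b)))"

definition field_embedding :: "'l::field set \<Rightarrow> 'l set \<Rightarrow> ('l \<Rightarrow> 'l) \<Rightarrow> bool" where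
  "field_embedding K F \<tau> \<longleftrightarrow> (\<forall>x\<in>K. \<tau> x = x) \<and>
     (\<forall>x\<in>F. \<forall>y\<in>F. \<tau> (x + y) = \<tau> x + \<tau> y \<and> \<tau> (x * y) = \<tau> x * \<tau> y)"

text \<open>Compositum of all conjugates over \<open>K\<close> of the fields \<open>F i\<close>, \<open>i < s\<close>\<close>
definition compositum :: "'l::field set \<Rightarrow> nat \<Rightarrow> (nat \<Rightarrow> 'l set) \<Rightarrow> 'l set" where
  "compositum K s F = \<Inter> {E. is_subfield E \<and> K \<subseteq> E \<and>
     (\<forall>i<s. \<forall>\<tau>. field_embedding K (F i) \<tau> \<longrightarrow> \<tau> ` F i \<subseteq> E)}"

definition integral_closure_in :: "'l::field set \<Rightarrow> 'l set \<Rightarrow> 'l set" where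
  "integral_closure_in R F = {x \<in> F. \<exists>q. lead_coeff q = 1 \<and> (\<forall>k. coeff q k \<in> R) \<and> poly q x = 0}"

text \<open>Structure constants of \<open>\<H>\<close> over a ring of functions on \<open>U\<close>\<close>
definition mulc_on ::
  "('n::finite) affine_hecke \<Rightarrow> 'n pt set \<Rightarrow> (('n pt \<Rightarrow> complex) \<Rightarrow> 'l) \<Rightarrow> 'n aff \<Rightarrow> 'n aff \<Rightarrow> 'n aff \<Rightarrow> 'l" where
  "mulc_on H U \<kappa> = (\<lambda>x y u. \<kappa> (on_set U (mulc H x y u)))"

text \<open>Linear functionals on \<open>\<H>\<close> are given by their values on \<open>N\<^sub>w\<close>; \<open>(a f b)(h) = f(b h a)\<close>.\<close>
definition fun_eval :: "('w \<Rightarrow> 'l::comm_ring_1) \<Rightarrow> ('w \<Rightarrow> 'l) \<Rightarrow> 'l" where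
  "fun_eval f h = (\<Sum>u\<in>{u. h u \<noteq> 0}. h u * f u)"

definition bi_act ::
  "('n::finite, 'z) root_datum_scheme \<Rightarrow> ('n aff \<Rightarrow> 'n aff \<Rightarrow> 'n aff \<Rightarrow> 'l::comm_ring_1) \<Rightarrow>
   ('n aff \<Rightarrow> 'l) \<Rightarrow> ('n aff \<Rightarrow> 'l) \<Rightarrow> ('n aff \<Rightarrow> 'l) \<Rightarrow> 'n aff \<Rightarrow> 'l" where
  "bi_act D c a f b = (\<lambda>w. if w \<in> Wgrp D then fun_eval f (hmul c (hmul c b (Nb w)) a) else 0)"

text \<open>The \<open>\<H>\<^sub>A\<close>-sub-bimodule generated by \<open>S\<close>.  For \<open>A \<supseteq> \<RR>(\<UU>)\<close> this is the image of \<open>M \<otimes> A\<close> in the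
  functionals on \<open>\<H>\<^sub>A\<close>; for the rings \<open>A\<close> used here \<open>M \<otimes> A\<close> embeds.\<close>
inductive_set sub_bimodule ::
  "('n::finite, 'z) root_datum_scheme \<Rightarrow> ('n aff \<Rightarrow> 'n aff \<Rightarrow> 'n aff \<Rightarrow> 'l::comm_ring_1) \<Rightarrow>
   'l set \<Rightarrow> ('n aff \<Rightarrow> 'l) \<Rightarrow> ('n aff \<Rightarrow> 'l) set" for D c A S where
  "S \<in> sub_bimodule D c A S"
| "f \<in> sub_bimodule D c A S \<Longrightarrow> g \<in> sub_bimodule D c A S \<Longrightarrow> (\<lambda>w. f w + g w) \<in> sub_bimodule D c A S"
| "f \<in> sub_bimodule D c A S \<Longrightarrow> a \<in> hcarrier D A \<Longrightarrow> b \<in> hcarrier D A \<Longrightarrow>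
     bi_act D c a f b \<in> sub_bimodule D c A S"

text \<open>The element \<open>h\<Sigma>\<close>\<close>
definition left_act ::
  "('n::finite, 'z) root_datum_scheme \<Rightarrow> ('n aff \<Rightarrow> 'n aff \<Rightarrow> 'n aff \<Rightarrow> 'l::comm_ring_1) \<Rightarrow>
   ('n aff \<Rightarrow> 'l) \<Rightarrow> ('n aff \<Rightarrow> 'l) \<Rightarrow> 'n aff \<Rightarrow> 'l" where
  "left_act D c S h = bi_act D c h S (Nb id)"

definition mats_over :: "'l set \<Rightarrow> nat \<Rightarrow> 'l mat set" where
  "mats_over F d = {A \<in> carrier_mat d d. elements_mat A \<subseteq> F}"

definition vecs_over :: "'l set \<Rightarrow> nat \<Rightarrow> 'l Matrix.vec set" where
  "vecs_over F d = {x \<in> carrier_vec d. set\<^sub>v x \<subseteq> F}"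

text \<open>\<open>\<Psi>\<close> is an isomorphism of \<open>K\<close>-algebras from \<open>(M, mul)\<close> onto the direct sum of the matrix algebras of size
  \<open>d i\<close> over \<open>F i\<close>, \<open>i < s\<close>.\<close>
definition matrix_decomposition ::
  "'l::field set \<Rightarrow> ('w \<Rightarrow> 'l) set \<Rightarrow> (('w \<Rightarrow> 'l) \<Rightarrow> ('w \<Rightarrow> 'l) \<Rightarrow> 'w \<Rightarrow> 'l) \<Rightarrow> nat \<Rightarrow> (nat \<Rightarrow> nat) \<Rightarrow>
   (nat \<Rightarrow> 'l set) \<Rightarrow> (('w \<Rightarrow> 'l) \<Rightarrow> nat \<Rightarrow> 'l mat) \<Rightarrow> bool" where
  "matrix_decomposition K M mul s d F \<Psi> \<longleftrightarrow>
     (\<forall>i<s. d i > 0) \<and>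
     (\<forall>f\<in>M. \<forall>i<s. \<Psi> f i \<in> mats_over (F i) (d i)) \<and>
     (\<forall>f\<in>M. \<forall>g\<in>M. \<forall>i<s. \<Psi> (\<lambda>w. f w + g w) i = \<Psi> f i + \<Psi> g i \<and> \<Psi> (mul f g) i = \<Psi> f i * \<Psi> g i) \<and>
     (\<forall>c\<in>K. \<forall>f\<in>M. \<forall>i<s. \<Psi> (\<lambda>w. c * f w) i = c \<cdot>\<^sub>m \<Psi> f i) \<and>
     (\<forall>f\<in>M. \<forall>g\<in>M. (\<forall>i<s. \<Psi> f i = \<Psi> g i) \<longrightarrow> f = g) \<and>
     (\<forall>A. (\<forall>i<s. A i \<in> mats_over (F i) (d i)) \<longrightarrow> (\<exists>f\<in>M. \<forall>i<s. \<Psi> f i = A i))"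

inductive_set vec_span :: "'l::field set \<Rightarrow> nat \<Rightarrow> 'l Matrix.vec set \<Rightarrow> 'l Matrix.vec set" for A d G where
  "0\<^sub>v d \<in> vec_span A d G"
| "x \<in> vec_span A d G \<Longrightarrow> a \<in> A \<Longrightarrow> g \<in> G \<Longrightarrow> x + a \<cdot>\<^sub>v g \<in> vec_span A d G"

definition is_lattice :: "'l::field set \<Rightarrow> 'l set \<Rightarrow> nat \<Rightarrow> 'l Matrix.vec set \<Rightarrow> bool" where
  "is_lattice R F d L \<longleftrightarrow> (\<exists>G. finite G \<and> G \<subseteq> vecs_over F d \<and> L = vec_span R d G \<and>
     vec_span F d G = vecs_over F d)"

text \<open>\<open>mprod\<close> is the product on \<open>M\<close>; \<open>Kfield i\<close>, \<open>Kdim i\<close> are the centers and sizes of the matrix algebras in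
  \<open>M \<otimes> \<KK>\<close> and \<open>Kiso\<close> the decomposition; \<open>Liso\<close> is the splitting of \<open>M \<otimes> \<LL>\<close>, \<open>Llat i\<close> the lattice \<open>L\<^sub>i\<close>.\<close>
record ('n::finite, 'l) model =
  emb :: "(((int ^ 'n \<Rightarrow> int ^ 'n) \<Rightarrow> complex) \<Rightarrow> complex) \<Rightarrow> 'l"
  mprod :: "((int ^ 'n \<Rightarrow> int ^ 'n) \<Rightarrow> 'l) \<Rightarrow> ((int ^ 'n \<Rightarrow> int ^ 'n) \<Rightarrow> 'l) \<Rightarrow> (int ^ 'n \<Rightarrow> int ^ 'n) \<Rightarrow> 'l"
  Knum :: nat
  Kdim :: "nat \<Rightarrow> nat"
  Kfield :: "nat \<Rightarrow> 'l set"
  Kiso :: "((int ^ 'n \<Rightarrow> int ^ 'n) \<Rightarrow> 'l) \<Rightarrow> nat \<Rightarrow> 'l mat"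
  Lnum :: nat
  Ldim :: "nat \<Rightarrow> nat"
  Liso :: "((int ^ 'n \<Rightarrow> int ^ 'n) \<Rightarrow> 'l) \<Rightarrow> nat \<Rightarrow> 'l mat"
  Llat :: "nat \<Rightarrow> 'l Matrix.vec set"

definition KK :: "('n::finite) affine_hecke \<Rightarrow> 'n pt set \<Rightarrow> ('n, 'l::field) model \<Rightarrow> 'l set" where
  "KK H U m = fraction_field (reg_ring H U (emb m))"

definition LL :: "('n::finite) affine_hecke \<Rightarrow> 'n pt set \<Rightarrow> ('n, 'l::field) model \<Rightarrow> 'l set" where
  "LL H U m = compositum (KK H U m) (Knum m) (Kfield m)"

definition Rtilde :: "('n::finite) affine_hecke \<Rightarrow> 'n pt set \<Rightarrow> ('n, 'l::field) model \<Rightarrow> 'l set" where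
  "Rtilde H U m = integral_closure_in (reg_ring H U (emb m)) (LL H U m)"

text \<open>The functional \<open>\<Sigma>\<close> with values in the field\<close>
definition Sig :: "('n::finite) affine_hecke \<Rightarrow> ('n, 'l::field) model \<Rightarrow> ('n aff \<Rightarrow> 'n pt \<Rightarrow> complex) \<Rightarrow> 'n aff \<Rightarrow> 'l" where
  "Sig H m Sg = (\<lambda>w. if w \<in> Wgrp H then emb m (Sg w) else 0)"

definition Mmod ::
  "('n::finite) affine_hecke \<Rightarrow> 'n pt set \<Rightarrow> ('n, 'l::field) model \<Rightarrow> ('n aff \<Rightarrow> 'n pt \<Rightarrow> complex) \<Rightarrow> 'l set \<Rightarrow>
   ('n aff \<Rightarrow> 'l) set" where
  "Mmod H U m Sg A = sub_bimodule H (mulc_on H U (emb m)) A (Sig H m Sg)"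

definition is_model ::
  "('n::finite) affine_hecke \<Rightarrow> 'n pt set \<Rightarrow> ('n aff \<Rightarrow> 'n pt \<Rightarrow> complex) \<Rightarrow> ('n, 'l::alg_closed_field) model \<Rightarrow> bool" where
  "is_model H U Sg m \<longleftrightarrow>
     ring_embedding H U (emb m) \<and>
     (\<forall>a\<in>hcarrier H (LL H U m). \<forall>b\<in>hcarrier H (LL H U m).
        mprod m (left_act H (mulc_on H U (emb m)) (Sig H m Sg) a)
                (left_act H (mulc_on H U (emb m)) (Sig H m Sg) b)
        = left_act H (mulc_on H U (emb m)) (Sig H m Sg) (hmul (mulc_on H U (emb m)) a b)) \<and>
     (\<forall>i<Knum m. finite_extension (KK H U m) (Kfield m i)) \<and>
     matrix_decomposition (KK H U m) (Mmod H U m Sg (KK H U m)) (mprod m)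
        (Knum m) (Kdim m) (Kfield m) (Kiso m) \<and>
     matrix_decomposition (LL H U m) (Mmod H U m Sg (LL H U m)) (mprod m)
        (Lnum m) (Ldim m) (\<lambda>_. LL H U m) (Liso m) \<and>
     (\<forall>i<Lnum m. is_lattice (Rtilde H U m) (LL H U m) (Ldim m i) (Llat m i) \<and>
        (\<forall>f\<in>Mmod H U m Sg (Rtilde H U m). \<forall>x\<in>Llat m i. Liso m f i *\<^sub>v x \<in> Llat m i))"

text \<open>Points of the normalization of \<open>U\<close> in \<open>\<LL>\<close>: \<open>\<complex>\<close>-algebra homomorphisms from its coordinate ring to
  \<open>\<complex>\<close> (0 off the ring).  Pointwise convergence is the analytic topology.\<close>
definition Utilde ::
  "('n::finite) affine_hecke \<Rightarrow> 'n pt set \<Rightarrow> ('n, 'l::field) model \<Rightarrow> ('l \<Rightarrow> complex) set" where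
  "Utilde H U m = {e. (\<forall>x. x \<notin> Rtilde H U m \<longrightarrow> e x = 0) \<and>
     (\<forall>x\<in>Rtilde H U m. \<forall>y\<in>Rtilde H U m. e (x + y) = e x + e y \<and> e (x * y) = e x * e y) \<and>
     (\<forall>c. e (emb m (on_set U (\<lambda>_. c))) = c)}"

text \<open>\<open>\<phi>(e) = p\<close>\<close>
definition above :: "('n::finite) affine_hecke \<Rightarrow> 'n pt set \<Rightarrow> ('n, 'l::field) model \<Rightarrow> ('l \<Rightarrow> complex) \<Rightarrow> 'n pt \<Rightarrow> bool" where
  "above H U m e p \<longleftrightarrow> e \<in> Utilde H U m \<and> p \<in> U \<and> (\<forall>f\<in>regular_functions H U. e (emb m f) = f p)"

text \<open>\<open>\<rho>\<close> on \<open>\<complex>\<^sup>d\<close> realises the \<open>\<H>\<^sub>p\<close>-module \<open>L\<^sub>i \<otimes> \<complex>\<^sub>e = L\<^sub>i/\<mm>\<^sub>eL\<^sub>i\<close>, with quotient map \<open>\<pi>\<close>.\<close>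
definition is_specialization ::
  "('n::finite) affine_hecke \<Rightarrow> 'n pt set \<Rightarrow> ('n aff \<Rightarrow> 'n pt \<Rightarrow> complex) \<Rightarrow> ('n, 'l::field) model \<Rightarrow> nat \<Rightarrow>
   ('l \<Rightarrow> complex) \<Rightarrow> 'n pt \<Rightarrow> nat \<Rightarrow> (('n aff \<Rightarrow> complex) \<Rightarrow> complex mat) \<Rightarrow> bool" where
  "is_specialization H U Sg m i e p d \<rho> \<longleftrightarrow> rep H p d \<rho> \<and>
     (\<exists>\<pi>. \<pi> ` Llat m i = carrier_vec d \<and>
        (\<forall>x\<in>Llat m i. \<forall>y\<in>Llat m i. \<pi> (x + y) = \<pi> x + \<pi> y) \<and>
        (\<forall>a\<in>Rtilde H U m. \<forall>x\<in>Llat m i. \<pi> (a \<cdot>\<^sub>v x) = e a \<cdot>\<^sub>v \<pi> x) \<and>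
        (\<forall>x\<in>Llat m i. \<pi> x = 0\<^sub>v d \<longleftrightarrow>
           x \<in> vec_span {a \<in> Rtilde H U m. e a = 0} (Ldim m i) (Llat m i)) \<and>
        (\<forall>w\<in>Wgrp H. \<forall>x\<in>Llat m i.
           \<pi> (Liso m (left_act H (mulc_on H U (emb m)) (Sig H m Sg) (Nb w)) i *\<^sub>v x) = \<rho> (Nb w) *\<^sub>v \<pi> x))"

text \<open>The character of \<open>L\<^bsub>i,e\<^esub>\<close>, which is well defined up to isomorphism.\<close>
definition spec_char ::
  "('n::finite) affine_hecke \<Rightarrow> 'n pt set \<Rightarrow> ('n aff \<Rightarrow> 'n pt \<Rightarrow> complex) \<Rightarrow> ('n, 'l::field) model \<Rightarrow> nat \<Rightarrow>
   ('l \<Rightarrow> complex) \<Rightarrow> 'n pt \<Rightarrow> 'n aff \<Rightarrow> complex" where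
  "spec_char H U Sg m i e p =
     (SOME \<chi>. \<exists>d \<rho>. is_specialization H U Sg m i e p d \<rho> \<and> \<chi> = chr H \<rho>)"

text \<open>\<open>IndC\<close> is the virtual character \<open>Ind\<^sub>D(b,C;v\<^sub>0)\<close>, where \<open>\<epsilon>(b,C) = eC\<close>: the interval of the real curve from
  \<open>v\<close> to \<open>v\<^sub>0\<close> is \<open>\<gamma>\<close>, \<open>\<gamma>'\<close> is its lift, and \<open>L\<^sub>b = L\<^sub>i\<close>.\<close>
definition is_limit_ind ::
  "('n::finite) affine_hecke \<Rightarrow> (('n aff \<Rightarrow> complex) set \<Rightarrow> 'n pt \<Rightarrow> 'n aff \<Rightarrow> complex) \<Rightarrow>
   (('n aff \<Rightarrow> complex) set \<Rightarrow> 'n pt \<Rightarrow> int) \<Rightarrow> ('n aff \<Rightarrow> complex) set \<Rightarrow> 'n pt set \<Rightarrow> 'n pt \<Rightarrow> 'n pt set \<Rightarrow>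
   'n pt set \<Rightarrow> ('n aff \<Rightarrow> 'n pt \<Rightarrow> complex) \<Rightarrow> ('n, 'l::field) model \<Rightarrow> int \<Rightarrow> ('n aff \<Rightarrow> complex) \<Rightarrow> bool" where
  "is_limit_ind H Ind eps b C v0 Z U Sg m eC IndC \<longleftrightarrow>
     (\<exists>v e e0 \<gamma> \<gamma>' i.
        v \<in> Z \<inter> C \<and> above H U m e v \<and>
        arc \<gamma> \<and> path_image \<gamma> \<subseteq> Z \<inter> closure_Q H C \<and> pathstart \<gamma> = v \<and> pathfinish \<gamma> = v0 \<and>
        path \<gamma>' \<and> pathstart \<gamma>' = e \<and> pathfinish \<gamma>' = e0 \<and>
        (\<forall>t\<in>{0..1}. above H U m (\<gamma>' t) (\<gamma> t)) \<and>
        i < Lnum m \<and> spec_char H U Sg m i e v = (\<lambda>w. of_int (eps b v) * Ind b v w) \<and>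
        (\<forall>w. of_int eC * IndC w = spec_char H U Sg m i e0 v0 w))"

end

theory Submission
  imports Defs "Jordan_Normal_Form.Char_Poly"
begin

text \<open>Only temperedness is at stake once the specialization at \<open>v\<^sub>0\<close> is known to exist.  Fix a dominant \<open>x\<close>
  with orbit \<open>O = W\<^sub>0x\<close> and write \<open>r\<close> for the generic residual point.  On a discrete series with central
  character \<open>W\<^sub>0r(v)\<close> one has \<open>\<Prod>\<^bsub>y\<in>O\<^esub> (\<theta>\<^sub>x - r(y)(v)) = 0\<close>, and \<open>\<theta>\<^sub>x\<close> has no eigenvalue of modulus greater
  than 1.  Let \<open>A\<close> be the set of \<open>y \<in> O\<close> with \<open>|r(y)(v\<^sub>0)| \<le> 1\<close>.  At the points \<open>v\<close> of \<open>C\<close> on the curve close to \<open>v\<^sub>0\<close>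
  the factors outside \<open>A\<close> are therefore invertible, and \<open>q = \<Prod>\<^bsub>y\<in>A\<^esub> (\<theta>\<^sub>x - r(y))\<close> acts by 0 on all
  members of \<open>DS\<close>.  The arc to \<open>v\<^sub>0\<close> meets the complement of \<open>C\<close> in finitely many points, because the
  mass of \<open>r\<close> is zero or singular at finitely many points of the curve; so \<open>\<Sigma>(hq) = 0\<close> at
  infinitely many points of the curve, hence identically.  Thus \<open>q\<Sigma> = 0\<close>, \<open>q(v\<^sub>0)\<close> acts by 0 on the
  specialization at \<open>v\<^sub>0\<close>, and every eigenvalue of \<open>\<theta>\<^sub>x\<close> there is some \<open>r(y)(v\<^sub>0)\<close> with \<open>y \<in> A\<close>.\<close>

section \<open>Regular functions on the curve\<close>

text \<open>The relation over the orbit is a Cayley-Hamilton argument: \<open>\<theta>_x\<close> is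
  not central, but the symmetric functions of the \<open>\<theta>_y\<close>, \<open>y\<close> in the
  orbit, are. Replacing the values r(y) by \<open>\<theta>_y\<close> in them turns the product into
  that of the \<open>\<theta>_x - \<theta>_y\<close>, which has the zero factor
  \<open>y = x\<close>.

  The step from q\<Sigma> = 0 to the module rests on \<Sigma> being a trace. The product of the
  model is prescribed only on elements h\<Sigma>; sums of characters are traces, so the bimodule
  generated by \<Sigma> consists of such elements, \<Sigma> is its unit, and sending h to the matrix
  of h\<Sigma> is a unital representation that preserves the lattice.

  Existence of the specialization has to be proved because \<open>spec_char\<close> is a choice. The
  lattice is only finitely generated over the integral closure, with no basis given, so a basis of
  its reduction is extracted from a generating set that is minimal modulo the maximal ideal.
  Elements of the algebra at the point then act through lifts of their coefficients. This requires
  the integral closure to be a ring, which is derived from characteristic polynomials.\<close>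

lemma laurent_off_QC: "f \<in> laurent D K \<Longrightarrow> p \<notin> QC D \<Longrightarrow> f p = 0"
  by (induction rule: laurent.induct) (auto simp: on_set_def)

lemma continuous_on_pt_coord: "continuous_on A (\<lambda>p :: 'n pt. p s)"
  by (rule continuous_on_subset[OF continuous_on_product_coordinates]) auto

lemma Lam_continuous: "f \<in> Lam D \<Longrightarrow> continuous_on (QC D) f"
proof (induction rule: laurent.induct)
  case (1 c)
  then show ?case by (simp add: on_set_def cong: continuous_on_cong)
next
  case (2 s)
  have "continuous_on (QC D) (on_set (QC D) (\<lambda>p. p s)) = continuous_on (QC D) (\<lambda>p. p s)"
    by (rule continuous_on_cong) (auto simp: on_set_def)
  then show ?case by (simp add: continuous_on_pt_coord)
next
  case (3 s)
  have "continuous_on (QC D) (on_set (QC D) (\<lambda>p. inverse (p s))) = continuous_on (QC D) (\<lambda>p. inverse (p s))"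
    by (rule continuous_on_cong) (auto simp: on_set_def)
  moreover have "continuous_on (QC D) (\<lambda>p. inverse (p s))"
    using 3 by (intro continuous_on_inverse continuous_on_pt_coord) (auto simp: QC_def)
  ultimately show ?case by simp
qed (auto intro: continuous_intros)

lemma Lam_const: "on_set (QC D) (\<lambda>_. c) \<in> Lam D"
  by (rule laurent.intros) auto

lemma Lam_zero: "(\<lambda>_. 0) \<in> Lam D"
  using Lam_const[of D 0] by (simp add: on_set_def)

lemma Lam_cmult: "f \<in> Lam D \<Longrightarrow> (\<lambda>p. c * f p) \<in> Lam D"
proof -
  assume f: "f \<in> Lam D"
  have "(\<lambda>p. on_set (QC D) (\<lambda>_. c) p * f p) \<in> Lam D"
    by (intro laurent.intros f) auto
  moreover have "(\<lambda>p. on_set (QC D) (\<lambda>_. c) p * f p) = (\<lambda>p. c * f p)"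
    using laurent_off_QC[OF f] by (auto simp: on_set_def fun_eq_iff)
  ultimately show ?thesis by simp
qed

lemma Lam_sum: "(\<And>i. i \<in> I \<Longrightarrow> f i \<in> Lam D) \<Longrightarrow> (\<lambda>p. \<Sum>i\<in>I. f i p) \<in> Lam D"
proof (induction I rule: infinite_finite_induct)
  case (insert i I)
  then have "(\<lambda>p. f i p + (\<Sum>i\<in>I. f i p)) \<in> Lam D" by (intro laurent.intros) auto
  with insert show ?case by simp
qed (auto simp: Lam_zero)

lemma irreducible_curve_QC: "irreducible_curve D Z \<Longrightarrow> Z \<subseteq> QC D"
  by (auto simp: irreducible_curve_def zariski_closed_def zeros_def)

text \<open>Adding \<open>f\<close> to the equations of \<open>Z\<close> cuts out a closed subset,
  and a proper closed subset of an irreducible curve is finite.\<close>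

lemma curve_zero_set:
  assumes "irreducible_curve D Z" "f \<in> Lam D"
  shows "finite {p \<in> Z. f p = 0} \<or> (\<forall>p\<in>Z. f p = 0)"
proof -
  obtain F where F: "F \<subseteq> Lam D" "Z = zeros D F"
    using assms by (auto simp: irreducible_curve_def zariski_closed_def)
  have "{p \<in> Z. f p = 0} = zeros D (insert f F)"
    using F by (auto simp: zeros_def)
  then have "zariski_closed D {p \<in> Z. f p = 0}"
    using F(1) assms(2) unfolding zariski_closed_def by (intro exI[of _ "insert f F"]) auto
  then show ?thesis using assms(1) by (auto simp: irreducible_curve_def)
qed

text \<open>Identity principle, through which facts known at infinitely many points reach the
  function field. The fraction \<open>g / h\<close> depends on \<open>u\<close>, but
  \<open>h\<close> is nonzero at \<open>u\<close> and so has finitely many zeros on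
  \<open>Z\<close>; thus \<open>g\<close> inherits infinitely many zeros from \<open>f\<close> and
  vanishes on \<open>Z\<close>, in particular at \<open>u\<close>.\<close>

lemma regular_vanish:
  assumes Z: "irreducible_curve D Z" "U \<subseteq> Z" and f: "f \<in> regular_functions D U"
    and I: "infinite I" "I \<subseteq> U" "\<And>p. p \<in> I \<Longrightarrow> f p = 0"
  shows "f = (\<lambda>_. 0)"
proof
  fix u show "f u = 0"
  proof (cases "u \<in> U")
    case True
    then obtain g h where gh: "g \<in> Lam D" "h \<in> Lam D" "h u \<noteq> 0" "\<forall>p\<in>U. h p \<noteq> 0 \<longrightarrow> f p = g p / h p"
      using f by (auto simp: regular_functions_def)
    have "finite {p \<in> Z. h p = 0}" using curve_zero_set[OF Z(1) gh(2)] gh(3) True Z(2) by auto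
    then have "infinite (I - {p \<in> Z. h p = 0})" using I by auto
    moreover have "I - {p \<in> Z. h p = 0} \<subseteq> {p \<in> Z. g p = 0}" using I gh Z(2) by fastforce
    ultimately have "infinite {p \<in> Z. g p = 0}" using finite_subset by blast
    then have "\<forall>p\<in>Z. g p = 0" using curve_zero_set[OF Z(1) gh(1)] by auto
    then show ?thesis using gh True Z(2) by auto
  next
    case False
    then show ?thesis using f by (auto simp: regular_functions_def)
  qed
qed

lemma Lam_regular:
  assumes "f \<in> Lam D" "U \<subseteq> QC D"
  shows "on_set U f \<in> regular_functions D U"
proof -
  have "\<forall>u\<in>U. \<exists>g\<in>Lam D. \<exists>h\<in>Lam D. h u \<noteq> 0 \<and> (\<forall>p\<in>U. h p \<noteq> 0 \<longrightarrow> on_set U f p = g p / h p)"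
  proof
    fix u assume "u \<in> U"
    then show "\<exists>g\<in>Lam D. \<exists>h\<in>Lam D. h u \<noteq> 0 \<and> (\<forall>p\<in>U. h p \<noteq> 0 \<longrightarrow> on_set U f p = g p / h p)"
      using assms Lam_const[of D 1]
      by (intro bexI[of _ f] bexI[of _ "on_set (QC D) (\<lambda>_. 1)"]) (auto simp: on_set_def)
  qed
  then show ?thesis by (auto simp: regular_functions_def on_set_def)
qed

lemma regular_const: "U \<subseteq> QC D \<Longrightarrow> on_set U (\<lambda>_. c) \<in> regular_functions D U"
  using Lam_regular[OF Lam_const, of U D c] by (auto simp: on_set_def subset_iff cong: if_cong)

lemma regularE:
  assumes "f \<in> regular_functions D U" "u \<in> U"
  obtains a h where "a \<in> Lam D" "h \<in> Lam D" "h u \<noteq> 0" "\<forall>p\<in>U. h p \<noteq> 0 \<longrightarrow> f p = a p / h p"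
  using assms by (auto simp: regular_functions_def)

lemma
  assumes f: "f \<in> regular_functions D U" and g: "g \<in> regular_functions D U"
  shows regular_add: "(\<lambda>p. f p + g p) \<in> regular_functions D U"
    and regular_mult: "(\<lambda>p. f p * g p) \<in> regular_functions D U"
proof -
  have "(\<exists>a\<in>Lam D. \<exists>h\<in>Lam D. h u \<noteq> 0 \<and> (\<forall>p\<in>U. h p \<noteq> 0 \<longrightarrow> f p + g p = a p / h p)) \<and>
      (\<exists>a\<in>Lam D. \<exists>h\<in>Lam D. h u \<noteq> 0 \<and> (\<forall>p\<in>U. h p \<noteq> 0 \<longrightarrow> f p * g p = a p / h p))" if u: "u \<in> U" for u
  proof -
    obtain a h where 1: "a \<in> Lam D" "h \<in> Lam D" "h u \<noteq> 0" "\<forall>p\<in>U. h p \<noteq> 0 \<longrightarrow> f p = a p / h p"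
      using regularE[OF f u] .
    obtain a' h' where 2: "a' \<in> Lam D" "h' \<in> Lam D" "h' u \<noteq> 0" "\<forall>p\<in>U. h' p \<noteq> 0 \<longrightarrow> g p = a' p / h' p"
      using regularE[OF g u] .
    have L: "(\<lambda>p. a p * h' p + a' p * h p) \<in> Lam D" "(\<lambda>p. a p * a' p) \<in> Lam D" "(\<lambda>p. h p * h' p) \<in> Lam D"
      using 1 2 by (auto intro!: laurent.intros)
    show ?thesis
      using 1 2 by (intro conjI bexI[OF _ L(1)] bexI[OF _ L(2)] bexI[OF _ L(3)]) (auto simp: add_frac_eq)
  qed
  then show "(\<lambda>p. f p + g p) \<in> regular_functions D U" "(\<lambda>p. f p * g p) \<in> regular_functions D U"
    using f g by (auto simp: regular_functions_def)
qed

lemma regular_zero: "U \<subseteq> QC D \<Longrightarrow> (\<lambda>_. 0) \<in> regular_functions D U"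
  using regular_const[of U D 0] by (simp add: on_set_def)

lemma regular_sum:
  assumes "U \<subseteq> QC D" "\<And>i. i \<in> I \<Longrightarrow> f i \<in> regular_functions D U"
  shows "(\<lambda>p. \<Sum>i\<in>I. f i p) \<in> regular_functions D U"
  using assms(2)
proof (induction I rule: infinite_finite_induct)
  case (insert i I)
  then have "(\<lambda>p. f i p + (\<Sum>i\<in>I. f i p)) \<in> regular_functions D U" by (intro regular_add) auto
  with insert show ?case by simp
qed (auto simp: regular_zero[OF assms(1)])

section \<open>Segments of positive parameters and connected components\<close>

lemma path_segment:
  fixes p q :: "'n pt"
  shows "path (\<lambda>s::real. (\<lambda>g. (1 - of_real s) * p g + of_real s * q g))"
  unfolding path_def
  by (rule continuous_on_coordinatewise_then_product) (intro continuous_intros)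

text \<open>Positivity and conjugation invariance survive convex combinations, and so does the
  normalisation to 1 off the reflections because the two weights add up to 1.\<close>

lemma Qpos_segment:
  assumes "p \<in> Qpos D" "q \<in> Qpos D" "s \<in> {0..1::real}"
  shows "(\<lambda>g. (1 - of_real s) * p g + of_real s * q g) \<in> Qpos D"
proof -
  have "\<exists>r>0. (1 - of_real s) * p g + of_real s * q g = complex_of_real r" if g: "g \<in> reflections D" for g
  proof -
    obtain a b where "a > 0" "p g = complex_of_real a" "b > 0" "q g = complex_of_real b"
      using assms(1,2) g unfolding Qpos_def by fastforce
    moreover from this have "(1 - s) * a + s * b > 0"
      using assms(3) by (cases "s = 0") (auto intro!: add_nonneg_pos)
    ultimately show ?thesis by (intro exI[of _ "(1 - s) * a + s * b"]) auto
  qed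
  moreover from this have "\<forall>g\<in>reflections D. (1 - of_real s) * p g + of_real s * q g \<noteq> 0" by force
  ultimately show ?thesis using assms by (auto simp: Qpos_def QC_def)
qed

text \<open>\<open>R\<close> contains a neighbourhood of \<open>p\<close> in \<open>Qpos D\<close>,
  cut out by \<open>f\<close> being nonzero. Inside a convex box around \<open>p\<close>, the
  segment from \<open>p\<close> to a nearby point of \<open>C\<close> stays in \<open>R\<close>, and
  a connected subset of \<open>R\<close> that meets a component lies in it.\<close>

lemma component_absorbs_closure:
  assumes C: "C \<in> components R" and R: "R \<subseteq> Qpos D" "p \<in> R" "p \<in> closure C"
    and f: "f \<in> Lam D" "f p \<noteq> 0" "\<And>q. q \<in> Qpos D \<Longrightarrow> f q \<noteq> 0 \<Longrightarrow> q \<in> R"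
  shows "p \<in> C"
proof -
  have QQ: "Qpos D \<subseteq> QC D" by (auto simp: Qpos_def)
  obtain N where N: "open N" "N \<inter> QC D = f -` (- {0}) \<inter> QC D"
    using Lam_continuous[OF f(1)] unfolding continuous_on_open_invariant
    by (metis open_Compl closed_singleton)
  have pN: "p \<in> N" using N f R QQ by blast
  obtain X where X: "p \<in> Pi\<^sub>E UNIV X" "\<And>i. open (X i)" "finite {i. X i \<noteq> UNIV}" "Pi\<^sub>E UNIV X \<subseteq> N"
    using product_topology_open_contains_basis[of "\<lambda>_. euclidean" UNIV N p] N(1) pN
    unfolding open_fun_def by auto
  have "\<exists>e>0. ball (p i) e \<subseteq> X i" for i
  proof -
    have "p i \<in> X i" using X(1) by (auto simp: PiE_iff)
    then show ?thesis using X(2)[of i] unfolding open_contains_ball by blast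
  qed
  then obtain e where e: "\<And>i. e i > 0" "\<And>i. ball (p i) (e i) \<subseteq> X i" by metis
  \<comment> \<open>The restricted factors of a basic open set are shrunk to balls, so that the box
    becomes convex while remaining open.\<close>
  define Y where "Y i = (if X i = UNIV then UNIV else ball (p i) (e i))" for i
  have Y: "p \<in> Pi\<^sub>E UNIV Y" "Pi\<^sub>E UNIV Y \<subseteq> N"
  proof -
    show "p \<in> Pi\<^sub>E UNIV Y" using e by (auto simp: Y_def)
    have "Pi\<^sub>E UNIV Y \<subseteq> Pi\<^sub>E UNIV X" using e by (intro PiE_mono) (auto simp: Y_def)
    then show "Pi\<^sub>E UNIV Y \<subseteq> N" using X(4) by (rule subset_trans)
  qed
  have "finite {i. Y i \<noteq> UNIV}"
    by (rule finite_subset[OF _ X(3)]) (auto simp: Y_def)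
  moreover have "open (Y i)" for i using X(2)[of i] by (simp add: Y_def)
  ultimately have "open (Pi\<^sub>E UNIV Y)" by (intro open_PiE)
  then have "C \<inter> Pi\<^sub>E UNIV Y \<noteq> {}"
    using R(3) Y(1) closure_iff_nhds_not_empty[of p C] by blast
  then obtain q where q: "q \<in> C" "q \<in> Pi\<^sub>E UNIV Y" by blast
  have CR: "C \<subseteq> R" using C by (rule in_components_subset)
  define g where "g = (\<lambda>s::real. (\<lambda>i. (1 - of_real s) * p i + of_real s * q i))"
  have g: "path g" unfolding g_def by (rule path_segment)
  have gR: "g s \<in> R" if s: "s \<in> {0..1}" for s
  proof (rule f(3))
    show gQ: "g s \<in> Qpos D" unfolding g_def using Qpos_segment[OF _ _ s] R CR q by blast
    have "g s i \<in> Y i" for i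
    proof (cases "X i = UNIV")
      case False
      have "convex (ball (p i) (e i))" by simp
      moreover have "p i \<in> ball (p i) (e i)" "q i \<in> ball (p i) (e i)"
        using Y(1) q(2) False by (auto simp: Y_def PiE_iff split: if_splits)
      ultimately have "(1 - s) *\<^sub>R p i + s *\<^sub>R q i \<in> ball (p i) (e i)"
        using s by (intro convexD) auto
      then show ?thesis using False by (simp add: g_def Y_def scaleR_conv_of_real)
    qed (simp add: Y_def)
    then have "g s \<in> N" using Y(2) by auto
    then show "f (g s) \<noteq> 0" using N gQ QQ by blast
  qed
  have "path_image g \<subseteq> C"
  proof (rule components_maximal[OF C])
    show "connected (path_image g)" using g by (rule connected_path_image)
    show "path_image g \<subseteq> R" using gR by (auto simp: path_image_def)
    have "g 1 = q" by (simp add: g_def)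
    then show "C \<inter> path_image g \<noteq> {}" using q(1) by (force simp: path_image_def)
  qed
  moreover have "g 0 = p" by (simp add: g_def)
  ultimately show ?thesis by (force simp: path_image_def)
qed

section \<open>Algebras given by structure constants\<close>

text \<open>Subrings are sets inside an ambient type because the ring of regular functions, its
  integral closure and the field \<open>LL\<close> must all live in the same field.\<close>

definition ring_set :: "'a::comm_ring_1 set \<Rightarrow> bool" where
  "ring_set A \<longleftrightarrow> 0 \<in> A \<and> 1 \<in> A \<and> (\<forall>x\<in>A. \<forall>y\<in>A. x + y \<in> A \<and> x * y \<in> A) \<and> (\<forall>x\<in>A. - x \<in> A)"

lemma ring_set_UNIV [simp]: "ring_set UNIV"
  by (simp add: ring_set_def)

lemma ring_set_sum: "ring_set A \<Longrightarrow> (\<And>i. i \<in> I \<Longrightarrow> f i \<in> A) \<Longrightarrow> sum f I \<in> A"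
  by (induction I rule: infinite_finite_induct) (auto simp: ring_set_def)

lemma ring_set_prod: "ring_set A \<Longrightarrow> (\<And>i. i \<in> I \<Longrightarrow> f i \<in> A) \<Longrightarrow> prod f I \<in> A"
  by (induction I rule: infinite_finite_induct) (auto simp: ring_set_def)

abbreviation supp :: "('w \<Rightarrow> 'a::zero) \<Rightarrow> 'w set" where
  "supp a \<equiv> {w. a w \<noteq> 0}"

text \<open>\<open>hmul\<close> sums over exact supports, which change under addition and scaling.
  With finite supersets both sides of a linearity statement become sums over one index set.\<close>

lemma hmul_superset:
  assumes "finite X" "supp a \<subseteq> X" "finite Y" "supp b \<subseteq> Y"
  shows "hmul c a b u = (\<Sum>x\<in>X. \<Sum>y\<in>Y. a x * b y * c x y u)"
proof -
  have "hmul c a b u = (\<Sum>x\<in>X. \<Sum>y\<in>supp b. a x * b y * c x y u)"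
    unfolding hmul_def by (rule sum.mono_neutral_left) (use assms in auto)
  also have "\<dots> = (\<Sum>x\<in>X. \<Sum>y\<in>Y. a x * b y * c x y u)"
    by (intro sum.cong refl sum.mono_neutral_left) (use assms in auto)
  finally show ?thesis .
qed

lemma fun_eval_superset:
  assumes "finite X" "supp h \<subseteq> X"
  shows "fun_eval S h = (\<Sum>x\<in>X. h x * S x)"
  unfolding fun_eval_def by (rule sum.mono_neutral_left) (use assms in auto)

lemma supp_Nb [simp]: "supp (Nb w :: 'w \<Rightarrow> 'a::zero_neq_one) = {w}"
  by (auto simp: Nb_def)

lemma hmul_Nb: "hmul c (Nb x) (Nb y) = c x y"
  by (simp add: hmul_def fun_eq_iff) (simp add: Nb_def)

lemma fun_eval_Nb [simp]: "fun_eval S (Nb w) = S w"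
  by (simp add: fun_eval_def) (simp add: Nb_def)

lemma transl_0: "transl 0 = id"
  by (auto simp: transl_def)

lemma id_in_Wgrp [simp]: "id \<in> Wgrp D"
  unfolding Wgrp_def using W0.W0_id[of D] transl_0[symmetric]
  by (intro CollectI exI[of _ 0] exI[of _ id]) simp

lemma hcarrierI: "finite (supp a) \<Longrightarrow> supp a \<subseteq> Wgrp D \<Longrightarrow> (\<And>w. a w \<in> A) \<Longrightarrow> a \<in> hcarrier D A"
  by (auto simp: hcarrier_def)

lemma hcarrierD:
  assumes "a \<in> hcarrier D A"
  shows "finite (supp a)" "supp a \<subseteq> Wgrp D" "a w \<in> A"
  using assms by (auto simp: hcarrier_def)

lemma hcarrier_mono: "a \<in> hcarrier D A \<Longrightarrow> A \<subseteq> B \<Longrightarrow> a \<in> hcarrier D B"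
  by (auto simp: hcarrier_def)

lemma hcarrier_UNIV: "a \<in> hcarrier D A \<Longrightarrow> a \<in> hcarrier D UNIV"
  by (auto simp: hcarrier_def)

lemma hcarrier_add:
  assumes "ring_set A" "a \<in> hcarrier D A" "b \<in> hcarrier D A"
  shows "(\<lambda>w. a w + b w) \<in> hcarrier D A"
proof (rule hcarrierI)
  show "finite (supp (\<lambda>w. a w + b w))"
    by (rule finite_subset[of _ "supp a \<union> supp b"]) (use hcarrierD[OF assms(2)] hcarrierD[OF assms(3)] in auto)
  show "supp (\<lambda>w. a w + b w) \<subseteq> Wgrp D"
    by (rule subset_trans[of _ "supp a \<union> supp b"]) (use hcarrierD(2)[OF assms(2)] hcarrierD(2)[OF assms(3)] in auto)
qed (use assms(1) hcarrierD(3)[OF assms(2)] hcarrierD(3)[OF assms(3)] in \<open>auto simp: ring_set_def\<close>)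

lemma hcarrier_scale:
  assumes "ring_set A" "c \<in> A" "a \<in> hcarrier D A"
  shows "(\<lambda>w. c * a w) \<in> hcarrier D A"
proof (rule hcarrierI)
  show "finite (supp (\<lambda>w. c * a w))"
    by (rule finite_subset[of _ "supp a"]) (use hcarrierD[OF assms(3)] in auto)
  show "supp (\<lambda>w. c * a w) \<subseteq> Wgrp D"
    by (rule subset_trans[of _ "supp a"]) (use hcarrierD(2)[OF assms(3)] in auto)
qed (use assms hcarrierD(3)[OF assms(3)] in \<open>auto simp: ring_set_def\<close>)

lemma hcarrier_zero: "ring_set A \<Longrightarrow> (\<lambda>w. 0) \<in> hcarrier D A"
  by (auto simp: hcarrier_def ring_set_def)

lemma hcarrier_sum:
  assumes "ring_set A" "\<And>i. i \<in> I \<Longrightarrow> h i \<in> hcarrier D A" "\<And>i. i \<in> I \<Longrightarrow> c i \<in> A"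
  shows "(\<lambda>w. \<Sum>i\<in>I. c i * h i w) \<in> hcarrier D A"
  using assms(2,3)
proof (induction I rule: infinite_finite_induct)
  case (insert i I)
  have "(\<lambda>w. c i * h i w + (\<Sum>i\<in>I. c i * h i w)) \<in> hcarrier D A"
    using insert by (intro hcarrier_add[OF assms(1)] hcarrier_scale[OF assms(1)]) auto
  with insert show ?case by simp
qed (auto simp: hcarrier_zero assms(1))

lemma hcarrier_Nb: "ring_set A \<Longrightarrow> w \<in> Wgrp D \<Longrightarrow> Nb w \<in> hcarrier D A"
  by (rule hcarrierI) (auto simp: Nb_def ring_set_def)

lemma hcarrier_expand:
  fixes a :: "'n::finite aff \<Rightarrow> 'a::comm_ring_1"
  assumes "a \<in> hcarrier D A"
  shows "a = (\<lambda>w. \<Sum>x\<in>supp a. a x * Nb x w)"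
proof
  fix w
  have "(\<Sum>x\<in>supp a. a x * Nb x w) = (\<Sum>x\<in>supp a. if w = x then a x else 0)"
    by (intro sum.cong) (auto simp: Nb_def)
  then show "a w = (\<Sum>x\<in>supp a. a x * Nb x w)"
    using hcarrierD(1)[OF assms] by (simp add: sum.delta)
qed

lemma hmul_scale_right:
  fixes c :: "'w \<Rightarrow> 'w \<Rightarrow> 'w \<Rightarrow> 'a::comm_ring_1"
  assumes "finite (supp a)" "finite (supp b)"
  shows "hmul c a (\<lambda>w. k * b w) = (\<lambda>u. k * hmul c a b u)"
proof
  fix u
  have "supp (\<lambda>w. k * b w) \<subseteq> supp b" by auto
  then show "hmul c a (\<lambda>w. k * b w) u = k * hmul c a b u"
    using assms by (subst (1 2) hmul_superset[of "supp a" _ "supp b"]) (auto simp: sum_distrib_left algebra_simps)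
qed

lemma hmul_add_right:
  fixes c :: "'w \<Rightarrow> 'w \<Rightarrow> 'w \<Rightarrow> 'a::comm_ring_1"
  assumes "finite (supp a)" "finite (supp b)" "finite (supp b')"
  shows "hmul c a (\<lambda>w. b w + b' w) = (\<lambda>u. hmul c a b u + hmul c a b' u)"
proof
  fix u
  have "supp (\<lambda>w. b w + b' w) \<subseteq> supp b \<union> supp b'" by auto
  then show "hmul c a (\<lambda>w. b w + b' w) u = hmul c a b u + hmul c a b' u"
    using assms by (subst (1 2 3) hmul_superset[of "supp a" _ "supp b \<union> supp b'"])
      (auto simp: sum.distrib algebra_simps)
qed

lemma hmul_zero_right: "hmul c a (\<lambda>_. 0) = (\<lambda>_. 0)"
  by (simp add: hmul_def)

lemma hmul_sum_right:
  fixes c :: "'n::finite aff \<Rightarrow> 'n aff \<Rightarrow> 'n aff \<Rightarrow> 'a::comm_ring_1"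
  assumes "a \<in> hcarrier D UNIV" "\<And>i. i \<in> I \<Longrightarrow> h i \<in> hcarrier D UNIV"
  shows "hmul c a (\<lambda>w. \<Sum>i\<in>I. k i * h i w) = (\<lambda>u. \<Sum>i\<in>I. k i * hmul c a (h i) u)"
  using assms(2)
proof (induction I rule: infinite_finite_induct)
  case (insert i I)
  have "(\<lambda>w. \<Sum>i\<in>I. k i * h i w) \<in> hcarrier D UNIV" "(\<lambda>w. k i * h i w) \<in> hcarrier D UNIV"
    using insert by (auto intro!: hcarrier_sum hcarrier_scale)
  then have "hmul c a (\<lambda>w. k i * h i w + (\<Sum>i\<in>I. k i * h i w)) =
      (\<lambda>u. k i * hmul c a (h i) u + (\<Sum>i\<in>I. k i * hmul c a (h i) u))"
    using insert hcarrierD(1)[OF assms(1)] hcarrierD(1)[OF insert.prems[of i]]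
    by (subst hmul_add_right) (auto simp: hmul_scale_right dest: hcarrierD(1))
  with insert show ?case by simp
qed (auto simp: hmul_zero_right)

lemma fun_eval_add:
  assumes "finite (supp a)" "finite (supp b)"
  shows "fun_eval S (\<lambda>w. a w + b w) = fun_eval S a + fun_eval S b"
proof -
  have "supp (\<lambda>w. a w + b w) \<subseteq> supp a \<union> supp b" by auto
  then show ?thesis
    using assms by (subst (1 2 3) fun_eval_superset[of "supp a \<union> supp b"]) (auto simp: sum.distrib algebra_simps)
qed

lemma fun_eval_scale:
  assumes "finite (supp a)"
  shows "fun_eval S (\<lambda>w. k * a w) = k * fun_eval S a"
proof -
  have "supp (\<lambda>w. k * a w) \<subseteq> supp a" by auto
  then show ?thesis
    using assms by (subst (1 2) fun_eval_superset[of "supp a"]) (auto simp: sum_distrib_left algebra_simps)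
qed

lemma fun_eval_zero [simp]: "fun_eval S (\<lambda>_. 0) = 0"
  by (simp add: fun_eval_def)

text \<open>Axioms on basis elements, shared by the algebra at one parameter point and by the
  generic algebra over the function field. They are restricted to \<open>Wgrp D\<close> because the
  constants are unconstrained off the group.\<close>

locale structure_constants =
  fixes D :: "('n::finite, 'z) root_datum_scheme"
    and c :: "'n aff \<Rightarrow> 'n aff \<Rightarrow> 'n aff \<Rightarrow> 'a::comm_ring_1"
  assumes supp_c: "x \<in> Wgrp D \<Longrightarrow> y \<in> Wgrp D \<Longrightarrow> finite (supp (c x y)) \<and> supp (c x y) \<subseteq> Wgrp D"
    and assoc_c: "x \<in> Wgrp D \<Longrightarrow> y \<in> Wgrp D \<Longrightarrow> z \<in> Wgrp D \<Longrightarrow>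
      (\<Sum>u\<in>supp (c x y). c x y u * c u z s) = (\<Sum>u\<in>supp (c y z). c y z u * c x u s)"
    and unit_c: "x \<in> Wgrp D \<Longrightarrow> c id x = Nb x" "x \<in> Wgrp D \<Longrightarrow> c x id = Nb x"
begin

abbreviation "carr \<equiv> hcarrier D (UNIV :: 'a set)"

lemma hmul_closed:
  assumes "ring_set A" "\<And>x y u. x \<in> Wgrp D \<Longrightarrow> y \<in> Wgrp D \<Longrightarrow> c x y u \<in> A"
    "a \<in> hcarrier D A" "b \<in> hcarrier D A"
  shows "hmul c a b \<in> hcarrier D A"
proof (rule hcarrierI)
  have sub: "supp (hmul c a b) \<subseteq> (\<Union>x\<in>supp a. \<Union>y\<in>supp b. supp (c x y))"
  proof
    fix u assume "u \<in> supp (hmul c a b)"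
    then have "(\<Sum>x\<in>supp a. \<Sum>y\<in>supp b. a x * b y * c x y u) \<noteq> 0" by (simp add: hmul_def)
    then obtain x where x: "x \<in> supp a" "(\<Sum>y\<in>supp b. a x * b y * c x y u) \<noteq> 0"
      by (meson sum.neutral)
    then obtain y where y: "y \<in> supp b" "a x * b y * c x y u \<noteq> 0"
      by (meson sum.neutral)
    then have "u \<in> supp (c x y)" by auto
    then show "u \<in> (\<Union>x\<in>supp a. \<Union>y\<in>supp b. supp (c x y))" using x y by blast
  qed
  have 1: "finite (supp (c x y))" "supp (c x y) \<subseteq> Wgrp D" if "x \<in> supp a" "y \<in> supp b" for x y
  proof -
    have "x \<in> Wgrp D" "y \<in> Wgrp D"
      using that hcarrierD(2)[OF assms(3)] hcarrierD(2)[OF assms(4)] by blast+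
    then show "finite (supp (c x y))" "supp (c x y) \<subseteq> Wgrp D" using supp_c by auto
  qed
  have "finite (\<Union>x\<in>supp a. \<Union>y\<in>supp b. supp (c x y))"
    by (intro finite_UN_I hcarrierD(1)[OF assms(3)] hcarrierD(1)[OF assms(4)] 1)
  then show "finite (supp (hmul c a b))" using finite_subset[OF sub] by blast
  have "(\<Union>x\<in>supp a. \<Union>y\<in>supp b. supp (c x y)) \<subseteq> Wgrp D" using 1(2) by blast
  then show "supp (hmul c a b) \<subseteq> Wgrp D" using sub by (rule subset_trans[rotated])
  show "hmul c a b w \<in> A" for w
    unfolding hmul_def
  proof (intro ring_set_sum[OF assms(1)])
    fix x y assume "x \<in> supp a" "y \<in> supp b"
    then have "c x y w \<in> A"
      using hcarrierD(2)[OF assms(3)] hcarrierD(2)[OF assms(4)] by (intro assms(2)) blast+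
    then show "a x * b y * c x y w \<in> A"
      using hcarrierD(3)[OF assms(3), of x] hcarrierD(3)[OF assms(4), of y] assms(1) by (simp add: ring_set_def)
  qed
qed

lemma hmul_carr: "a \<in> carr \<Longrightarrow> b \<in> carr \<Longrightarrow> hmul c a b \<in> carr"
  by (rule hmul_closed) auto

lemma hmul_id:
  assumes a: "a \<in> carr"
  shows hmul_id_left: "hmul c (Nb id) a = a" and hmul_id_right: "hmul c a (Nb id) = a"
proof -
  have exp: "(\<Sum>y\<in>supp a. a y * c' y u) = a u" if "\<And>y. y \<in> Wgrp D \<Longrightarrow> c' y = Nb y" for c' u
  proof -
    have "(\<Sum>y\<in>supp a. a y * c' y u) = (\<Sum>y\<in>supp a. a y * Nb y u)"
      using hcarrierD(2)[OF a] by (intro sum.cong) (auto simp: that subset_iff)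
    then show ?thesis by (subst (3) hcarrier_expand[OF a]) simp
  qed
  have "hmul c (Nb id) a u = (\<Sum>y\<in>supp a. a y * c id y u)" "hmul c a (Nb id) u = (\<Sum>y\<in>supp a. a y * c y id u)" for u
    by (simp_all add: hmul_def) (simp_all add: Nb_def)
  then show "hmul c (Nb id) a = a" "hmul c a (Nb id) = a"
    using exp[of "c id"] exp[of "\<lambda>y. c y id"] by (auto simp: unit_c)
qed

lemma fun_eval_hmul:
  assumes "a \<in> carr" "b \<in> carr"
  shows "fun_eval S (hmul c a b) = (\<Sum>x\<in>supp a. \<Sum>y\<in>supp b. a x * b y * fun_eval S (c x y))"
proof -
  define T where "T = (\<Union>x\<in>supp a. \<Union>y\<in>supp b. supp (c x y)) \<union> supp (hmul c a b)"
  have W: "x \<in> Wgrp D" if "x \<in> supp a \<or> x \<in> supp b" for x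
    using that hcarrierD(2)[OF assms(1)] hcarrierD(2)[OF assms(2)] by blast
  have T: "finite T" unfolding T_def
    using W supp_c by (auto intro!: finite_UnI finite_UN_I hcarrierD(1)[OF assms(1)] hcarrierD(1)[OF assms(2)] hcarrierD(1)[OF hmul_carr] assms)
  have "fun_eval S (hmul c a b) = (\<Sum>u\<in>T. hmul c a b u * S u)"
    by (rule fun_eval_superset) (use T in \<open>auto simp: T_def\<close>)
  also have "\<dots> = (\<Sum>u\<in>T. \<Sum>x\<in>supp a. \<Sum>y\<in>supp b. a x * b y * (c x y u * S u))"
    by (simp add: hmul_def sum_distrib_right sum_distrib_left mult_ac)
  also have "\<dots> = (\<Sum>x\<in>supp a. \<Sum>u\<in>T. \<Sum>y\<in>supp b. a x * b y * (c x y u * S u))"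
    by (rule sum.swap)
  also have "\<dots> = (\<Sum>x\<in>supp a. \<Sum>y\<in>supp b. \<Sum>u\<in>T. a x * b y * (c x y u * S u))"
    by (intro sum.cong refl sum.swap)
  also have "\<dots> = (\<Sum>x\<in>supp a. \<Sum>y\<in>supp b. a x * b y * fun_eval S (c x y))"
  proof (intro sum.cong refl)
    fix x y assume "x \<in> supp a" "y \<in> supp b"
    then have "fun_eval S (c x y) = (\<Sum>u\<in>T. c x y u * S u)"
      by (intro fun_eval_superset) (use T in \<open>auto simp: T_def\<close>)
    then show "(\<Sum>u\<in>T. a x * b y * (c x y u * S u)) = a x * b y * fun_eval S (c x y)"
      by (simp add: sum_distrib_left)
  qed
  finally show ?thesis .
qed

lemma hmul_assoc:
  assumes a: "a \<in> carr" and b: "b \<in> carr" and d: "d \<in> carr"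
  shows "hmul c (hmul c a b) d = hmul c a (hmul c b d)"
proof
  fix s
  have W: "x \<in> Wgrp D" if "x \<in> supp a \<or> x \<in> supp b \<or> x \<in> supp d" for x
    using that hcarrierD(2)[OF a] hcarrierD(2)[OF b] hcarrierD(2)[OF d] by blast
  \<comment> \<open>For fixed \<open>d\<close> and \<open>s\<close> the coefficient is a linear
    functional of \<open>hmul c a b\<close>, so \<open>fun_eval_hmul\<close> reduces associativity
    to basis elements.\<close>
  have "hmul c (hmul c a b) d s = fun_eval (\<lambda>u. \<Sum>z\<in>supp d. d z * c u z s) (hmul c a b)"
    by (simp add: hmul_def[of c "hmul c a b"] fun_eval_def sum_distrib_left mult.assoc)
  also have "\<dots> = (\<Sum>x\<in>supp a. \<Sum>y\<in>supp b. a x * b y * (\<Sum>u\<in>supp (c x y). \<Sum>z\<in>supp d. d z * (c x y u * c u z s)))"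
    unfolding fun_eval_hmul[OF a b] by (simp add: fun_eval_def sum_distrib_left mult_ac)
  also have "\<dots> = (\<Sum>x\<in>supp a. \<Sum>y\<in>supp b. a x * b y * (\<Sum>z\<in>supp d. d z * (\<Sum>u\<in>supp (c x y). c x y u * c u z s)))"
    by (subst sum.swap) (simp add: sum_distrib_left)
  also have "\<dots> = (\<Sum>x\<in>supp a. \<Sum>y\<in>supp b. a x * b y * (\<Sum>z\<in>supp d. d z * (\<Sum>u\<in>supp (c y z). c y z u * c x u s)))"
    using W by (intro sum.cong refl arg_cong2[where f = "(*)"] assoc_c) auto
  also have "\<dots> = (\<Sum>x\<in>supp a. a x * fun_eval (\<lambda>u. c x u s) (hmul c b d))"
    unfolding fun_eval_hmul[OF b d] by (simp add: fun_eval_def sum_distrib_left mult_ac)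
  also have "\<dots> = hmul c a (hmul c b d) s"
    by (simp add: hmul_def[of c a] fun_eval_def sum_distrib_left mult.assoc)
  finally show "hmul c (hmul c a b) d s = hmul c a (hmul c b d) s" .
qed

section \<open>The bimodule generated by a trace functional\<close>

lemma left_act_eq:
  assumes "h \<in> carr"
  shows "left_act D c S h = (\<lambda>w. if w \<in> Wgrp D then fun_eval S (hmul c (Nb w) h) else 0)"
  by (auto simp: left_act_def bi_act_def hmul_id_left hcarrier_Nb fun_eq_iff)

lemma left_act_add:
  assumes "h \<in> carr" "k \<in> carr"
  shows "left_act D c S (\<lambda>w. h w + k w) = (\<lambda>w. left_act D c S h w + left_act D c S k w)"
proof -
  have "hmul c (Nb w) h \<in> carr" "hmul c (Nb w) k \<in> carr" if "w \<in> Wgrp D" for w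
    using that assms by (auto intro!: hmul_carr hcarrier_Nb)
  then show ?thesis
    using assms hcarrierD(1)[OF assms(1)] hcarrierD(1)[OF assms(2)]
    by (auto simp: left_act_eq hcarrier_add hmul_add_right fun_eq_iff intro!: fun_eval_add dest: hcarrierD(1))
qed

lemma left_act_scale:
  assumes "h \<in> carr"
  shows "left_act D c S (\<lambda>w. k * h w) = (\<lambda>w. k * left_act D c S h w)"
proof -
  have "hmul c (Nb w) h \<in> carr" if "w \<in> Wgrp D" for w
    using that assms by (auto intro!: hmul_carr hcarrier_Nb)
  then show ?thesis
    using assms hcarrierD(1)[OF assms]
    by (auto simp: left_act_eq hcarrier_scale hmul_scale_right fun_eq_iff intro!: fun_eval_scale dest: hcarrierD(1))
qed

lemma fun_eval_left_act:
  assumes "h \<in> carr" "k \<in> carr"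
  shows "fun_eval (left_act D c S h) k = fun_eval S (hmul c k h)"
proof -
  have "fun_eval (left_act D c S h) k = (\<Sum>x\<in>supp k. k x * fun_eval S (hmul c (Nb x) h))"
    unfolding fun_eval_def[of _ k]
    by (intro sum.cong) (use hcarrierD(2)[OF assms(2)] assms(1) in \<open>auto simp: left_act_eq\<close>)
  also have "\<dots> = (\<Sum>x\<in>supp k. k x * (\<Sum>y\<in>supp h. h y * fun_eval S (c x y)))"
  proof (intro sum.cong refl)
    fix x assume "x \<in> supp k"
    then have "x \<in> Wgrp D" using hcarrierD(2)[OF assms(2)] by blast
    then show "k x * fun_eval S (hmul c (Nb x) h) = k x * (\<Sum>y\<in>supp h. h y * fun_eval S (c x y))"
      by (simp add: fun_eval_hmul hcarrier_Nb assms) (simp add: Nb_def)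
  qed
  also have "\<dots> = fun_eval S (hmul c k h)"
    by (simp add: fun_eval_hmul assms sum_distrib_left mult_ac)
  finally show ?thesis .
qed

end

locale traced_structure_constants = structure_constants D c
  for D :: "('n::finite, 'z) root_datum_scheme" and c :: "'n aff \<Rightarrow> 'n aff \<Rightarrow> 'n aff \<Rightarrow> 'a::comm_ring_1" +
  fixes S :: "'n aff \<Rightarrow> 'a"
  assumes trace_c: "x \<in> Wgrp D \<Longrightarrow> y \<in> Wgrp D \<Longrightarrow> fun_eval S (c x y) = fun_eval S (c y x)"
    and S_off: "w \<notin> Wgrp D \<Longrightarrow> S w = 0"
begin

lemma trace:
  assumes "a \<in> carr" "b \<in> carr"
  shows "fun_eval S (hmul c a b) = fun_eval S (hmul c b a)"
proof -
  have W: "x \<in> Wgrp D" if "x \<in> supp a \<or> x \<in> supp b" for x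
    using that hcarrierD(2)[OF assms(1)] hcarrierD(2)[OF assms(2)] by blast
  have "fun_eval S (hmul c a b) = (\<Sum>y\<in>supp b. \<Sum>x\<in>supp a. a x * b y * fun_eval S (c x y))"
    by (simp add: fun_eval_hmul assms) (rule sum.swap)
  also have "\<dots> = (\<Sum>y\<in>supp b. \<Sum>x\<in>supp a. b y * a x * fun_eval S (c y x))"
    using W by (intro sum.cong refl) (simp add: trace_c mult.commute)
  also have "\<dots> = fun_eval S (hmul c b a)"
    by (simp add: fun_eval_hmul assms)
  finally show ?thesis .
qed

text \<open>On an element \<open>k\<close> the left side is \<open>S(b k a h)\<close>, and the trace
  property moves \<open>b\<close> to the right end, giving \<open>S(k a h b)\<close>. The right
  multiplication is thereby absorbed into a left one.\<close>

lemma bi_act_left_act: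
  assumes a: "a \<in> carr" and b: "b \<in> carr" and h: "h \<in> carr"
  shows "bi_act D c a (left_act D c S h) b = left_act D c S (hmul c (hmul c a h) b)"
proof
  fix w
  show "bi_act D c a (left_act D c S h) b w = left_act D c S (hmul c (hmul c a h) b) w"
  proof (cases "w \<in> Wgrp D")
    case True
    have N: "Nb w \<in> carr" using True by (intro hcarrier_Nb) auto
    note closed = a b h N hmul_carr
    have "fun_eval (left_act D c S h) (hmul c (hmul c b (Nb w)) a) = fun_eval S (hmul c (hmul c (hmul c b (Nb w)) a) h)"
      by (intro fun_eval_left_act closed)
    also have "hmul c (hmul c (hmul c b (Nb w)) a) h = hmul c b (hmul c (Nb w) (hmul c a h))"
      by (simp add: hmul_assoc closed)
    also have "fun_eval S \<dots> = fun_eval S (hmul c (hmul c (Nb w) (hmul c a h)) b)"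
      by (intro trace closed)
    also have "hmul c (hmul c (Nb w) (hmul c a h)) b = hmul c (Nb w) (hmul c (hmul c a h) b)"
      by (simp add: hmul_assoc closed)
    finally show ?thesis using True by (simp add: bi_act_def left_act_eq closed)
  qed (simp add: bi_act_def left_act_def)
qed

lemma left_act_id: "left_act D c S (Nb id) = S"
  by (auto simp: left_act_eq hcarrier_Nb hmul_id_right fun_eq_iff S_off)

text \<open>By the trace property the bimodule is already the cyclic left module generated by
  \<open>S\<close>. A product prescribed only on elements \<open>left_act D c S h\<close> is
  therefore known on all of it. The condition on \<open>c\<close> keeps coefficients in
  \<open>A\<close>.\<close>

lemma sub_bimodule_left_act:
  assumes A: "ring_set A" "\<And>x y u. x \<in> Wgrp D \<Longrightarrow> y \<in> Wgrp D \<Longrightarrow> c x y u \<in> A"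
    and f: "f \<in> sub_bimodule D c A S"
  shows "\<exists>h\<in>hcarrier D A. f = left_act D c S h"
  using f
proof (induction rule: sub_bimodule.induct)
  case 1
  show ?case using left_act_id hcarrier_Nb[OF A(1) id_in_Wgrp] by (intro bexI[of _ "Nb id"]) simp_all
next
  case (2 f g)
  then obtain h k where "h \<in> hcarrier D A" "f = left_act D c S h" "k \<in> hcarrier D A" "g = left_act D c S k" by auto
  then show ?case
    by (intro bexI[of _ "\<lambda>w. h w + k w"] hcarrier_add[OF A(1)])
       (simp_all add: left_act_add[OF hcarrier_UNIV hcarrier_UNIV])
next
  case (3 f a b)
  then obtain h where h: "h \<in> hcarrier D A" "f = left_act D c S h" by auto
  have "bi_act D c a f b = left_act D c S (hmul c (hmul c a h) b)"
    unfolding h(2) by (intro bi_act_left_act) (use 3 h hcarrier_UNIV in blast)+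
  moreover have "hmul c (hmul c a h) b \<in> hcarrier D A"
    by (intro hmul_closed A 3 h)
  ultimately show ?case by blast
qed

end

lemma left_act_sub_bimodule:
  "ring_set A \<Longrightarrow> h \<in> hcarrier D A \<Longrightarrow> left_act D c S h \<in> sub_bimodule D c A S"
  unfolding left_act_def by (intro sub_bimodule.intros hcarrier_Nb id_in_Wgrp)

section \<open>Specialized and generic Hecke algebras\<close>

lemma supp_mulc_at: "supp (mulc_at H v x y) \<subseteq> {u. mulc H x y u \<noteq> (\<lambda>_. 0)}"
  by (auto simp: mulc_at_def)

locale hecke =
  fixes H :: "('n::finite) affine_hecke"
  assumes hecke: "is_affine_hecke H"
begin

text \<open>Support in the sense of Laurent polynomials: one finite index set serves all parameter
  points, although the support of \<open>mulc_at H v x y\<close> may shrink at special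
  \<open>v\<close>.\<close>

definition msupp :: "'n aff \<Rightarrow> 'n aff \<Rightarrow> 'n aff set" where
  "msupp x y = {u. mulc H x y u \<noteq> (\<lambda>_. 0)}"

lemma
  assumes "x \<in> Wgrp H" "y \<in> Wgrp H"
  shows mulc_Lam: "mulc H x y u \<in> Lam H"
    and finite_msupp: "finite (msupp x y)"
    and msupp_Wgrp: "msupp x y \<subseteq> Wgrp H"
  using hecke assms unfolding is_affine_hecke_def msupp_def by blast+

lemma
  shows theta_Lam: "theta H x u \<in> Lam H"
    and finite_theta: "finite {u. theta H x u \<noteq> (\<lambda>_. 0)}"
    and theta_Wgrp: "{u. theta H x u \<noteq> (\<lambda>_. 0)} \<subseteq> Wgrp H"
  using hecke unfolding is_affine_hecke_def by blast+

lemma root_datum: "semisimple_based_root_datum H"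
  using hecke unfolding is_affine_hecke_def by blast

lemma theta_carr: "theta_at H v x \<in> hcarrier H UNIV"
proof (rule hcarrierI)
  have sub: "supp (theta_at H v x) \<subseteq> {u. theta H x u \<noteq> (\<lambda>_. 0)}" by (auto simp: theta_at_def)
  show "finite (supp (theta_at H v x))" using finite_subset[OF sub finite_theta] .
  show "supp (theta_at H v x) \<subseteq> Wgrp H" using sub theta_Wgrp by (rule subset_trans)
qed auto

lemma theta_mult: "v \<in> QC H \<Longrightarrow> hmul (mulc_at H v) (theta_at H v x) (theta_at H v y) = theta_at H v (x + y)"
  using hecke unfolding is_affine_hecke_def by blast

lemma theta_dominant: "v \<in> QC H \<Longrightarrow> dominant H x \<Longrightarrow> theta_at H v x = Nb (transl x)"
  using hecke unfolding is_affine_hecke_def by blast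

lemma theta_0: "v \<in> QC H \<Longrightarrow> theta_at H v 0 = Nb id"
  using theta_dominant[of v 0] by (simp add: dominant_def pairing_def transl_0)

lemma structure_constants_at:
  assumes v: "v \<in> QC H"
  shows "structure_constants H (mulc_at H v)"
proof
  fix x y z s assume xyz: "x \<in> Wgrp H" "y \<in> Wgrp H" "z \<in> Wgrp H"
  have "hmul (mulc_at H v) (hmul (mulc_at H v) (Nb x) (Nb y)) (Nb z) =
           hmul (mulc_at H v) (Nb x) (hmul (mulc_at H v) (Nb y) (Nb z))"
    using hecke xyz v unfolding is_affine_hecke_def by blast
  then have "hmul (mulc_at H v) (mulc_at H v x y) (Nb z) s = hmul (mulc_at H v) (Nb x) (mulc_at H v y z) s"
    by (simp add: hmul_Nb)
  then show "(\<Sum>u\<in>supp (mulc_at H v x y). mulc_at H v x y u * mulc_at H v u z s) =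
     (\<Sum>u\<in>supp (mulc_at H v y z). mulc_at H v y z u * mulc_at H v x u s)"
    by (simp add: hmul_def) (simp add: Nb_def)
next
  fix x y assume xy: "x \<in> Wgrp H" "y \<in> Wgrp H"
  show "finite (supp (mulc_at H v x y)) \<and> supp (mulc_at H v x y) \<subseteq> Wgrp H"
    using supp_mulc_at[of H v x y] finite_msupp[OF xy] msupp_Wgrp[OF xy] finite_subset
    unfolding msupp_def by blast
next
  fix x assume x: "x \<in> Wgrp H"
  have "hmul (mulc_at H v) (Nb id) (Nb x) = Nb x" "hmul (mulc_at H v) (Nb x) (Nb id) = Nb x"
    using hecke x v unfolding is_affine_hecke_def by blast+
  then show "mulc_at H v id x = Nb x" "mulc_at H v x id = Nb x" by (simp_all add: hmul_Nb)
qed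

end

locale rep_setup = hecke H for H :: "('n::finite) affine_hecke" +
  fixes v :: "'n pt" and d :: nat and \<rho> :: "('n aff \<Rightarrow> complex) \<Rightarrow> complex mat"
  assumes v: "v \<in> QC H" and rep: "rep H v d \<rho>"
begin

abbreviation "mul \<equiv> hmul (mulc_at H v)"
abbreviation "th \<equiv> theta_at H v"

sublocale structure_constants H "mulc_at H v"
  by (rule structure_constants_at[OF v])

lemma rho_carrier: "a \<in> carr \<Longrightarrow> \<rho> a \<in> carrier_mat d d"
  and rho_add: "a \<in> carr \<Longrightarrow> b \<in> carr \<Longrightarrow> \<rho> (\<lambda>w. a w + b w) = \<rho> a + \<rho> b"
  and rho_scale: "a \<in> carr \<Longrightarrow> \<rho> (\<lambda>w. c * a w) = c \<cdot>\<^sub>m \<rho> a"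
  and rho_mult: "a \<in> carr \<Longrightarrow> b \<in> carr \<Longrightarrow> \<rho> (mul a b) = \<rho> a * \<rho> b"
  and rho_id: "\<rho> (Nb id) = 1\<^sub>m d"
  using rep unfolding rep_def alg_rep_def by blast+

lemma rho_zero: "\<rho> (\<lambda>_. 0) = 0\<^sub>m d d"
proof -
  have z: "(\<lambda>_. 0) \<in> carr" by (rule hcarrier_zero) simp
  have "\<rho> (\<lambda>w. 0 * 0) = 0 \<cdot>\<^sub>m \<rho> (\<lambda>_. 0)" by (rule rho_scale[OF z])
  also have "\<dots> = 0\<^sub>m d d" using rho_carrier[OF z] by auto
  finally show ?thesis by simp
qed

lemma rho_sum:
  assumes "\<And>i. i \<in> I \<Longrightarrow> h i \<in> carr" "j < d" "k < d"
  shows "\<rho> (\<lambda>w. \<Sum>i\<in>I. c i * h i w) $$ (j, k) = (\<Sum>i\<in>I. c i * \<rho> (h i) $$ (j, k))"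
  using assms(1)
proof (induction I rule: infinite_finite_induct)
  case (insert i I)
  have 1: "(\<lambda>w. \<Sum>i\<in>I. c i * h i w) \<in> carr" "(\<lambda>w. c i * h i w) \<in> carr"
    using insert by (auto intro!: hcarrier_sum hcarrier_scale)
  then have "\<rho> (\<lambda>w. c i * h i w + (\<Sum>i\<in>I. c i * h i w)) = c i \<cdot>\<^sub>m \<rho> (h i) + \<rho> (\<lambda>w. \<Sum>i\<in>I. c i * h i w)"
    using insert by (simp add: rho_add rho_scale)
  with insert 1 assms(2,3) rho_carrier[of "h i"] rho_carrier[OF 1(1)] show ?case by simp
qed (simp_all add: rho_zero assms)

lemma rho_zeroI:
  assumes "a \<in> carr" "\<And>j k. j < d \<Longrightarrow> k < d \<Longrightarrow> \<rho> a $$ (j, k) = 0"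
  shows "\<rho> a = 0\<^sub>m d d"
  using assms rho_carrier[OF assms(1)] by (intro eq_matI) auto

lemma mtrace_rho:
  assumes "a \<in> carr"
  shows "fun_eval (chr H \<rho>) a = mtrace (\<rho> a)"
proof -
  have W: "x \<in> Wgrp H" if "x \<in> supp a" for x using that hcarrierD(2)[OF assms] by blast
  have "mtrace (\<rho> a) = (\<Sum>i<d. \<rho> a $$ (i, i))"
    using rho_carrier[OF assms] by (simp add: mtrace_def)
  also have "\<dots> = (\<Sum>i<d. \<Sum>x\<in>supp a. a x * \<rho> (Nb x) $$ (i, i))"
  proof (intro sum.cong refl)
    fix i assume i: "i \<in> {..<d}"
    have "\<rho> (\<lambda>w. \<Sum>x\<in>supp a. a x * Nb x w) $$ (i, i) = (\<Sum>x\<in>supp a. a x * \<rho> (Nb x) $$ (i, i))"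
      using W i by (intro rho_sum hcarrier_Nb) auto
    then show "\<rho> a $$ (i, i) = (\<Sum>x\<in>supp a. a x * \<rho> (Nb x) $$ (i, i))"
      using hcarrier_expand[OF assms] by simp
  qed
  also have "\<dots> = (\<Sum>x\<in>supp a. \<Sum>i<d. a x * \<rho> (Nb x) $$ (i, i))" by (rule sum.swap)
  also have "\<dots> = fun_eval (chr H \<rho>) a" unfolding fun_eval_def
  proof (intro sum.cong refl)
    fix x assume "x \<in> supp a"
    then have x: "x \<in> Wgrp H" by (rule W)
    then have "\<rho> (Nb x) \<in> carrier_mat d d" by (intro rho_carrier hcarrier_Nb) auto
    then show "(\<Sum>i<d. a x * \<rho> (Nb x) $$ (i, i)) = a x * chr H \<rho> x"
      using x by (simp add: chr_def mtrace_def sum_distrib_left)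
  qed
  finally show ?thesis by simp
qed

end

lemma mtrace_comm:
  assumes "A \<in> carrier_mat d d" "B \<in> carrier_mat d d"
  shows "mtrace (A * B) = mtrace (B * A :: 'a::comm_semiring_0 mat)"
proof -
  have "mtrace (A * B) = (\<Sum>i<d. \<Sum>j<d. A $$ (i, j) * B $$ (j, i))"
    using assms by (auto simp: mtrace_def scalar_prod_def atLeast0LessThan intro!: sum.cong)
  also have "\<dots> = (\<Sum>j<d. \<Sum>i<d. A $$ (i, j) * B $$ (j, i))" by (rule sum.swap)
  also have "\<dots> = mtrace (B * A)"
    using assms by (auto simp: mtrace_def scalar_prod_def atLeast0LessThan mult.commute intro!: sum.cong)
  finally show ?thesis .
qed

lemma (in rep_setup) chr_trace:
  assumes "a \<in> carr" "b \<in> carr"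
  shows "fun_eval (chr H \<rho>) (mul a b) = fun_eval (chr H \<rho>) (mul b a)"
  using assms by (simp add: mtrace_rho hmul_carr rho_mult mtrace_comm[OF rho_carrier rho_carrier])

locale hecke_curve = hecke H for H :: "('n::finite) affine_hecke" +
  fixes Z U :: "'n pt set" and \<kappa> :: "('n pt \<Rightarrow> complex) \<Rightarrow> 'l::field"
  assumes Zcurve: "irreducible_curve H Z" and UZ: "U \<subseteq> Z" and emb: "ring_embedding H U \<kappa>"
begin

abbreviation "Reg \<equiv> regular_functions H U"

lemma UQC: "U \<subseteq> QC H"
  using UZ irreducible_curve_QC[OF Zcurve] by blast

lemma k_add: "f \<in> Reg \<Longrightarrow> g \<in> Reg \<Longrightarrow> \<kappa> (\<lambda>p. f p + g p) = \<kappa> f + \<kappa> g"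
  and k_mult: "f \<in> Reg \<Longrightarrow> g \<in> Reg \<Longrightarrow> \<kappa> (\<lambda>p. f p * g p) = \<kappa> f * \<kappa> g"
  and k_one: "\<kappa> (on_set U (\<lambda>_. 1)) = 1"
  using emb unfolding ring_embedding_def by blast+

lemma k_zero: "\<kappa> (\<lambda>_. 0) = 0"
proof -
  have "\<kappa> (\<lambda>_. 0) + \<kappa> (\<lambda>_. 0) = \<kappa> (\<lambda>_. 0) + 0"
    using k_add[OF regular_zero[OF UQC] regular_zero[OF UQC]] by (simp only: add_0_right)
  then show ?thesis by (rule add_left_imp_eq)
qed

lemma k_sum: "(\<And>i. i \<in> I \<Longrightarrow> f i \<in> Reg) \<Longrightarrow> \<kappa> (\<lambda>p. \<Sum>i\<in>I. f i p) = (\<Sum>i\<in>I. \<kappa> (f i))"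
proof (induction I rule: infinite_finite_induct)
  case (insert i I)
  then have "\<kappa> (\<lambda>p. f i p + (\<Sum>i\<in>I. f i p)) = \<kappa> (f i) + \<kappa> (\<lambda>p. \<Sum>i\<in>I. f i p)"
    by (intro k_add regular_sum[OF UQC]) auto
  with insert show ?case by simp
qed (auto simp: k_zero)

lemma k_sum_mult:
  assumes "\<And>i. i \<in> I \<Longrightarrow> f i \<in> Reg" "\<And>i. i \<in> I \<Longrightarrow> g i \<in> Reg"
  shows "(\<Sum>i\<in>I. \<kappa> (f i) * \<kappa> (g i)) = \<kappa> (\<lambda>p. \<Sum>i\<in>I. f i p * g i p)"
  using assms by (subst k_sum) (auto intro: regular_mult simp: k_mult)

lemma regular_eqI:
  assumes "f \<in> Reg" "g \<in> Reg" "infinite I" "I \<subseteq> U" "\<And>p. p \<in> I \<Longrightarrow> f p = g p"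
  shows "f = g"
proof -
  have "(\<lambda>p. on_set U (\<lambda>_. - 1) p * g p) \<in> Reg"
    by (intro regular_mult regular_const[OF UQC] assms)
  then have "(\<lambda>p. f p + on_set U (\<lambda>_. - 1) p * g p) \<in> Reg"
    by (intro regular_add assms)
  then have "(\<lambda>p. f p + on_set U (\<lambda>_. - 1) p * g p) = (\<lambda>_. 0)"
    using assms(3,4,5) by (intro regular_vanish[OF Zcurve UZ, of _ I]) (auto simp: on_set_def)
  moreover have "f p = 0 \<and> g p = 0" if "p \<notin> U" for p
    using that assms(1,2) by (auto simp: regular_functions_def)
  ultimately show ?thesis by (auto simp: fun_eq_iff on_set_def split: if_splits)
qed

lemma ring_set_reg: "ring_set (reg_ring H U \<kappa>)"
proof -
  have "0 \<in> reg_ring H U \<kappa>" "1 \<in> reg_ring H U \<kappa>"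
    unfolding reg_ring_def using k_zero k_one regular_zero[OF UQC] regular_const[OF UQC, of 1]
    by (auto intro: rev_image_eqI)
  moreover have "x + y \<in> reg_ring H U \<kappa> \<and> x * y \<in> reg_ring H U \<kappa>"
    if "x \<in> reg_ring H U \<kappa>" "y \<in> reg_ring H U \<kappa>" for x y
    using that unfolding reg_ring_def
    by (auto simp: k_add[symmetric] k_mult[symmetric] intro!: imageI regular_add regular_mult)
  moreover have "- x \<in> reg_ring H U \<kappa>" if x: "x \<in> reg_ring H U \<kappa>" for x
  proof -
    obtain f where f: "f \<in> Reg" "x = \<kappa> f" using x by (auto simp: reg_ring_def)
    have g: "(\<lambda>p. on_set U (\<lambda>_. - 1) p * f p) \<in> Reg"
      by (intro regular_mult regular_const[OF UQC] f)
    have "\<kappa> f + \<kappa> (\<lambda>p. on_set U (\<lambda>_. - 1) p * f p) = \<kappa> (\<lambda>p. f p + on_set U (\<lambda>_. - 1) p * f p)"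
      by (intro k_add[symmetric] f g)
    also have "(\<lambda>p. f p + on_set U (\<lambda>_. - 1) p * f p) = (\<lambda>_. 0)"
      using f(1) by (auto simp: fun_eq_iff on_set_def regular_functions_def)
    finally have "- x = \<kappa> (\<lambda>p. on_set U (\<lambda>_. - 1) p * f p)" using f by (simp add: k_zero minus_unique)
    then show ?thesis using g by (auto simp: reg_ring_def)
  qed
  ultimately show ?thesis by (auto simp: ring_set_def)
qed

abbreviation "con \<equiv> mulc_on H U \<kappa>"

lemma con_off: "u \<notin> msupp x y \<Longrightarrow> con x y u = 0"
proof -
  assume "u \<notin> msupp x y"
  then have "on_set U (mulc H x y u) = (\<lambda>_. 0)" by (simp add: msupp_def on_set_def fun_eq_iff)
  then show ?thesis by (simp add: mulc_on_def k_zero)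
qed

lemma mulc_reg: "x \<in> Wgrp H \<Longrightarrow> y \<in> Wgrp H \<Longrightarrow> on_set U (mulc H x y u) \<in> Reg"
  by (intro Lam_regular mulc_Lam UQC)

text \<open>Associativity compares images under \<open>\<kappa>\<close> of two regular functions,
  which agree on \<open>U\<close> because the algebra at each point of \<open>U\<close> is
  associative. Sums run over \<open>msupp\<close>, which does not depend on the point, and are cut
  down to the actual supports at the end.\<close>

lemma structure_constants_on: "structure_constants H con"
proof
  fix x y assume xy: "x \<in> Wgrp H" "y \<in> Wgrp H"
  have "supp (con x y) \<subseteq> msupp x y" using con_off by blast
  then show "finite (supp (con x y)) \<and> supp (con x y) \<subseteq> Wgrp H"
    using finite_msupp[OF xy] msupp_Wgrp[OF xy] finite_subset by blast
next
  fix x assume x: "x \<in> Wgrp H"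
  have at: "mulc H id x u p = Nb x u \<and> mulc H x id u p = Nb x u" if p: "p \<in> U" for u p
  proof -
    interpret P: structure_constants H "mulc_at H p" by (rule structure_constants_at) (use p UQC in auto)
    show ?thesis using P.unit_c[OF x] by (auto simp: mulc_at_def fun_eq_iff)
  qed
  have "on_set U (mulc H id x u) = (if u = x then on_set U (\<lambda>_. 1) else (\<lambda>_. 0))"
     "on_set U (mulc H x id u) = (if u = x then on_set U (\<lambda>_. 1) else (\<lambda>_. 0))" for u
    by (rule ext; simp add: on_set_def at; simp add: Nb_def)+
  then have "con id x u = Nb x u \<and> con x id u = Nb x u" for u
    by (simp add: mulc_on_def Nb_def k_one k_zero)
  then show "con id x = Nb x" "con x id = Nb x" by blast+
next
  fix x y z s assume xyz: "x \<in> Wgrp H" "y \<in> Wgrp H" "z \<in> Wgrp H"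
  have W: "u \<in> Wgrp H" if "u \<in> msupp x y \<or> u \<in> msupp y z" for u
    using that xyz msupp_Wgrp by blast
  have 1: "(\<Sum>u\<in>msupp x y. con x y u * con u z s) = \<kappa> (\<lambda>p. \<Sum>u\<in>msupp x y. on_set U (mulc H x y u) p * on_set U (mulc H u z s) p)"
    unfolding mulc_on_def using W by (intro k_sum_mult mulc_reg xyz) auto
  have 2: "(\<Sum>u\<in>msupp y z. con y z u * con x u s) = \<kappa> (\<lambda>p. \<Sum>u\<in>msupp y z. on_set U (mulc H y z u) p * on_set U (mulc H x u s) p)"
    unfolding mulc_on_def using W by (intro k_sum_mult mulc_reg xyz) auto
  have "(\<Sum>u\<in>msupp x y. on_set U (mulc H x y u) p * on_set U (mulc H u z s) p) =
      (\<Sum>u\<in>msupp y z. on_set U (mulc H y z u) p * on_set U (mulc H x u s) p)" for p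
  proof (cases "p \<in> U")
    case True
    interpret P: structure_constants H "mulc_at H p" by (rule structure_constants_at) (use True UQC in auto)
    have "(\<Sum>u\<in>msupp x y. mulc H x y u p * mulc H u z s p) = (\<Sum>u\<in>supp (mulc_at H p x y). mulc_at H p x y u * mulc_at H p u z s)"
      using finite_msupp xyz supp_mulc_at[of H p x y]
      by (intro sum.mono_neutral_cong_right) (auto simp: mulc_at_def msupp_def)
    also have "\<dots> = (\<Sum>u\<in>supp (mulc_at H p y z). mulc_at H p y z u * mulc_at H p x u s)"
      by (intro P.assoc_c xyz)
    also have "\<dots> = (\<Sum>u\<in>msupp y z. mulc H y z u p * mulc H x u s p)"
      using finite_msupp xyz supp_mulc_at[of H p y z]
      by (intro sum.mono_neutral_cong_left) (auto simp: mulc_at_def msupp_def)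
    finally show ?thesis using True by (simp add: on_set_def)
  qed (simp add: on_set_def)
  then have "(\<Sum>u\<in>msupp x y. con x y u * con u z s) = (\<Sum>u\<in>msupp y z. con y z u * con x u s)"
    unfolding 1 2 by simp
  moreover have "(\<Sum>u\<in>msupp x y. con x y u * con u z s) = (\<Sum>u\<in>supp (con x y). con x y u * con u z s)"
    using finite_msupp xyz con_off[of _ x y] by (intro sum.mono_neutral_right) auto
  moreover have "(\<Sum>u\<in>msupp y z. con y z u * con x u s) = (\<Sum>u\<in>supp (con y z). con y z u * con x u s)"
    using finite_msupp xyz con_off[of _ y z] by (intro sum.mono_neutral_right) auto
  ultimately show "(\<Sum>u\<in>supp (con x y). con x y u * con u z s) = (\<Sum>u\<in>supp (con y z). con y z u * con x u s)"
    by simp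
qed

end

section \<open>The trace functional\<close>

text \<open>\<open>I\<close> is a set of points at which \<open>Sg\<close> is known to be a trace;
  in the application these are points of the component, where \<open>Sg\<close> is a combination of
  characters.\<close>

locale sigma_setup = hecke_curve H Z U \<kappa>
  for H :: "('n::finite) affine_hecke" and Z U :: "'n pt set" and \<kappa> :: "('n pt \<Rightarrow> complex) \<Rightarrow> 'l::field" +
  fixes Sg :: "'n aff \<Rightarrow> 'n pt \<Rightarrow> complex" and I :: "'n pt set"
  assumes Sg_reg: "w \<in> Wgrp H \<Longrightarrow> Sg w \<in> regular_functions H U"
    and I: "infinite I" "I \<subseteq> U"
    and Sg_trace: "p \<in> I \<Longrightarrow> x \<in> Wgrp H \<Longrightarrow> y \<in> Wgrp H \<Longrightarrow>
      fun_eval (\<lambda>w. Sg w p) (mulc_at H p x y) = fun_eval (\<lambda>w. Sg w p) (mulc_at H p y x)"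
begin

definition S :: "'n aff \<Rightarrow> 'l" where
  "S w = (if w \<in> Wgrp H then \<kappa> (Sg w) else 0)"

text \<open>The value of \<Sigma> on the product of \<open>Nb x\<close> and \<open>Nb y\<close> as a
  function of the point. It is regular, so the identity principle applies to it.\<close>

definition G :: "'n aff \<Rightarrow> 'n aff \<Rightarrow> 'n pt \<Rightarrow> complex" where
  "G x y p = (\<Sum>u\<in>msupp x y. on_set U (mulc H x y u) p * Sg u p)"

lemma G_reg:
  assumes "x \<in> Wgrp H" "y \<in> Wgrp H"
  shows "G x y \<in> Reg"
proof -
  have "(\<lambda>p. \<Sum>u\<in>msupp x y. on_set U (mulc H x y u) p * Sg u p) \<in> Reg"
    using msupp_Wgrp[OF assms] assms
    by (intro regular_sum[OF UQC] regular_mult mulc_reg Sg_reg) auto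
  then show ?thesis unfolding G_def[abs_def] .
qed

lemma fun_eval_S_con:
  assumes "x \<in> Wgrp H" "y \<in> Wgrp H"
  shows "fun_eval S (con x y) = \<kappa> (G x y)"
proof -
  have W: "u \<in> Wgrp H" if "u \<in> msupp x y" for u using msupp_Wgrp[OF assms] that by blast
  have "\<kappa> (G x y) = \<kappa> (\<lambda>p. \<Sum>u\<in>msupp x y. on_set U (mulc H x y u) p * Sg u p)"
    by (simp add: G_def[abs_def])
  also have "\<dots> = (\<Sum>u\<in>msupp x y. \<kappa> (on_set U (mulc H x y u)) * \<kappa> (Sg u))"
    using W assms by (intro k_sum_mult[symmetric] mulc_reg Sg_reg) auto
  also have "\<dots> = (\<Sum>u\<in>msupp x y. con x y u * S u)"
    using W by (intro sum.cong refl) (simp add: mulc_on_def S_def)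
  also have "\<dots> = fun_eval S (con x y)"
    using con_off[of _ x y] finite_msupp[OF assms] by (intro fun_eval_superset[symmetric]) auto
  finally show ?thesis by simp
qed

lemma G_at:
  assumes "x \<in> Wgrp H" "y \<in> Wgrp H" "p \<in> U"
  shows "G x y p = fun_eval (\<lambda>w. Sg w p) (mulc_at H p x y)"
proof -
  have "fun_eval (\<lambda>w. Sg w p) (mulc_at H p x y) = (\<Sum>u\<in>msupp x y. mulc_at H p x y u * Sg u p)"
    by (rule fun_eval_superset) (use finite_msupp assms supp_mulc_at[of H p x y] in \<open>auto simp: msupp_def\<close>)
  then show ?thesis using assms(3) by (simp add: G_def on_set_def mulc_at_def)
qed

text \<open>The trace property amounts to equality of the regular functions \<open>G x y\<close> and
  \<open>G y x\<close>, which agree on the infinite set \<open>I\<close>.\<close>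

lemma traced: "traced_structure_constants H con S"
proof -
  interpret structure_constants H con by (rule structure_constants_on)
  show ?thesis
  proof
    fix x y assume xy: "x \<in> Wgrp H" "y \<in> Wgrp H"
    have "G x y = G y x"
      by (rule regular_eqI[OF G_reg G_reg I]) (use xy I Sg_trace G_at in \<open>auto simp: subset_iff\<close>)
    then show "fun_eval S (con x y) = fun_eval S (con y x)" by (simp add: fun_eval_S_con xy)
  qed (simp add: S_def)
qed

text \<open>The value of \<Sigma> on \<open>Nb w\<close> times the family \<open>h\<close> is a
  regular function of the point with infinitely many zeros, hence zero in the field. The set
  \<open>F\<close> bounds the support of the family uniformly, so the value is a finite sum over a
  fixed index set.\<close>

lemma left_act_zero:
  assumes F: "finite F" "F \<subseteq> Wgrp H" and h: "\<And>y. h y \<in> Lam H" "\<And>y. y \<notin> F \<Longrightarrow> h y = (\<lambda>_. 0)"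
    and J: "infinite J" "J \<subseteq> U"
    and zero: "\<And>p w. p \<in> J \<Longrightarrow> w \<in> Wgrp H \<Longrightarrow>
      fun_eval (\<lambda>w. Sg w p) (hmul (mulc_at H p) (Nb w) (\<lambda>y. h y p)) = 0"
  shows "left_act H con S (\<lambda>y. \<kappa> (on_set U (h y))) = (\<lambda>_. 0)"
proof -
  interpret structure_constants H con by (rule structure_constants_on)
  define k where "k = (\<lambda>y. \<kappa> (on_set U (h y)))"
  have koff: "k y = 0" if "y \<notin> F" for y
  proof -
    have "on_set U (h y) = (\<lambda>_. 0)" using h(2)[OF that] by (simp add: on_set_def fun_eq_iff)
    then show ?thesis by (simp add: k_def k_zero)
  qed
  then have sk: "supp k \<subseteq> F" by auto
  have kc: "k \<in> carr" by (rule hcarrierI) (use sk F finite_subset in auto)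
  have "fun_eval S (hmul con (Nb w) k) = 0" if w: "w \<in> Wgrp H" for w
  proof -
    have "fun_eval S (hmul con (Nb w) k) = (\<Sum>y\<in>supp k. k y * fun_eval S (con w y))"
      by (simp add: fun_eval_hmul kc hcarrier_Nb w) (simp add: Nb_def)
    also have "\<dots> = (\<Sum>y\<in>F. k y * fun_eval S (con w y))"
      by (rule sum.mono_neutral_left) (use F sk in auto)
    also have "\<dots> = (\<Sum>y\<in>F. \<kappa> (on_set U (h y)) * \<kappa> (G w y))"
      using F w by (intro sum.cong refl) (auto simp: k_def fun_eval_S_con subset_iff)
    also have "\<dots> = \<kappa> (\<lambda>p. \<Sum>y\<in>F. on_set U (h y) p * G w y p)"
      using F w by (intro k_sum_mult Lam_regular h UQC G_reg) auto
    also have "(\<lambda>p. \<Sum>y\<in>F. on_set U (h y) p * G w y p) = (\<lambda>_. 0)"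
    proof (rule regular_vanish[OF Zcurve UZ _ J])
      show "(\<lambda>p. \<Sum>y\<in>F. on_set U (h y) p * G w y p) \<in> Reg"
        using F w by (intro regular_sum[OF UQC] regular_mult Lam_regular h UQC G_reg) auto
      fix p assume p: "p \<in> J"
      then have pU: "p \<in> U" using J by auto
      interpret P: structure_constants H "mulc_at H p"
        by (rule structure_constants_at) (use pU UQC in auto)
      define a where "a = (\<lambda>y. h y p)"
      have sa: "supp a \<subseteq> F"
      proof
        fix y assume "y \<in> supp a"
        then show "y \<in> F" using h(2)[of y] by (cases "y \<in> F") (auto simp: a_def)
      qed
      have a: "a \<in> P.carr" by (rule hcarrierI) (use sa F finite_subset in auto)
      have "0 = fun_eval (\<lambda>w. Sg w p) (hmul (mulc_at H p) (Nb w) a)"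
        using zero[OF p w] by (simp add: a_def)
      also have "\<dots> = (\<Sum>y\<in>supp a. a y * fun_eval (\<lambda>w. Sg w p) (mulc_at H p w y))"
        by (simp add: P.fun_eval_hmul a hcarrier_Nb w) (simp add: Nb_def)
      also have "\<dots> = (\<Sum>y\<in>F. a y * fun_eval (\<lambda>w. Sg w p) (mulc_at H p w y))"
        by (rule sum.mono_neutral_left) (use F sa in auto)
      also have "\<dots> = (\<Sum>y\<in>F. on_set U (h y) p * G w y p)"
        using F w pU by (intro sum.cong refl) (auto simp: G_at subset_iff on_set_def a_def)
      finally show "(\<Sum>y\<in>F. on_set U (h y) p * G w y p) = 0" by simp
    qed
    finally show ?thesis by (simp add: k_zero)
  qed
  then show ?thesis using kc by (auto simp: left_act_eq k_def[symmetric])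
qed

end

lemma (in hecke) fun_eval_character_sum:
  assumes Sg: "\<And>w. w \<in> Wgrp H \<Longrightarrow> Sg w v = (\<Sum>\<chi>\<in>X. c \<chi> * \<chi> w)"
    and a: "a \<in> hcarrier H UNIV"
  shows "fun_eval (\<lambda>w. Sg w v) a = (\<Sum>\<chi>\<in>X. c \<chi> * fun_eval \<chi> a)"
proof -
  have "fun_eval (\<lambda>w. Sg w v) a = (\<Sum>u\<in>supp a. a u * (\<Sum>\<chi>\<in>X. c \<chi> * \<chi> u))"
    unfolding fun_eval_def using hcarrierD(2)[OF a] by (intro sum.cong refl) (use Sg in auto)
  also have "\<dots> = (\<Sum>u\<in>supp a. \<Sum>\<chi>\<in>X. c \<chi> * (a u * \<chi> u))"
    by (simp add: sum_distrib_left mult_ac)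
  also have "\<dots> = (\<Sum>\<chi>\<in>X. \<Sum>u\<in>supp a. c \<chi> * (a u * \<chi> u))" by (rule sum.swap)
  also have "\<dots> = (\<Sum>\<chi>\<in>X. c \<chi> * fun_eval \<chi> a)"
    by (simp add: fun_eval_def sum_distrib_left)
  finally show ?thesis .
qed

lemma (in hecke) character_sum_trace:
  assumes v: "v \<in> QC H" and Sg: "\<And>w. w \<in> Wgrp H \<Longrightarrow> Sg w v = (\<Sum>\<chi>\<in>X. c \<chi> * \<chi> w)"
    and X: "\<And>\<chi>. \<chi> \<in> X \<Longrightarrow> \<exists>d \<rho>. rep H v d \<rho> \<and> \<chi> = chr H \<rho>"
    and xy: "x \<in> Wgrp H" "y \<in> Wgrp H"
  shows "fun_eval (\<lambda>w. Sg w v) (mulc_at H v x y) = fun_eval (\<lambda>w. Sg w v) (mulc_at H v y x)"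
proof -
  interpret P: structure_constants H "mulc_at H v" by (rule structure_constants_at[OF v])
  have N: "Nb x \<in> P.carr" "Nb y \<in> P.carr" using xy by (auto intro: hcarrier_Nb)
  have c: "mulc_at H v x y \<in> P.carr" "mulc_at H v y x \<in> P.carr"
    using P.hmul_carr[OF N] P.hmul_carr[OF N(2,1)] by (simp_all add: hmul_Nb)
  have "fun_eval \<chi> (mulc_at H v x y) = fun_eval \<chi> (mulc_at H v y x)" if \<chi>: "\<chi> \<in> X" for \<chi>
  proof -
    obtain d \<rho> where "rep H v d \<rho>" "\<chi> = chr H \<rho>" using X[OF \<chi>] by blast
    then interpret R: rep_setup H v d \<rho> using v hecke by unfold_locales auto
    show ?thesis using R.chr_trace[OF N] by (simp add: hmul_Nb \<open>\<chi> = chr H \<rho>\<close>)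
  qed
  then show ?thesis by (simp add: fun_eval_character_sum[OF Sg] c)
qed

text \<open>An element acting by zero in a module still does so after multiplication by
  \<open>Nb w\<close>, so each trace in the sum vanishes, whatever its coefficient.\<close>

lemma (in hecke) character_sum_vanish:
  assumes v: "v \<in> QC H" and Sg: "\<And>w. w \<in> Wgrp H \<Longrightarrow> Sg w v = (\<Sum>\<chi>\<in>X. c \<chi> * \<chi> w)"
    and X: "\<And>\<chi>. \<chi> \<in> X \<Longrightarrow> \<exists>d \<rho>. rep H v d \<rho> \<and> \<chi> = chr H \<rho> \<and> \<rho> a = 0\<^sub>m d d"
    and w: "w \<in> Wgrp H" and a: "a \<in> hcarrier H UNIV"
  shows "fun_eval (\<lambda>w. Sg w v) (hmul (mulc_at H v) (Nb w) a) = 0"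
proof -
  interpret P: structure_constants H "mulc_at H v" by (rule structure_constants_at[OF v])
  have N: "Nb w \<in> P.carr" using w by (auto intro: hcarrier_Nb)
  have "fun_eval \<chi> (hmul (mulc_at H v) (Nb w) a) = 0" if \<chi>: "\<chi> \<in> X" for \<chi>
  proof -
    obtain d \<rho> where r: "rep H v d \<rho>" "\<chi> = chr H \<rho>" "\<rho> a = 0\<^sub>m d d" using X[OF \<chi>] by blast
    then interpret R: rep_setup H v d \<rho> using v hecke by unfold_locales auto
    have "\<rho> (hmul (mulc_at H v) (Nb w) a) = 0\<^sub>m d d"
      using R.rho_carrier[OF N] by (simp add: R.rho_mult N a r(3))
    then show ?thesis by (simp add: R.mtrace_rho P.hmul_carr N a r(2)) (simp add: mtrace_def)
  qed
  then show ?thesis by (simp add: fun_eval_character_sum[OF Sg] P.hmul_carr N a)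
qed

section \<open>The finite Weyl group\<close>

lemma pairing_add_left: "pairing (x + y) z = pairing x z + pairing y z"
  by (simp add: pairing_def algebra_simps sum.distrib)

lemma additive_scale:
  fixes f :: "int ^ 'n \<Rightarrow> int ^ 'm"
  assumes "Modules.additive f"
  shows "f (k *s x) = k *s f x"
proof -
  interpret Modules.additive f by fact
  have nat: "f (int n *s x) = int n *s f x" for n
  proof (induction n)
    case 0
    then show ?case by (simp add: zero)
  next
    case (Suc n)
    have "f (int (Suc n) *s x) = f (x + int n *s x)"
      by (simp add: vector_sadd_rdistrib)
    then show ?case using Suc by (simp add: add vector_sadd_rdistrib)
  qed
  show ?thesis
  proof (cases "k \<ge> 0")
    case True
    then show ?thesis using nat[of "nat k"] by simp
  next
    case False
    then have "k *s x = - (int (nat (- k)) *s x)" "k *s f x = - (int (nat (- k)) *s f x)"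
      by (simp_all add: Finite_Cartesian_Product.vec_eq_iff)
    then show ?thesis using nat[of "nat (- k)"] by (simp add: minus)
  qed
qed

lemma refl_additive: "Modules.additive (refl D \<alpha>)"
  by standard (simp add: refl_def pairing_add_left vector_sadd_rdistrib)

lemma W0_additive: "w \<in> W0 D \<Longrightarrow> Modules.additive w"
  by (induction rule: W0.induct) (auto simp: Modules.additive_def additive.add[OF refl_additive])

lemma W0_comp: "w \<in> W0 D \<Longrightarrow> w' \<in> W0 D \<Longrightarrow> w \<circ> w' \<in> W0 D"
  by (induction rule: W0.induct) (auto simp: comp_assoc intro: W0.intros)

lemma W0_bij:
  assumes "semisimple_based_root_datum D" "w \<in> W0 D"
  shows "bij w"
  using assms(2)
proof (induction rule: W0.induct)
  case (W0_refl \<alpha> w)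
  have 2: "pairing \<alpha> (coroot D \<alpha>) = 2"
    using W0_refl assms(1) by (auto simp: semisimple_based_root_datum_def)
  have "refl D \<alpha> (refl D \<alpha> x) = x" for x
  proof -
    have "refl D \<alpha> \<alpha> = - \<alpha>" by (rule Finite_Cartesian_Product.vec_eq_iff[THEN iffD2]) (simp add: refl_def 2)
    then have "refl D \<alpha> (- (k *s \<alpha>)) = k *s \<alpha>" for k
      using additive_scale[OF refl_additive, of D \<alpha> k \<alpha>] by (simp add: additive.minus[OF refl_additive])
    then have "refl D \<alpha> (x + - (k *s \<alpha>)) = refl D \<alpha> x + k *s \<alpha>" for k
      by (simp only: additive.add[OF refl_additive])
    from this[of "pairing x (coroot D \<alpha>)"] show ?thesis by (simp add: refl_def)
  qed
  then have "bij (refl D \<alpha>)" by (intro o_bij[of "refl D \<alpha>"]) auto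
  then show ?case using W0_refl by (intro bij_comp) auto
qed (rule bij_id)

lemma W0_roots:
  assumes "semisimple_based_root_datum D" "w \<in> W0 D" "\<beta> \<in> roots D"
  shows "w \<beta> \<in> roots D"
  using assms(2)
proof (induction rule: W0.induct)
  case (W0_refl \<alpha> w)
  then show ?case using assms(1) by (auto simp: semisimple_based_root_datum_def)
qed (simp add: assms)

definition orb :: "('n::finite, 'z) root_datum_scheme \<Rightarrow> 'n lat \<Rightarrow> 'n lat set" where
  "orb D x = {w x | w. w \<in> W0 D}"

lemma orb_self: "x \<in> orb D x"
  unfolding orb_def using W0.W0_id[of D] by (metis (mono_tags, lifting) id_apply mem_Collect_eq)

text \<open>The roots span rationally, so a nonzero multiple of \<open>x\<close> is an integral
  combination of roots. Elements of \<open>W0 D\<close> map the finite set of roots to itself, and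
  the restriction of \<open>w\<close> to the roots determines \<open>w x\<close> because the lattice
  has no torsion.\<close>

lemma finite_orb:
  assumes D: "semisimple_based_root_datum D"
  shows "finite (orb D x)"
proof -
  obtain m :: int and c where mc: "m \<noteq> 0" "m *s x = (\<Sum>\<alpha>\<in>roots D. c \<alpha> *s \<alpha>)"
    using D unfolding semisimple_based_root_datum_def by metis
  have fin: "finite (roots D)" using D unfolding semisimple_based_root_datum_def by blast
  \<comment> \<open>Recovers \<open>w x\<close> from the restriction of \<open>w\<close> to the
    roots; the chosen vector is unique because \<open>m\<close> is nonzero.\<close>
  define F where "F f = (SOME y. m *s y = (\<Sum>\<alpha>\<in>roots D. c \<alpha> *s f \<alpha>))" for f :: "'a lat \<Rightarrow> 'a lat"
  have "w x \<in> F ` (PiE (roots D) (\<lambda>_. roots D))" if w: "w \<in> W0 D" for w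
  proof -
    define f where "f = restrict w (roots D)"
    have "m *s w x = w (m *s x)" by (rule additive_scale[symmetric, OF W0_additive[OF w]])
    also have "\<dots> = (\<Sum>\<alpha>\<in>roots D. w (c \<alpha> *s \<alpha>))"
      unfolding mc by (rule additive.sum[OF W0_additive[OF w]])
    also have "\<dots> = (\<Sum>\<alpha>\<in>roots D. c \<alpha> *s f \<alpha>)"
      by (intro sum.cong refl) (simp add: f_def additive_scale[OF W0_additive[OF w]])
    finally have 1: "m *s w x = (\<Sum>\<alpha>\<in>roots D. c \<alpha> *s f \<alpha>)" .
    then have "m *s F f = (\<Sum>\<alpha>\<in>roots D. c \<alpha> *s f \<alpha>)" unfolding F_def by (rule someI)
    with 1 have "m *s F f = m *s w x" by simp
    then have "vec_nth (m *s F f) i = vec_nth (m *s w x) i" for i by simp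
    then have "F f = w x" using mc(1) by (intro Finite_Cartesian_Product.vec_eq_iff[THEN iffD2]) simp
    moreover have "f \<in> PiE (roots D) (\<lambda>_. roots D)"
      using W0_roots[OF D w] by (auto simp: f_def)
    ultimately show ?thesis by (metis image_eqI)
  qed
  then have "orb D x \<subseteq> F ` (PiE (roots D) (\<lambda>_. roots D))" by (auto simp: orb_def)
  then show ?thesis using finite_PiE[OF fin, of "\<lambda>_. roots D"] fin finite_subset by blast
qed

lemma orb_stable:
  assumes D: "semisimple_based_root_datum D" and w: "w \<in> W0 D"
  shows "w ` orb D x = orb D x"
proof (rule card_subset_eq[OF finite_orb[OF D]])
  show "w ` orb D x \<subseteq> orb D x"
  proof
    fix y assume "y \<in> w ` orb D x"
    then obtain w' where "w' \<in> W0 D" "y = w (w' x)" by (auto simp: orb_def)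
    then show "y \<in> orb D x" unfolding orb_def using W0_comp[OF w, of w']
      by (metis (mono_tags, lifting) comp_apply mem_Collect_eq)
  qed
  have "inj w" using W0_bij[OF D w] by (rule bij_is_inj)
  then show "card (w ` orb D x) = card (orb D x)" by (metis card_image inj_on_subset subset_UNIV)
qed

section \<open>Weights and central characters\<close>

lemma smult_mat_vec:
  assumes "A \<in> carrier_mat n m" "u \<in> carrier_vec m"
  shows "(c \<cdot>\<^sub>m A) *\<^sub>v u = c \<cdot>\<^sub>v (A *\<^sub>v u :: 'a::comm_ring_1 Matrix.vec)"
  by (rule eq_vecI) (use assms in \<open>auto simp: smult_scalar_prod_distrib[of _ m]\<close>)

abbreviation eigen_steps :: "'a::comm_ring_1 mat \<Rightarrow> 'a list \<Rightarrow> 'a Matrix.vec \<Rightarrow> 'a Matrix.vec" where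
  "eigen_steps B \<mu>s \<equiv> foldr (\<lambda>\<mu> x. B *\<^sub>v x - \<mu> \<cdot>\<^sub>v x) \<mu>s"

text \<open>The last nonzero vector in the chain is an eigenvector for the next scalar, the list
  being consumed from its right end. The predicate \<open>P\<close> is stable under the steps, so
  the eigenvector can be found inside a prescribed joint eigenspace.\<close>

lemma eigenvector_step:
  fixes B :: "'a::field mat"
  assumes B: "B \<in> carrier_mat d d"
    and P: "\<And>x. P x \<Longrightarrow> x \<in> carrier_vec d" "\<And>x \<mu>. P x \<Longrightarrow> P (B *\<^sub>v x - \<mu> \<cdot>\<^sub>v x)"
    and u: "P u" "u \<noteq> 0\<^sub>v d" "eigen_steps B \<mu>s u = 0\<^sub>v d"
  shows "\<exists>\<mu>\<in>set \<mu>s. \<exists>x. P x \<and> x \<noteq> 0\<^sub>v d \<and> B *\<^sub>v x = \<mu> \<cdot>\<^sub>v x"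
  using u(3)
proof (induction \<mu>s)
  case (Cons \<mu> \<mu>s)
  define x where "x = eigen_steps B \<mu>s u"
  have Px: "P x" unfolding x_def by (induction \<mu>s) (auto intro: P u)
  show ?case
  proof (cases "x = 0\<^sub>v d")
    case True
    then show ?thesis using Cons by (auto simp: x_def)
  next
    case False
    have c: "B *\<^sub>v x \<in> carrier_vec d" "\<mu> \<cdot>\<^sub>v x \<in> carrier_vec d" using B P(1)[OF Px] by auto
    have "B *\<^sub>v x - \<mu> \<cdot>\<^sub>v x = 0\<^sub>v d" using Cons(2) by (simp add: x_def)
    then have "B *\<^sub>v x = \<mu> \<cdot>\<^sub>v x"
    proof (intro eq_vecI)
      fix i assume i: "i < dim_vec (\<mu> \<cdot>\<^sub>v x)"
      assume "B *\<^sub>v x - \<mu> \<cdot>\<^sub>v x = 0\<^sub>v d"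
      then have "(B *\<^sub>v x - \<mu> \<cdot>\<^sub>v x) $ i = (0\<^sub>v d :: 'a Matrix.vec) $ i" by simp
      then show "(B *\<^sub>v x) $ i = (\<mu> \<cdot>\<^sub>v x) $ i" using c i by auto
    qed (use c carrier_matD(1)[OF B] in auto)
    then show ?thesis using Px False by auto
  qed
qed (use u in auto)

text \<open>For a character \<open>t\<close> of the lattice this is \<open>\<Prod>\<^bsub>y\<in>A\<^esub> (\<theta>\<^sub>x - t(y))\<close>, expanded so that its
  coefficients are visibly Laurent polynomials when \<open>t\<close> is a generic point.\<close>
definition qel :: "('n::finite) affine_hecke \<Rightarrow> 'n pt \<Rightarrow> 'n lat \<Rightarrow> ('n lat \<Rightarrow> complex) \<Rightarrow> 'n lat set \<Rightarrow> 'n aff \<Rightarrow> complex" where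
  "qel H v x t A = (\<lambda>w. \<Sum>B\<in>Pow A. ((- 1) ^ card B * t (\<Sum>B)) * theta_at H v (int (card A - card B) *s x) w)"

lemma (in hecke) qel_carr: "qel H v x t A \<in> hcarrier H UNIV"
  unfolding qel_def by (intro hcarrier_sum theta_carr) auto

lemma sum_Pow_insert:
  assumes "finite A" "y \<notin> A"
  shows "(\<Sum>B\<in>Pow (insert y A). f B) = (\<Sum>B\<in>Pow A. f B) + (\<Sum>B\<in>Pow A. f (insert y B))"
proof -
  have "(\<Sum>B\<in>Pow (insert y A). f B) = (\<Sum>B\<in>Pow A. f B) + (\<Sum>B\<in>insert y ` Pow A. f B)"
    unfolding Pow_insert by (rule sum.union_disjoint) (use assms in auto)
  also have "(\<Sum>B\<in>insert y ` Pow A. f B) = (\<Sum>B\<in>Pow A. f (insert y B))"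
    by (rule sum.reindex_cong[of "insert y"]) (use assms in \<open>auto simp: inj_on_def\<close>)
  finally show ?thesis .
qed

context rep_setup
begin

text \<open>This is multiplication by the factor \<open>\<theta>_x - t y\<close>: subsets without
  \<open>y\<close> carry the \<open>\<theta>_x\<close> term, those with \<open>y\<close> the scalar
  term. Together with \<open>qel_empty\<close> it shows that the alternating sum over subsets is the
  product.\<close>

lemma qel_insert:
  assumes t: "\<And>x y. t (x + y) = t x * t y" and A: "finite A" "y \<notin> A"
  shows "qel H v x t (insert y A) = (\<lambda>w. mul (th x) (qel H v x t A) w + (- t y) * qel H v x t A w)"
proof
  fix w
  have 1: "mul (th x) (qel H v x t A) w = (\<Sum>B\<in>Pow A. (-1) ^ card B * t (\<Sum>B) * th (int (card (insert y A) - card B) *s x) w)"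
  proof -
    have "mul (th x) (qel H v x t A) = (\<lambda>w. \<Sum>B\<in>Pow A. (-1) ^ card B * t (\<Sum>B) * mul (th x) (th (int (card A - card B) *s x)) w)"
      unfolding qel_def by (rule hmul_sum_right) (auto intro: theta_carr)
    moreover have "mul (th x) (th (int (card A - card B) *s x)) = th (int (card (insert y A) - card B) *s x)" if "B \<in> Pow A" for B
    proof -
      have "card (insert y A) - card B = Suc (card A - card B)"
        using A that by (simp add: Suc_diff_le card_mono)
      then have "int (card (insert y A) - card B) *s x = x + int (card A - card B) *s x"
        by (simp add: vector_sadd_rdistrib)
      then show ?thesis using theta_mult[OF v] by simp
    qed
    ultimately show ?thesis by simp
  qed
  have 2: "(- t y) * qel H v x t A w = (\<Sum>B\<in>Pow A. (-1) ^ card (insert y B) * t (\<Sum>(insert y B)) * th (int (card (insert y A) - card (insert y B)) *s x) w)"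
    unfolding qel_def sum_distrib_left
  proof (intro sum.cong refl)
    fix B assume "B \<in> Pow A"
    then have "finite B" "y \<notin> B" using A finite_subset by auto
    then show "- t y * ((- 1) ^ card B * t (\<Sum> B) * th (int (card A - card B) *s x) w) =
         (- 1) ^ card (insert y B) * t (\<Sum> (insert y B)) * th (int (card (insert y A) - card (insert y B)) *s x) w"
      using A by (simp add: t)
  qed
  show "qel H v x t (insert y A) w = mul (th x) (qel H v x t A) w + (- t y) * qel H v x t A w"
    by (subst 1, subst 2) (simp only: qel_def sum_Pow_insert[OF A])
qed

lemma rho_qel_insert:
  assumes t: "\<And>x y. t (x + y) = t x * t y" and A: "finite A" "y \<notin> A" and u: "u \<in> carrier_vec d"
  shows "\<rho> (qel H v x t (insert y A)) *\<^sub>v u = \<rho> (th x) *\<^sub>v (\<rho> (qel H v x t A) *\<^sub>v u) - t y \<cdot>\<^sub>v (\<rho> (qel H v x t A) *\<^sub>v u)"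
proof -
  have c: "qel H v x t A \<in> carr" "th x \<in> carr" by (rule qel_carr theta_carr)+
  have r: "\<rho> (qel H v x t A) \<in> carrier_mat d d" "\<rho> (th x) \<in> carrier_mat d d" using c by (auto intro: rho_carrier)
  have "\<rho> (qel H v x t (insert y A)) = \<rho> (th x) * \<rho> (qel H v x t A) + (- t y) \<cdot>\<^sub>m \<rho> (qel H v x t A)"
    unfolding qel_insert[OF t A] rho_mult[OF c(2,1), symmetric] rho_scale[OF c(1), symmetric]
    by (intro rho_add hmul_carr hcarrier_scale c) auto
  then have "\<rho> (qel H v x t (insert y A)) *\<^sub>v u = (\<rho> (th x) * \<rho> (qel H v x t A)) *\<^sub>v u + ((- t y) \<cdot>\<^sub>m \<rho> (qel H v x t A)) *\<^sub>v u"
    using r u by (simp add: add_mult_distrib_mat_vec[of _ d d])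
  also have "\<dots> = \<rho> (th x) *\<^sub>v (\<rho> (qel H v x t A) *\<^sub>v u) + (- t y) \<cdot>\<^sub>v (\<rho> (qel H v x t A) *\<^sub>v u)"
    using r u by (simp add: assoc_mult_mat_vec[of _ d d _ d] smult_mat_vec[of _ d d])
  also have "\<dots> = \<rho> (th x) *\<^sub>v (\<rho> (qel H v x t A) *\<^sub>v u) - t y \<cdot>\<^sub>v (\<rho> (qel H v x t A) *\<^sub>v u)"
    using r u by (intro eq_vecI) auto
  finally show ?thesis .
qed

lemma qel_empty: "t 0 = 1 \<Longrightarrow> qel H v x t {} = Nb id"
  by (simp add: qel_def theta_0[OF v])

text \<open>Splits off the factors indexed by \<open>ys\<close>. If the full product acts by zero,
  vectors in the image of the factor over \<open>A\<close> are killed by the remaining steps, which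
  is the input of \<open>eigenvector_step\<close>.\<close>

lemma rho_qel_foldr:
  assumes t: "\<And>x y. t (x + y) = t x * t y" and A: "finite A" "distinct ys" "set ys \<inter> A = {}" and u: "u \<in> carrier_vec d"
  shows "\<rho> (qel H v x t (set ys \<union> A)) *\<^sub>v u = eigen_steps (\<rho> (th x)) (map t ys) (\<rho> (qel H v x t A) *\<^sub>v u)"
  using A(2,3) by (induction ys) (auto simp: rho_qel_insert[OF t] A(1) u)

lemma rho_qel_eigen:
  assumes t: "\<And>x y. t (x + y) = t x * t y" "t 0 = 1" and A: "finite A" and u: "u \<in> carrier_vec d" "\<rho> (th x) *\<^sub>v u = \<mu> \<cdot>\<^sub>v u"
  shows "\<rho> (qel H v x t A) *\<^sub>v u = (\<Prod>y\<in>A. \<mu> - t y) \<cdot>\<^sub>v u"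
  using A
proof (induction A)
  case empty
  then show ?case using u by (simp add: qel_empty[where t=t, OF t(2)] rho_id)
next
  case (insert y A)
  have r: "\<rho> (th x) \<in> carrier_mat d d" by (intro rho_carrier theta_carr)
  define p where "p = (\<Prod>y\<in>A. \<mu> - t y)"
  have "\<rho> (qel H v x t (insert y A)) *\<^sub>v u = \<rho> (th x) *\<^sub>v (p \<cdot>\<^sub>v u) - t y \<cdot>\<^sub>v (p \<cdot>\<^sub>v u)"
    using insert by (simp add: rho_qel_insert[OF t(1) _ _ u(1)] p_def)
  also have "\<rho> (th x) *\<^sub>v (p \<cdot>\<^sub>v u) = p \<cdot>\<^sub>v (\<mu> \<cdot>\<^sub>v u)"
    using r u by (simp add: mult_mat_vec)
  also have "p \<cdot>\<^sub>v (\<mu> \<cdot>\<^sub>v u) - t y \<cdot>\<^sub>v (p \<cdot>\<^sub>v u) = ((\<mu> - t y) * p) \<cdot>\<^sub>v u"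
    using u by (intro eq_vecI) (auto simp: algebra_simps)
  finally show ?case using insert by (simp add: p_def)
qed

text \<open>An invariant \<open>a\<close> has the same sum against \<open>t\<close> and against
  \<open>t \<circ> w\<close>, by reindexing along the bijection \<open>w\<close>.\<close>

lemma central_char_W0:
  assumes cc: "central_char H v d \<rho> t" and w: "w \<in> W0 H"
  shows "central_char H v d \<rho> (t \<circ> w)"
proof -
  have "\<rho> (theta_comb H v a) = (\<Sum>x\<in>supp a. a x * (t \<circ> w) x) \<cdot>\<^sub>m 1\<^sub>m d"
    if a: "finite (supp a)" "\<forall>w\<in>W0 H. a \<circ> w = a" for a
  proof -
    have aw: "a (w x) = a x" for x using a(2) w by (metis comp_apply)
    have b: "bij w" by (rule W0_bij[OF root_datum w])
    have "w ` supp a = supp a"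
    proof
      show "w ` supp a \<subseteq> supp a" using aw by auto
      show "supp a \<subseteq> w ` supp a"
      proof
        fix y assume y: "y \<in> supp a"
        obtain x where "y = w x" using b by (metis bij_pointE)
        then show "y \<in> w ` supp a" using y aw by auto
      qed
    qed
    then have "(\<Sum>x\<in>supp a. a x * t x) = (\<Sum>x\<in>supp a. a x * (t \<circ> w) x)"
      using b aw by (intro sum.reindex_cong[of w]) (auto simp: bij_is_inj inj_on_def dest: bij_is_inj injD)
    then show ?thesis using cc a by (simp add: central_char_def)
  qed
  moreover have "t \<circ> w \<in> torus"
    using cc additive.add[OF W0_additive[OF w]] additive.zero[OF W0_additive[OF w]]
    by (auto simp: central_char_def torus_def)
  ultimately show ?thesis by (simp add: central_char_def)
qed

text \<open>The operand is the \<open>k\<close>-th elementary symmetric function of the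
  \<open>\<theta>_y\<close> with \<open>y\<close> in a \<open>W0 H\<close>-stable set. It has
  invariant coefficients and so acts by its value at \<open>t\<close>.\<close>

lemma central_char_symmetric:
  assumes cc: "central_char H v d \<rho> t" and A: "finite A" "\<And>w. w \<in> W0 H \<Longrightarrow> w ` A = A"
  shows "\<rho> (\<lambda>u. \<Sum>B | B \<subseteq> A \<and> card B = k. th (\<Sum>B) u) = (\<Sum>B | B \<subseteq> A \<and> card B = k. t (\<Sum>B)) \<cdot>\<^sub>m 1\<^sub>m d"
proof -
  define X where "X = {B. B \<subseteq> A \<and> card B = k}"
  have X: "finite X" using A by (simp add: X_def)
  \<comment> \<open>Different subsets can have the same sum, so the coefficient counts the subsets
    with sum \<open>z\<close>. Its invariance becomes a bijection between such families of
    subsets.\<close>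
  define a :: "'n lat \<Rightarrow> complex" where "a z = of_nat (card {B \<in> X. \<Sum>B = z})" for z
  have sa: "supp a \<subseteq> Sum ` X"
  proof
    fix z assume "z \<in> supp a"
    then have "card {B \<in> X. \<Sum>B = z} \<noteq> 0" by (simp add: a_def)
    then have "{B \<in> X. \<Sum>B = z} \<noteq> {}" by (metis card.empty)
    then show "z \<in> Sum ` X" by auto
  qed
  then have fa: "finite (supp a)" using X finite_subset by blast
  have inv: "a \<circ> w = a" if w: "w \<in> W0 H" for w
  proof
    fix z
    have b: "bij w" by (rule W0_bij[OF root_datum w])
    have inj: "inj w" using b by (rule bij_is_inj)
    have Sw: "\<Sum>(w ` B) = w (\<Sum>B)" for B
      using additive.sum[OF W0_additive[OF w], of id B] inj
      by (simp add: sum.reindex inj_on_subset)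
    have wX: "w ` B \<in> X" if "B \<in> X" for B
      using that A(2)[OF w] inj by (auto simp: X_def card_image inj_on_subset)
    have "bij_betw (image w) {B \<in> X. \<Sum>B = z} {B \<in> X. \<Sum>B = w z}"
    proof (rule bij_betw_imageI)
      show "inj_on (image w) {B \<in> X. \<Sum>B = z}" using inj by (meson inj_image_eq_iff inj_onI)
      show "image w ` {B \<in> X. \<Sum>B = z} = {B \<in> X. \<Sum>B = w z}"
      proof
        show "image w ` {B \<in> X. \<Sum>B = z} \<subseteq> {B \<in> X. \<Sum>B = w z}" using wX Sw by auto
        show "{B \<in> X. \<Sum>B = w z} \<subseteq> image w ` {B \<in> X. \<Sum>B = z}"
        proof
          fix B assume B: "B \<in> {B \<in> X. \<Sum>B = w z}"
          then have "B \<subseteq> w ` A" using A(2)[OF w] by (auto simp: X_def)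
          then obtain B' where B': "B' \<subseteq> A" "B = w ` B'" by (auto simp: subset_image_iff)
          have "B' \<in> X" using B B' inj by (auto simp: X_def card_image inj_on_subset)
          moreover have "\<Sum>B' = z" using B B' Sw inj by (auto dest: injD)
          ultimately show "B \<in> image w ` {B \<in> X. \<Sum>B = z}" using B' by auto
        qed
      qed
    qed
    then show "(a \<circ> w) z = a z" by (simp add: a_def bij_betw_same_card)
  qed
  have grp: "(\<Sum>z\<in>supp a. a z * f z) = (\<Sum>B\<in>X. f (\<Sum>B))" for f :: "'n lat \<Rightarrow> complex"
  proof -
    have "(\<Sum>z\<in>supp a. a z * f z) = (\<Sum>z\<in>Sum ` X. a z * f z)"
      by (rule sum.mono_neutral_left) (use X sa in auto)
    also have "\<dots> = (\<Sum>z\<in>Sum ` X. \<Sum>B\<in>{B \<in> X. \<Sum>B = z}. f (\<Sum>B))"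
      by (intro sum.cong refl) (simp add: a_def)
    also have "\<dots> = (\<Sum>B\<in>X. f (\<Sum>B))"
      by (rule sum.group) (use X in auto)
    finally show ?thesis .
  qed
  have "\<rho> (theta_comb H v a) = (\<Sum>x\<in>supp a. a x * t x) \<cdot>\<^sub>m 1\<^sub>m d"
    using cc fa inv unfolding central_char_def by blast
  moreover have "theta_comb H v a = (\<lambda>u. \<Sum>B\<in>X. th (\<Sum>B) u)"
    by (simp add: theta_comb_def grp)
  ultimately show ?thesis by (simp add: grp X_def)
qed

text \<open>Expansion of the product of \<open>\<theta>_x - \<theta>_y\<close> over \<open>y\<close>
  in \<open>A\<close>, which has the zero factor \<open>y = x\<close>; in the application
  \<open>f\<close> is a matrix entry of the representing operators. Subsets with and without
  \<open>x\<close> cancel in pairs.\<close>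

lemma alternating_theta:
  assumes "finite A" "x \<in> A"
  shows "(\<Sum>B\<in>Pow A. (- 1) ^ card B * f (int (card A - card B) *s x + \<Sum>B)) = (0 :: complex)"
proof -
  define A' where "A' = A - {x}"
  have A: "A = insert x A'" "x \<notin> A'" "finite A'" using assms by (auto simp: A'_def)
  have "(- 1) ^ card (insert x B) * f (int (card A - card (insert x B)) *s x + \<Sum>(insert x B)) =
        - ((- 1) ^ card B * f (int (card A - card B) *s x + \<Sum>B))" if B: "B \<in> Pow A'" for B
  proof -
    have "finite B" "x \<notin> B" using A B finite_subset by auto
    moreover have "card A - card B = Suc (card A - card (insert x B))"
    proof -
      have "card B \<le> card A'" using A B by (auto intro: card_mono)
      then show ?thesis using A \<open>finite B\<close> \<open>x \<notin> B\<close> by simp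
    qed
    then have "int (card A - card B) *s x + \<Sum>B = int (card A - card (insert x B)) *s x + (x + \<Sum>B)"
      by (simp add: vector_sadd_rdistrib)
    ultimately show ?thesis by (simp add: add.assoc)
  qed
  then show ?thesis
    unfolding A(1) sum_Pow_insert[OF A(3,2)] unfolding A(1)[symmetric]
    by (simp add: sum_negf)
qed

text \<open>The elementary symmetric functions of the values \<open>t y\<close> are the scalars by
  which those of the \<open>\<theta>_y\<close> act. Hence the product of the
  \<open>\<theta>_x - t y\<close> acts as the product of the \<open>\<theta>_x - \<theta>_y\<close>,
  which vanishes because \<open>x\<close> is in \<open>A\<close>.\<close>

lemma rho_qel_orbit:
  assumes cc: "central_char H v d \<rho> t" and A: "finite A" "\<And>w. w \<in> W0 H \<Longrightarrow> w ` A = A" "x \<in> A"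
  shows "\<rho> (qel H v x t A) = 0\<^sub>m d d"
proof (rule rho_zeroI[OF qel_carr])
  fix i j assume ij: "i < d" "j < d"
  define X where "X k = {B. B \<subseteq> A \<and> card B = k}" for k
  define n where "n = card A"
  have X: "finite (X k)" for k using A by (simp add: X_def)
  have PX: "Pow A = (\<Union>k\<in>{..n}. X k)" using A by (auto simp: X_def n_def card_mono)
  have split: "(\<Sum>B\<in>Pow A. f B) = (\<Sum>k\<le>n. \<Sum>B\<in>X k. f B)" for f :: "'n lat set \<Rightarrow> complex"
    unfolding PX by (rule sum.UNION_disjoint) (use X in \<open>auto simp: X_def\<close>)
  \<comment> \<open>Here scalars are traded for elements of the commutative subalgebra: the
    symmetric sum acts by its scalar, and multiplying it by \<open>th z\<close> shifts all exponents
    by \<open>z\<close>.\<close>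
  have key: "(\<Sum>B\<in>X k. t (\<Sum>B)) * \<rho> (th z) $$ (i, j) = (\<Sum>B\<in>X k. \<rho> (th (z + \<Sum>B)) $$ (i, j))" for k z
  proof -
    define e where "e = (\<lambda>u. \<Sum>B\<in>X k. 1 * th (\<Sum>B) u)"
    have e: "e \<in> carr" unfolding e_def by (intro hcarrier_sum theta_carr) auto
    have c: "\<rho> (th z) \<in> carrier_mat d d" by (intro rho_carrier theta_carr)
    have "\<rho> (mul (th z) e) = \<rho> (th z) * \<rho> e" by (intro rho_mult theta_carr e)
    also have "\<rho> e = (\<Sum>B\<in>X k. t (\<Sum>B)) \<cdot>\<^sub>m 1\<^sub>m d"
      using central_char_symmetric[OF cc A(1,2)] by (simp add: e_def X_def)
    also have "\<rho> (th z) * \<dots> = (\<Sum>B\<in>X k. t (\<Sum>B)) \<cdot>\<^sub>m \<rho> (th z)"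
      using c by (simp add: mult_smult_distrib[of _ d d _ d])
    finally have "\<rho> (mul (th z) e) $$ (i, j) = (\<Sum>B\<in>X k. t (\<Sum>B)) * \<rho> (th z) $$ (i, j)"
      using c ij by simp
    moreover have "mul (th z) e = (\<lambda>u. \<Sum>B\<in>X k. 1 * th (z + \<Sum>B) u)"
      unfolding e_def by (subst hmul_sum_right) (auto intro: theta_carr simp: theta_mult[OF v])
    moreover have "\<rho> (\<lambda>u. \<Sum>B\<in>X k. 1 * th (z + \<Sum>B) u) $$ (i, j) = (\<Sum>B\<in>X k. 1 * \<rho> (th (z + \<Sum>B)) $$ (i, j))"
      by (rule rho_sum) (auto intro: theta_carr ij)
    ultimately show ?thesis by simp
  qed
  have "\<rho> (qel H v x t A) $$ (i, j) = (\<Sum>B\<in>Pow A. ((- 1) ^ card B * t (\<Sum>B)) * \<rho> (th (int (n - card B) *s x)) $$ (i, j))"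
    unfolding qel_def n_def by (rule rho_sum) (auto intro: theta_carr ij)
  also have "\<dots> = (\<Sum>k\<le>n. (- 1) ^ k * ((\<Sum>B\<in>X k. t (\<Sum>B)) * \<rho> (th (int (n - k) *s x)) $$ (i, j)))"
    unfolding split by (intro sum.cong refl) (simp add: X_def sum_distrib_left sum_distrib_right mult_ac)
  also have "\<dots> = (\<Sum>k\<le>n. (- 1) ^ k * (\<Sum>B\<in>X k. \<rho> (th (int (n - k) *s x + \<Sum>B)) $$ (i, j)))"
    by (simp add: key)
  also have "\<dots> = (\<Sum>B\<in>Pow A. (- 1) ^ card B * \<rho> (th (int (n - card B) *s x + \<Sum>B)) $$ (i, j))"
    unfolding split by (intro sum.cong refl) (simp add: X_def sum_distrib_left)
  also have "\<dots> = 0"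
    unfolding n_def by (rule alternating_theta[OF A(1,3)])
  finally show "\<rho> (qel H v x t A) $$ (i, j) = 0" .
qed

end

lemma lat_induct:
  fixes E :: "(int ^ 'n::finite) set"
  assumes "0 \<in> E" "\<And>x y. x \<in> E \<Longrightarrow> y \<in> E \<Longrightarrow> x + y \<in> E" "\<And>x. x \<in> E \<Longrightarrow> - x \<in> E"
    and "\<And>i. axis i 1 \<in> E"
  shows "z \<in> E"
proof -
  have nat: "int n *s x \<in> E" if "x \<in> E" for n x
    by (induction n) (auto simp: vector_sadd_rdistrib assms that)
  have int: "k *s x \<in> E" if "x \<in> E" for k x
  proof (cases "k \<ge> 0")
    case True
    then show ?thesis using nat[OF that, of "nat k"] by simp
  next
    case False
    then have "k *s x = - (int (nat (- k)) *s x)"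
      by (simp add: Finite_Cartesian_Product.vec_eq_iff)
    then show ?thesis using assms(3)[OF nat[OF that, of "nat (- k)"]] by simp
  qed
  have "(\<Sum>i\<in>I. vec_nth z i *s axis i 1) \<in> E" for I :: "'n set"
    by (induction I rule: infinite_finite_induct) (auto intro!: assms int)
  moreover have "(\<Sum>i\<in>UNIV. vec_nth z i *s axis i 1) = z"
    by (rule Finite_Cartesian_Product.vec_eq_iff[THEN iffD2])
       (simp add: axis_def if_distrib cong: if_cong)
  ultimately show ?thesis by metis
qed

lemma zero_mat_vec: "u \<in> carrier_vec m \<Longrightarrow> 0\<^sub>m n m *\<^sub>v u = (0\<^sub>v n :: 'a::comm_ring_1 Matrix.vec)"
  by (rule eq_vecI) auto

lemma zero_smult_vec: "u \<in> carrier_vec m \<Longrightarrow> 0 \<cdot>\<^sub>v u = (0\<^sub>v m :: 'a::comm_ring_1 Matrix.vec)"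
  by (rule eq_vecI) auto

section \<open>Joint eigenvectors of the commutative subalgebra and weights\<close>

context rep_setup
begin

lemma th_vec: "u \<in> carrier_vec d \<Longrightarrow> \<rho> (th x) *\<^sub>v u \<in> carrier_vec d"
  using rho_carrier[OF theta_carr[of v x]] by simp

lemma th_commute:
  assumes "u \<in> carrier_vec d"
  shows "\<rho> (th x) *\<^sub>v (\<rho> (th y) *\<^sub>v u) = \<rho> (th (x + y)) *\<^sub>v u"
proof -
  have "\<rho> (th x) \<in> carrier_mat d d" "\<rho> (th y) \<in> carrier_mat d d" by (intro rho_carrier theta_carr)+
  then have "\<rho> (th x) *\<^sub>v (\<rho> (th y) *\<^sub>v u) = \<rho> (mul (th x) (th y)) *\<^sub>v u"
    using assms by (simp add: rho_mult theta_carr)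
  then show ?thesis by (simp add: theta_mult[OF v])
qed

text \<open>The relation over the orbit of \<open>z\<close> annihilates every vector by a product of
  linear factors in \<open>\<theta>_z\<close>, so the chain starting at \<open>u\<close> must
  produce an eigenvector, and it does so within \<open>P\<close>.\<close>

lemma th_eigenvector_step:
  assumes cc: "central_char H v d \<rho> t"
    and P: "\<And>x. P x \<Longrightarrow> x \<in> carrier_vec d" "\<And>x \<mu>. P x \<Longrightarrow> P (\<rho> (th z) *\<^sub>v x - \<mu> \<cdot>\<^sub>v x)"
    and u: "P u" "u \<noteq> 0\<^sub>v d"
  shows "\<exists>\<mu>. \<exists>x. P x \<and> x \<noteq> 0\<^sub>v d \<and> \<rho> (th z) *\<^sub>v x = \<mu> \<cdot>\<^sub>v x"
proof -
  have t: "t (x + y) = t x * t y" "t 0 = 1" for x y using cc by (auto simp: central_char_def torus_def)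
  obtain ys where ys: "set ys = orb H z" "distinct ys"
    using finite_distinct_list[OF finite_orb[OF root_datum]] by metis
  have uc: "u \<in> carrier_vec d" using P u by auto
  have "\<rho> (qel H v z t (set ys \<union> {})) *\<^sub>v u =
      eigen_steps (\<rho> (th z)) (map t ys) (\<rho> (qel H v z t {}) *\<^sub>v u)"
    by (rule rho_qel_foldr) (use t ys uc in auto)
  moreover have "\<rho> (qel H v z t (set ys \<union> {})) = 0\<^sub>m d d"
    using rho_qel_orbit[OF cc finite_orb[OF root_datum] orb_stable[OF root_datum] orb_self] ys by simp
  ultimately have "eigen_steps (\<rho> (th z)) (map t ys) u = 0\<^sub>v d"
    using uc by (simp add: zero_mat_vec qel_empty[where t = t, OF t(2)] rho_id)
  from eigenvector_step[OF rho_carrier[OF theta_carr] P u this] show ?thesis by blast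
qed

text \<open>The \<open>\<theta>_z\<close> commute, so the joint eigenspace found so far is stable
  under the next operator and contains an eigenvector of it.\<close>

lemma common_eigenvector:
  assumes cc: "central_char H v d \<rho> t"
    and u: "u \<in> carrier_vec d" "u \<noteq> 0\<^sub>v d" "\<rho> (th x) *\<^sub>v u = \<mu> \<cdot>\<^sub>v u"
  shows "\<exists>n u. u \<in> carrier_vec d \<and> u \<noteq> 0\<^sub>v d \<and> \<rho> (th x) *\<^sub>v u = \<mu> \<cdot>\<^sub>v u \<and> (\<forall>z\<in>set zs. \<rho> (th z) *\<^sub>v u = n z \<cdot>\<^sub>v u)"
proof (induction zs)
  case Nil
  then show ?case using u by auto
next
  case (Cons z zs)
  then obtain n u where n: "u \<in> carrier_vec d" "u \<noteq> 0\<^sub>v d" "\<rho> (th x) *\<^sub>v u = \<mu> \<cdot>\<^sub>v u"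
    "\<forall>z\<in>set zs. \<rho> (th z) *\<^sub>v u = n z \<cdot>\<^sub>v u" by blast
  define P where "P y \<longleftrightarrow> y \<in> carrier_vec d \<and> \<rho> (th x) *\<^sub>v y = \<mu> \<cdot>\<^sub>v y \<and> (\<forall>z\<in>set zs. \<rho> (th z) *\<^sub>v y = n z \<cdot>\<^sub>v y)" for y
  have r: "\<rho> (th x) \<in> carrier_mat d d" for x by (intro rho_carrier theta_carr)
  have step: "\<rho> (th y) *\<^sub>v (\<rho> (th z) *\<^sub>v x' - \<nu> \<cdot>\<^sub>v x') = \<mu>' \<cdot>\<^sub>v (\<rho> (th z) *\<^sub>v x' - \<nu> \<cdot>\<^sub>v x')"
    if "x' \<in> carrier_vec d" "\<rho> (th y) *\<^sub>v x' = \<mu>' \<cdot>\<^sub>v x'" for x' y \<mu>' \<nu>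
  proof -
    have "\<rho> (th y) *\<^sub>v (\<rho> (th z) *\<^sub>v x' - \<nu> \<cdot>\<^sub>v x') = \<rho> (th y) *\<^sub>v (\<rho> (th z) *\<^sub>v x') - \<rho> (th y) *\<^sub>v (\<nu> \<cdot>\<^sub>v x')"
      using r that by (intro mult_minus_distrib_mat_vec[of _ d d]) (auto simp: th_vec)
    also have "\<rho> (th y) *\<^sub>v (\<rho> (th z) *\<^sub>v x') = \<rho> (th z) *\<^sub>v (\<rho> (th y) *\<^sub>v x')"
      by (simp only: th_commute[OF that(1)] add.commute)
    also have "\<dots> = \<mu>' \<cdot>\<^sub>v (\<rho> (th z) *\<^sub>v x')"
      unfolding that(2) by (rule mult_mat_vec[OF r that(1)])
    also have "\<rho> (th y) *\<^sub>v (\<nu> \<cdot>\<^sub>v x') = \<nu> \<cdot>\<^sub>v (\<mu>' \<cdot>\<^sub>v x')"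
      unfolding mult_mat_vec[OF r that(1)] that(2) ..
    also have "\<mu>' \<cdot>\<^sub>v (\<rho> (th z) *\<^sub>v x') - \<nu> \<cdot>\<^sub>v (\<mu>' \<cdot>\<^sub>v x') = \<mu>' \<cdot>\<^sub>v (\<rho> (th z) *\<^sub>v x' - \<nu> \<cdot>\<^sub>v x')"
      using r[of z] th_vec[OF that(1), of z] that(1) by (intro eq_vecI) (auto simp: algebra_simps)
    finally show ?thesis .
  qed
  have "\<exists>\<nu>. \<exists>y. P y \<and> y \<noteq> 0\<^sub>v d \<and> \<rho> (th z) *\<^sub>v y = \<nu> \<cdot>\<^sub>v y"
  proof (rule th_eigenvector_step[OF cc, of P z u])
    show "P u" using n by (simp add: P_def)
    fix x' \<nu> assume "P x'"
    then show "P (\<rho> (th z) *\<^sub>v x' - \<nu> \<cdot>\<^sub>v x')"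
      using step r[of z] unfolding P_def by (intro conjI ballI minus_carrier_vec mult_mat_vec_carrier[of _ d d]) (auto simp: th_vec)
  qed (use n in \<open>auto simp: P_def\<close>)
  then obtain \<nu> y where y: "P y" "y \<noteq> 0\<^sub>v d" "\<rho> (th z) *\<^sub>v y = \<nu> \<cdot>\<^sub>v y" by blast
  show ?case
    by (rule exI[of _ "n(z := \<nu>)"], rule exI[of _ y]) (use y in \<open>auto simp: P_def\<close>)
qed

lemma smult_vec_inj:
  assumes "u \<in> carrier_vec d" "u \<noteq> 0\<^sub>v d" "a \<cdot>\<^sub>v u = b \<cdot>\<^sub>v (u :: complex Matrix.vec)"
  shows "a = b"
proof -
  obtain i where i: "i < d" "u $ i \<noteq> 0" using assms(1,2) by (metis carrier_vecD eq_vecI index_zero_vec)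
  have "(a \<cdot>\<^sub>v u) $ i = (b \<cdot>\<^sub>v u) $ i" using assms(3) by simp
  then show ?thesis using i assms(1) by simp
qed

text \<open>A joint eigenvector for \<open>\<theta>_x\<close> and for the standard basis of the
  lattice is an eigenvector of every \<open>\<theta>_z\<close>. Its eigenvalues form a character of
  the lattice, and exponent 1 suffices in the definition of \<open>weight\<close>.\<close>

lemma weight_of_eigenvector:
  assumes cc: "central_char H v d \<rho> t"
    and u: "u \<in> carrier_vec d" "u \<noteq> 0\<^sub>v d" "\<rho> (th x) *\<^sub>v u = \<mu> \<cdot>\<^sub>v u"
  shows "\<exists>s. weight H v d \<rho> s \<and> s x = \<mu>"
proof -
  obtain js where js: "set js = (UNIV :: 'n set)" using finite_list[OF finite[of UNIV]] by metis
  obtain n u where n: "u \<in> carrier_vec d" "u \<noteq> 0\<^sub>v d" "\<rho> (th x) *\<^sub>v u = \<mu> \<cdot>\<^sub>v u"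
    "\<forall>z\<in>set (map (\<lambda>i. axis i 1) js). \<rho> (th z) *\<^sub>v u = n z \<cdot>\<^sub>v u"
    using common_eigenvector[OF cc u, of "map (\<lambda>i. axis i 1) js"] by blast
  have r: "\<rho> (th x) \<in> carrier_mat d d" for x by (intro rho_carrier theta_carr)
  have ev0: "\<rho> (th 0) *\<^sub>v u = 1 \<cdot>\<^sub>v u" using n(1) by (simp add: theta_0[OF v] rho_id)
  have evadd: "\<rho> (th (a + b)) *\<^sub>v u = (p * q) \<cdot>\<^sub>v u"
    if "\<rho> (th a) *\<^sub>v u = p \<cdot>\<^sub>v u" "\<rho> (th b) *\<^sub>v u = q \<cdot>\<^sub>v u" for a b p q
  proof -
    have "\<rho> (th (a + b)) *\<^sub>v u = \<rho> (th a) *\<^sub>v (q \<cdot>\<^sub>v u)" using th_commute[OF n(1), of a b] that by simp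
    also have "\<dots> = q \<cdot>\<^sub>v (\<rho> (th a) *\<^sub>v u)" by (rule mult_mat_vec[OF r n(1)])
    also have "\<dots> = (p * q) \<cdot>\<^sub>v u" unfolding that(1) by (simp add: smult_smult_assoc mult.commute)
    finally show ?thesis .
  qed
  \<comment> \<open>The exponents that act on \<open>u\<close> by a scalar form a subgroup; the
    scalars can be inverted because each \<open>\<theta>_a\<close> is invertible.\<close>
  let ?E = "{z. \<exists>p. \<rho> (th z) *\<^sub>v u = p \<cdot>\<^sub>v u}"
  have "z \<in> ?E" for z
  proof (rule lat_induct)
    show "0 \<in> ?E" using ev0 by blast
    show "axis i 1 \<in> ?E" for i using n(4) js by auto
    show "a + b \<in> ?E"
      if "a \<in> ?E" "b \<in> ?E" for a b
      using that evadd by blast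
    show "- a \<in> ?E"
      if a: "a \<in> ?E" for a
    proof -
      obtain p where p: "\<rho> (th a) *\<^sub>v u = p \<cdot>\<^sub>v u" using a by auto
      define y where "y = \<rho> (th (- a)) *\<^sub>v u"
      have y: "y \<in> carrier_vec d" unfolding y_def using r n(1) by (intro mult_mat_vec_carrier) auto
      have "\<rho> (th (- a)) *\<^sub>v (\<rho> (th a) *\<^sub>v u) = u" using th_commute[OF n(1), of "- a" a] ev0 by simp
      then have "p \<cdot>\<^sub>v y = u" unfolding p y_def by (simp only: mult_mat_vec[OF r n(1)])
      moreover from this have "p \<noteq> 0" using n(2) y by auto
      ultimately have "y = inverse p \<cdot>\<^sub>v u" by (metis left_inverse one_smult_vec smult_smult_assoc)
      then show ?thesis unfolding y_def by blast
    qed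
  qed
  then have ex: "\<exists>p. \<rho> (th z) *\<^sub>v u = p \<cdot>\<^sub>v u" for z by blast
  define s where "s z = (SOME p. \<rho> (th z) *\<^sub>v u = p \<cdot>\<^sub>v u)" for z
  have s: "\<rho> (th z) *\<^sub>v u = s z \<cdot>\<^sub>v u" for z
    unfolding s_def by (rule someI_ex[OF ex])
  have inj: "a = b" if "a \<cdot>\<^sub>v u = b \<cdot>\<^sub>v u" for a b using smult_vec_inj[OF n(1,2) that] .
  have "s 0 = 1" using s[of 0] ev0 by (intro inj) simp
  moreover have "s (a + b) = s a * s b" for a b using s[of "a + b"] evadd[OF s s] by (intro inj) simp
  ultimately have "s \<in> torus" by (simp add: torus_def)
  moreover have "((\<rho> (th z) - s z \<cdot>\<^sub>m 1\<^sub>m d) ^\<^sub>m 1) *\<^sub>v u = 0\<^sub>v d" for z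
  proof -
    have "(\<rho> (th z) - s z \<cdot>\<^sub>m 1\<^sub>m d) *\<^sub>v u = \<rho> (th z) *\<^sub>v u - (s z \<cdot>\<^sub>m 1\<^sub>m d) *\<^sub>v u"
      using r n(1) by (intro minus_mult_distrib_mat_vec[of _ d d]) auto
    also have "\<dots> = 0\<^sub>v d" using n(1) s by (simp add: smult_mat_vec[of _ d d])
    finally show ?thesis using r[of z] by simp
  qed
  ultimately have "weight H v d \<rho> s" using n(1,2) unfolding weight_def by blast
  moreover have "s x = \<mu>" using s[of x] n(3) by (intro inj) simp
  ultimately show ?thesis by blast
qed

text \<open>Otherwise a nonzero vector in the image would be killed by the remaining factors of the
  orbit product. Then some \<open>t y\<close> with \<open>y\<close> outside \<open>A\<close> would
  be an eigenvalue of \<open>\<theta>_x\<close>, hence the value at \<open>x\<close> of a weight,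
  against the modulus bound.\<close>

lemma discrete_series_qel:
  assumes ds: "discrete_series H v d \<rho>" and cc: "central_char H v d \<rho> t"
    and x: "dominant H x" and A: "A \<subseteq> orb H x" "\<And>y. y \<in> orb H x \<Longrightarrow> y \<notin> A \<Longrightarrow> cmod (t y) > 1"
  shows "\<rho> (qel H v x t A) = 0\<^sub>m d d"
proof -
  have t: "t (x + y) = t x * t y" "t 0 = 1" for x y using cc by (auto simp: central_char_def torus_def)
  have fin: "finite (orb H x)" "finite A" using finite_orb[OF root_datum] A finite_subset by blast+
  obtain ys where ys: "set ys = orb H x - A" "distinct ys"
    using finite_distinct_list[of "orb H x - A"] fin by auto
  have r: "\<rho> (th x) \<in> carrier_mat d d" "\<rho> (qel H v x t A) \<in> carrier_mat d d"
    by (intro rho_carrier theta_carr qel_carr)+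
  have zero: "\<rho> (qel H v x t A) *\<^sub>v u = 0\<^sub>v d" if u: "u \<in> carrier_vec d" for u
  proof (rule ccontr)
    define u1 where "u1 = \<rho> (qel H v x t A) *\<^sub>v u"
    assume "\<rho> (qel H v x t A) *\<^sub>v u \<noteq> 0\<^sub>v d"
    then have u1: "u1 \<in> carrier_vec d" "u1 \<noteq> 0\<^sub>v d" using r u by (auto simp: u1_def)
    have "\<rho> (qel H v x t (set ys \<union> A)) *\<^sub>v u = eigen_steps (\<rho> (th x)) (map t ys) u1"
      unfolding u1_def by (rule rho_qel_foldr) (use t ys u fin in auto)
    moreover have "set ys \<union> A = orb H x" using ys A by auto
    moreover have "\<rho> (qel H v x t (orb H x)) = 0\<^sub>m d d"
      by (rule rho_qel_orbit[OF cc fin(1) orb_stable[OF root_datum] orb_self])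
    ultimately have "eigen_steps (\<rho> (th x)) (map t ys) u1 = 0\<^sub>v d"
      using u by (simp add: zero_mat_vec)
    from eigenvector_step[OF r(1), of "\<lambda>x. x \<in> carrier_vec d", OF _ _ u1 this]
    obtain y z where y: "y \<in> set ys" "z \<in> carrier_vec d" "z \<noteq> 0\<^sub>v d" "\<rho> (th x) *\<^sub>v z = t y \<cdot>\<^sub>v z"
      using r(1) by auto
    obtain s where s: "weight H v d \<rho> s" "s x = t y" using weight_of_eigenvector[OF cc y(2,3,4)] by blast
    \<comment> \<open>The strict bound for a discrete series excludes \<open>x = 0\<close>, where
      every character has the value 1.\<close>
    have "cmod (s x) \<le> 1"
    proof (cases "x = 0")
      case True
      then show ?thesis using s by (simp add: weight_def torus_def)
    next
      case False
      then show ?thesis using ds s x unfolding discrete_series_def by (meson less_imp_le)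
    qed
    then show False using A(2)[of y] y ys s by auto
  qed
  show ?thesis
  proof (rule eq_matI)
    fix i j assume ij: "i < dim_row (0\<^sub>m d d :: complex mat)" "j < dim_col (0\<^sub>m d d :: complex mat)"
    have "(\<rho> (qel H v x t A) *\<^sub>v unit_vec d j) $ i = 0" using zero[of "unit_vec d j"] ij by simp
    then show "\<rho> (qel H v x t A) $$ (i, j) = 0\<^sub>m d d $$ (i, j)" using r ij by simp
  qed (use r in auto)
qed

text \<open>The scalar \<open>c\<close> is a dummy filling the list, so that the iterates of
  \<open>M\<close> run over the same list as the corresponding \<open>eigen_steps\<close>.\<close>

lemma pow_mat_foldr:
  assumes "M \<in> carrier_mat d d" "u \<in> carrier_vec d"
  shows "(M ^\<^sub>m k) *\<^sub>v u = foldr (\<lambda>_ x. M *\<^sub>v x) (replicate k (c::complex)) (u :: complex Matrix.vec)"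
  using assms(2)
proof (induction k arbitrary: u)
  case (Suc k)
  have "(M ^\<^sub>m Suc k) *\<^sub>v u = (M ^\<^sub>m k) *\<^sub>v (M *\<^sub>v u)"
    using assms(1) Suc.prems by (simp add: assoc_mult_mat_vec[of _ d d _ d] pow_carrier_mat)
  also have "\<dots> = foldr (\<lambda>_ x. M *\<^sub>v x) (replicate k c) (M *\<^sub>v u)"
    by (rule Suc.IH) (use assms(1) Suc.prems in auto)
  also have "\<dots> = foldr (\<lambda>_ x. M *\<^sub>v x) (replicate k c @ [c]) u" by simp
  finally show ?case by (simp only: replicate_append_same replicate_Suc)
qed (use assms(1) in simp)

text \<open>A generalised weight vector is killed by a power of \<open>\<theta>_x - s x\<close>; the
  last nonzero iterate is a genuine eigenvector.\<close>

lemma weight_eigenvector: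
  assumes "weight H v d \<rho> s"
  shows "\<exists>u\<in>carrier_vec d. u \<noteq> 0\<^sub>v d \<and> \<rho> (th x) *\<^sub>v u = s x \<cdot>\<^sub>v u"
proof -
  obtain u k where u: "u \<in> carrier_vec d" "u \<noteq> 0\<^sub>v d" "((\<rho> (th x) - s x \<cdot>\<^sub>m 1\<^sub>m d) ^\<^sub>m k) *\<^sub>v u = 0\<^sub>v d"
    using assms unfolding weight_def by metis
  have r: "\<rho> (th x) \<in> carrier_mat d d" by (intro rho_carrier theta_carr)
  define M where "M = \<rho> (th x) - s x \<cdot>\<^sub>m 1\<^sub>m d"
  have M: "M \<in> carrier_mat d d" unfolding M_def using r by auto
  have Mv: "M *\<^sub>v y = \<rho> (th x) *\<^sub>v y - s x \<cdot>\<^sub>v y" if "y \<in> carrier_vec d" for y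
    unfolding M_def using r that
    by (simp add: minus_mult_distrib_mat_vec[of _ d d] smult_mat_vec[of _ d d])
  have "foldr (\<lambda>\<mu> y. M *\<^sub>v y) (replicate k (s x)) u = eigen_steps (\<rho> (th x)) (replicate k (s x)) u \<and>
    foldr (\<lambda>\<mu> y. M *\<^sub>v y) (replicate k (s x)) u \<in> carrier_vec d"
    by (induction k) (use u M th_vec in \<open>auto simp: Mv\<close>)
  then have "eigen_steps (\<rho> (th x)) (replicate k (s x)) u = 0\<^sub>v d"
    using u(3) pow_mat_foldr[OF M u(1), of k "s x"] by (simp add: M_def)
  from eigenvector_step[OF r, of "\<lambda>x. x \<in> carrier_vec d", OF _ _ u(1,2) this]
  show ?thesis using r by auto
qed

text \<open>On an eigenvector \<open>qel\<close> acts by the product of the differences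
  \<open>s x - t y\<close>, so one of them must vanish.\<close>

lemma weight_root_of_qel:
  assumes t: "t \<in> torus" and q: "\<rho> (qel H v x t A) = 0\<^sub>m d d" and A: "finite A"
    and s: "weight H v d \<rho> s"
  shows "\<exists>y\<in>A. s x = t y"
proof -
  obtain u where u: "u \<in> carrier_vec d" "u \<noteq> 0\<^sub>v d" "\<rho> (th x) *\<^sub>v u = s x \<cdot>\<^sub>v u"
    using weight_eigenvector[OF s] by blast
  have "0\<^sub>m d d *\<^sub>v u = (\<Prod>y\<in>A. s x - t y) \<cdot>\<^sub>v u"
    using rho_qel_eigen[of t A u x "s x"] t A u q by (simp add: torus_def)
  then have "(\<Prod>y\<in>A. s x - t y) \<cdot>\<^sub>v u = 0 \<cdot>\<^sub>v u" using u(1) by (simp add: zero_mat_vec zero_smult_vec[of u d])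
  then have "(\<Prod>y\<in>A. s x - t y) = 0" by (rule smult_vec_inj[OF u(1,2)])
  then show ?thesis using A by auto
qed

end

section \<open>Integral closure\<close>

definition rspan :: "'a::comm_ring_1 set \<Rightarrow> 'a set \<Rightarrow> 'a set" where
  "rspan R B = {\<Sum>b\<in>B. a b * b | a. \<forall>b\<in>B. a b \<in> R}"

lemma rspanI: "(\<And>b. b \<in> B \<Longrightarrow> a b \<in> R) \<Longrightarrow> (\<Sum>b\<in>B. a b * b) \<in> rspan R B"
  by (auto simp: rspan_def)

lemma rspan_add: 
  assumes "ring_set R" "x \<in> rspan R B" "y \<in> rspan R B"
  shows "x + y \<in> rspan R B"
proof -
  obtain a b where a: "\<forall>c\<in>B. a c \<in> R" "x = (\<Sum>c\<in>B. a c * c)" and b: "\<forall>c\<in>B. b c \<in> R" "y = (\<Sum>c\<in>B. b c * c)"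
    using assms(2,3) unfolding rspan_def by blast
  have "(\<Sum>c\<in>B. (a c + b c) * c) \<in> rspan R B" by (rule rspanI) (use a b assms(1) in \<open>auto simp: ring_set_def\<close>)
  then show ?thesis by (simp add: a b distrib_right sum.distrib)
qed

lemma rspan_scale:
  assumes "ring_set R" "r \<in> R" "x \<in> rspan R B"
  shows "r * x \<in> rspan R B"
proof -
  obtain a where a: "\<forall>c\<in>B. a c \<in> R" "x = (\<Sum>c\<in>B. a c * c)"
    using assms(3) unfolding rspan_def by blast
  have "(\<Sum>c\<in>B. (r * a c) * c) \<in> rspan R B" by (rule rspanI) (use a assms in \<open>auto simp: ring_set_def\<close>)
  then show ?thesis by (simp add: a sum_distrib_left mult.assoc)
qed

lemma rspan_sum:
  assumes "ring_set R" "\<And>i. i \<in> I \<Longrightarrow> f i \<in> rspan R B"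
  shows "sum f I \<in> rspan R B"
proof -
  have "0 \<in> rspan R B" using rspanI[of B "\<lambda>_. 0" R] assms(1) by (simp add: ring_set_def)
  then show ?thesis using assms(2)
    by (induction I rule: infinite_finite_induct) (auto intro!: rspan_add[OF assms(1)])
qed

lemma rspan_base:
  assumes "ring_set R" "finite B" "b \<in> B"
  shows "b \<in> rspan R B"
proof -
  have "(\<Sum>c\<in>B. (if c = b then 1 else 0) * c) \<in> rspan R B"
    by (rule rspanI) (use assms(1) in \<open>auto simp: ring_set_def\<close>)
  moreover have "(\<Sum>c\<in>B. (if c = b then 1 else 0) * c) = (\<Sum>c\<in>B. if c = b then b else 0)"
    by (intro sum.cong) auto
  ultimately show ?thesis using assms(2,3) by simp
qed

lemma rspan_mult_closed:
  assumes "ring_set R" "\<And>b. b \<in> B \<Longrightarrow> z * b \<in> rspan R B" "x \<in> rspan R B"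
  shows "z * x \<in> rspan R B"
proof -
  obtain a where a: "\<forall>c\<in>B. a c \<in> R" "x = (\<Sum>c\<in>B. a c * c)"
    using assms(3) unfolding rspan_def by blast
  have "(\<Sum>c\<in>B. a c * (z * c)) \<in> rspan R B"
    by (rule rspan_sum[OF assms(1)], rule rspan_scale[OF assms(1)]) (use a assms in auto)
  then show ?thesis by (simp add: a sum_distrib_left mult_ac)
qed

lemma ring_set_poly: "ring_set R \<Longrightarrow> ring_set {p. \<forall>k. coeff p k \<in> R}"
proof -
  assume R: "ring_set R"
  have "coeff (p * q) k \<in> R" if "\<forall>k. coeff p k \<in> R" "\<forall>k. coeff q k \<in> R" for p q k
    unfolding coeff_mult using that R by (intro ring_set_sum[OF R]) (auto simp: ring_set_def)
  moreover have "coeff 1 k \<in> R" for k :: nat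
    using R by (cases k) (auto simp: ring_set_def)
  ultimately show ?thesis using R by (simp add: ring_set_def)
qed

text \<open>The Leibniz formula uses only sums, products and signs of entries of the characteristic
  matrix, all in the subring of polynomials with coefficients in \<open>R\<close>.\<close>

lemma char_poly_coeff:
  fixes R :: "'a::comm_ring_1 set"
  assumes R: "ring_set R" and A: "A \<in> carrier_mat n n" "\<And>i j. i < n \<Longrightarrow> j < n \<Longrightarrow> A $$ (i, j) \<in> R"
  shows "coeff (char_poly A) k \<in> R"
proof -
  let ?P = "{p. \<forall>k. coeff p k \<in> R}"
  have P: "ring_set ?P" by (rule ring_set_poly[OF R])
  have R': "0 \<in> R" "1 \<in> R" "\<And>x. x \<in> R \<Longrightarrow> - x \<in> R" using R by (auto simp: ring_set_def)
  have c: "char_poly_matrix A \<in> carrier_mat n n" using A by simp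
  have ent: "char_poly_matrix A $$ (i, j) \<in> ?P" if "i < n" "j < n" for i j
    using A that R' by (auto simp: char_poly_matrix_def coeff_pCons split: nat.splits)
  have sg: "signof p \<in> ?P" for p :: "nat \<Rightarrow> nat"
  proof -
    have "1 \<in> ?P" "- 1 \<in> ?P" using P unfolding ring_set_def by blast+
    moreover have "signof p = (1 :: 'a poly) \<or> signof p = (- 1 :: 'a poly)" by (simp add: sign_def)
    ultimately show ?thesis by metis
  qed
  have "char_poly A \<in> ?P"
    unfolding char_poly_def det_def'[OF c]
  proof (rule ring_set_sum[OF P])
    fix p assume "p \<in> {p. p permutes {0..<n}}"
    then have p: "p i < n" if "i < n" for i using that permutes_in_image[of p "{0..<n}" i] by auto
    have "(\<Prod>i = 0..<n. char_poly_matrix A $$ (i, p i)) \<in> ?P"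
      by (rule ring_set_prod[OF P]) (use ent p in auto)
    then show "signof p * (\<Prod>i = 0..<n. char_poly_matrix A $$ (i, p i)) \<in> ?P"
      using P sg[of p] unfolding ring_set_def by blast
  qed
  then show ?thesis by auto
qed

text \<open>\<open>z\<close> is a root of the characteristic polynomial of multiplication by \<open>z\<close> on the span of \<open>B\<close>.\<close>
lemma integral_of_span:
  fixes z :: "'l::field"
  assumes R: "ring_set R" and B: "finite B" "1 \<in> B" "\<And>b. b \<in> B \<Longrightarrow> z * b \<in> rspan R B"
  shows "\<exists>q. lead_coeff q = 1 \<and> (\<forall>k. coeff q k \<in> R) \<and> poly q z = 0"
proof -
  obtain bs where bs: "set bs = B" "distinct bs" using finite_distinct_list[OF B(1)] by blast
  define n where "n = length bs"
  have "\<forall>b\<in>B. \<exists>a. (\<forall>c\<in>B. a c \<in> R) \<and> z * b = (\<Sum>c\<in>B. a c * c)"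
    using B(3) unfolding rspan_def by blast
  then obtain a where a: "\<And>b c. b \<in> B \<Longrightarrow> c \<in> B \<Longrightarrow> a b c \<in> R" "\<And>b. b \<in> B \<Longrightarrow> z * b = (\<Sum>c\<in>B. a b c * c)"
    by metis
  define A where "A = Matrix.mat n n (\<lambda>(i, j). a (bs ! i) (bs ! j))"
  define u where "u = Matrix.vec n (\<lambda>i. bs ! i)"
  have A: "A \<in> carrier_mat n n" by (simp add: A_def)
  have sumB: "(\<Sum>c\<in>B. f c) = (\<Sum>j<n. f (bs ! j))" for f :: "'l \<Rightarrow> 'l"
    unfolding bs(1)[symmetric] sum.distinct_set_conv_list[OF bs(2)] sum_list_sum_nth
    by (simp add: n_def atLeast0LessThan)
  have "A *\<^sub>v u = z \<cdot>\<^sub>v u"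
  proof (rule eq_vecI)
    fix i assume "i < dim_vec (z \<cdot>\<^sub>v u)"
    then have i: "i < n" by (simp add: u_def)
    then have "bs ! i \<in> B" using bs(1) n_def nth_mem by blast
    then have "z * bs ! i = (\<Sum>j<n. a (bs ! i) (bs ! j) * bs ! j)" using a(2) sumB by simp
    then show "(A *\<^sub>v u) $ i = (z \<cdot>\<^sub>v u) $ i"
      using i by (simp add: A_def u_def scalar_prod_def atLeast0LessThan)
  qed (simp add: A_def u_def)
  \<comment> \<open>The vector of generators is the eigenvector for \<open>z\<close>; it is nonzero
    because 1 is among the generators.\<close>
  moreover have "u \<noteq> 0\<^sub>v n"
  proof
    assume "u = 0\<^sub>v n"
    obtain i where "i < n" "bs ! i = 1" using B(2) bs(1) n_def by (metis in_set_conv_nth)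
    then have "u $ i = 1" by (simp add: u_def)
    then show False using \<open>u = 0\<^sub>v n\<close> \<open>i < n\<close> by simp
  qed
  ultimately have "eigenvalue A z"
    unfolding eigenvalue_def eigenvector_def using A by (intro exI[of _ u]) (auto simp: u_def)
  then have "poly (char_poly A) z = 0" using eigenvalue_root_char_poly[OF A] by simp
  moreover have "lead_coeff (char_poly A) = 1" using degree_monic_char_poly[OF A] by simp
  moreover have "coeff (char_poly A) k \<in> R" for k
    by (rule char_poly_coeff[OF R A]) (use a(1) bs(1) n_def in \<open>auto simp: A_def\<close>)
  ultimately show ?thesis by blast
qed

lemma integral_power:
  fixes x :: "'l::field"
  assumes "lead_coeff q = 1" "\<forall>k. coeff q k \<in> R" "poly q x = 0"
  shows "degree q > 0" "x ^ degree q = (\<Sum>k<degree q. - coeff q k * x ^ k)"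
proof -
  show "degree q > 0"
  proof (rule ccontr)
    assume "\<not> degree q > 0"
    then obtain c where "q = [:c:]" by (auto elim: degree_eq_zeroE)
    then show False using assms by simp
  qed
  have "0 = (\<Sum>k\<le>degree q. coeff q k * x ^ k)" using assms(3) by (simp add: poly_altdef)
  also have "\<dots> = (\<Sum>k<degree q. coeff q k * x ^ k) + x ^ degree q"
    using assms(1) by (simp add: lessThan_Suc_atMost[symmetric])
  finally show "x ^ degree q = (\<Sum>k<degree q. - coeff q k * x ^ k)"
    by (simp add: sum_negf eq_neg_iff_add_eq_0 add.commute)
qed

text \<open>The monomials below the two degrees span a module stable under both elements, since the
  monic relations rewrite the top powers. Coincidences among the monomials are harmless, as only
  spanning matters.\<close>

lemma integral_pair_module:
  fixes x y :: "'l::field"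
  assumes R: "ring_set R"
    and x: "lead_coeff p = 1" "\<forall>k. coeff p k \<in> R" "poly p x = 0"
    and y: "lead_coeff q = 1" "\<forall>k. coeff q k \<in> R" "poly q y = 0"
  shows "\<exists>B. finite B \<and> 1 \<in> B \<and> (\<forall>b\<in>B. x * b \<in> rspan R B \<and> y * b \<in> rspan R B)"
proof -
  define n m where "n = degree p" "m = degree q"
  note px = integral_power[OF x, folded n_m_def] and py = integral_power[OF y, folded n_m_def]
  define B where "B = (\<lambda>(i, j). x ^ i * y ^ j) ` ({..<n} \<times> {..<m})"
  have mem: "x ^ i * y ^ j \<in> B" if "i < n" "j < m" for i j using that by (auto simp: B_def)
  have fin: "finite B" by (simp add: B_def)
  have base: "x ^ i * y ^ j \<in> rspan R B" if "i < n" "j < m" for i j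
    using rspan_base[OF R fin mem[OF that]] .
  have neg: "- coeff p k \<in> R" "- coeff q k \<in> R" for k using x y R by (auto simp: ring_set_def)
  have "x * (x ^ i * y ^ j) \<in> rspan R B" if ij: "i < n" "j < m" for i j
  proof (cases "Suc i < n")
    case True
    then show ?thesis using base[of "Suc i" j] ij by (simp add: mult.assoc)
  next
    case False
    then have "Suc i = n" using ij by simp
    then have "x * (x ^ i * y ^ j) = x ^ n * y ^ j" by (metis mult.assoc power_Suc)
    also have "\<dots> = (\<Sum>k<n. - coeff p k * (x ^ k * y ^ j))"
      unfolding px(2) by (simp add: sum_distrib_right mult.assoc)
    also have "\<dots> \<in> rspan R B"
      by (intro rspan_sum[OF R] rspan_scale[OF R] neg base) (use ij in auto)
    finally show ?thesis .
  qed
  moreover have "y * (x ^ i * y ^ j) \<in> rspan R B" if ij: "i < n" "j < m" for i j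
  proof (cases "Suc j < m")
    case True
    then show ?thesis using base[of i "Suc j"] ij by (simp add: mult_ac)
  next
    case False
    then have "Suc j = m" using ij by simp
    then have "y * (x ^ i * y ^ j) = x ^ i * y ^ m" by (metis mult.left_commute power_Suc)
    also have "\<dots> = (\<Sum>k<m. - coeff q k * (x ^ i * y ^ k))"
      unfolding py(2) by (simp add: sum_distrib_left mult_ac)
    also have "\<dots> \<in> rspan R B"
      by (intro rspan_sum[OF R] rspan_scale[OF R] neg base) (use ij in auto)
    finally show ?thesis .
  qed
  moreover have "1 \<in> B" using mem[OF px(1) py(1)] by simp
  ultimately show ?thesis using fin by (intro exI[of _ B]) (auto simp: B_def)
qed

lemma ring_set_subfield: "is_subfield F \<Longrightarrow> ring_set F"
  by (auto simp: is_subfield_def ring_set_def)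

text \<open>Sums and products of two integral elements preserve a common finitely generated module
  containing 1, hence are integral. Negatives are products with -1, which lies in
  \<open>R\<close>.\<close>

lemma ring_set_integral_closure:
  assumes R: "ring_set R" and F: "is_subfield F" "R \<subseteq> F"
  shows "ring_set (integral_closure_in R F)" and "R \<subseteq> integral_closure_in R F"
proof -
  show RI: "R \<subseteq> integral_closure_in R F"
  proof
    fix x assume x: "x \<in> R"
    have "lead_coeff [:-x, 1:] = 1 \<and> (\<forall>k. coeff [:-x, 1:] k \<in> R) \<and> poly [:-x, 1:] x = 0"
      using x R by (auto simp: ring_set_def coeff_pCons split: nat.splits)
    then show "x \<in> integral_closure_in R F" using x F unfolding integral_closure_in_def by blast
  qed
  have pair: "x + y \<in> integral_closure_in R F \<and> x * y \<in> integral_closure_in R F"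
    if xy: "x \<in> integral_closure_in R F" "y \<in> integral_closure_in R F" for x y
  proof -
    obtain p q where p: "lead_coeff p = 1" "\<forall>k. coeff p k \<in> R" "poly p x = 0"
      and q: "lead_coeff q = 1" "\<forall>k. coeff q k \<in> R" "poly q y = 0"
      using xy unfolding integral_closure_in_def by blast
    obtain B where B: "finite B" "1 \<in> B" "\<And>b. b \<in> B \<Longrightarrow> x * b \<in> rspan R B" "\<And>b. b \<in> B \<Longrightarrow> y * b \<in> rspan R B"
      using integral_pair_module[OF R p q] by blast
    have "(x + y) * b \<in> rspan R B" "(x * y) * b \<in> rspan R B" if "b \<in> B" for b
    proof -
      show "(x + y) * b \<in> rspan R B" using B(3,4)[OF that] by (simp add: distrib_right rspan_add[OF R])
      show "(x * y) * b \<in> rspan R B"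
        unfolding mult.assoc by (rule rspan_mult_closed[OF R B(3) B(4)[OF that]])
    qed
    moreover have "x \<in> F" "y \<in> F" using xy by (auto simp: integral_closure_in_def)
    then have "x + y \<in> F" "x * y \<in> F" using F by (auto simp: is_subfield_def)
    ultimately show ?thesis
      unfolding integral_closure_in_def using integral_of_span[OF R B(1,2)] by blast
  qed
  moreover have "0 \<in> integral_closure_in R F" "1 \<in> integral_closure_in R F" "- 1 \<in> integral_closure_in R F"
    using RI R by (auto simp: ring_set_def)
  moreover have "- x \<in> integral_closure_in R F" if "x \<in> integral_closure_in R F" for x
    using pair[of "- 1" x] that calculation(4) by simp
  ultimately show "ring_set (integral_closure_in R F)" by (simp add: ring_set_def)
qed

section \<open>Reduction of a lattice at a point\<close>

lemma vec_span_carrier: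
  "x \<in> vec_span X n G \<Longrightarrow> G \<subseteq> carrier_vec n \<Longrightarrow> x \<in> carrier_vec n"
  by (induction rule: vec_span.induct) auto

lemma vec_span_add:
  assumes G: "G \<subseteq> carrier_vec n" and "y \<in> vec_span X n G" "x \<in> vec_span X n G"
  shows "x + y \<in> vec_span X n G"
  using assms(2)
proof (induction rule: vec_span.induct)
  case 1
  then show ?case using assms(3) vec_span_carrier[OF assms(3) G] by simp
next
  case (2 y a g)
  have "y \<in> carrier_vec n" "g \<in> carrier_vec n" "x \<in> carrier_vec n"
    using 2 G vec_span_carrier assms(3) by blast+
  then have "x + (y + a \<cdot>\<^sub>v g) = (x + y) + a \<cdot>\<^sub>v g" by (simp add: assoc_add_vec[of _ n])
  then show ?case using vec_span.intros(2)[OF 2(4,2,3)] by simp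
qed

lemma vec_span_scale:
  assumes G: "G \<subseteq> carrier_vec n" and X: "\<And>x. x \<in> X \<Longrightarrow> c * x \<in> X" and "x \<in> vec_span X n G"
  shows "c \<cdot>\<^sub>v x \<in> vec_span X n G"
  using assms(3)
proof (induction rule: vec_span.induct)
  case 1
  have "c \<cdot>\<^sub>v 0\<^sub>v n = 0\<^sub>v n" by (rule eq_vecI) auto
  then show ?case by (simp add: vec_span.intros(1))
next
  case (2 y a g)
  have "y \<in> carrier_vec n" "g \<in> carrier_vec n"
    using 2 G vec_span_carrier by blast+
  then have "c \<cdot>\<^sub>v (y + a \<cdot>\<^sub>v g) = c \<cdot>\<^sub>v y + (c * a) \<cdot>\<^sub>v g"
    by (simp add: smult_add_distrib_vec[of _ n] smult_smult_assoc)
  then show ?case using vec_span.intros(2)[OF 2(4) X[OF 2(2)] 2(3)] by simp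
qed

lemma vec_span_base: "G \<subseteq> carrier_vec n \<Longrightarrow> a \<in> X \<Longrightarrow> g \<in> G \<Longrightarrow> a \<cdot>\<^sub>v g \<in> vec_span X n G"
  using vec_span.intros(2)[OF vec_span.intros(1), of a X g G n] by auto

text \<open>Defined coordinatewise, so that the length is \<open>n\<close> also for empty
  \<open>J\<close>; the index set allows repetitions in the family \<open>g\<close>.\<close>

definition lcomb :: "nat \<Rightarrow> 'i set \<Rightarrow> ('i \<Rightarrow> 'a) \<Rightarrow> ('i \<Rightarrow> 'a Matrix.vec) \<Rightarrow> 'a::comm_ring_1 Matrix.vec" where
  "lcomb n J a g = Matrix.vec n (\<lambda>i. \<Sum>j\<in>J. a j * g j $ i)"

lemma lcomb_carrier [simp]: "lcomb n J a g \<in> carrier_vec n"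
  by (simp add: lcomb_def)

lemma lcomb_empty: "lcomb n {} a g = 0\<^sub>v n"
  by (rule eq_vecI) (auto simp: lcomb_def)

lemma lcomb_insert:
  assumes "finite J" "j \<notin> J" "g j \<in> carrier_vec n"
  shows "lcomb n (insert j J) a g = lcomb n J a g + a j \<cdot>\<^sub>v g j"
  by (rule eq_vecI) (use assms in \<open>auto simp: lcomb_def\<close>)

lemma lcomb_closed:
  assumes "finite J" "\<And>j. j \<in> J \<Longrightarrow> g j \<in> carrier_vec n" "\<And>j. j \<in> J \<Longrightarrow> a j \<cdot>\<^sub>v g j \<in> V"
    "0\<^sub>v n \<in> V" "\<And>x y. x \<in> V \<Longrightarrow> y \<in> V \<Longrightarrow> x + y \<in> V"
  shows "lcomb n J a g \<in> V"
  using assms(1-3) by (induction J) (auto simp: lcomb_empty lcomb_insert assms)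

text \<open>\<open>A\<close> is a ring of functions, \<open>e\<close> the evaluation at a point and
  \<open>k\<close> the embedding of constants, so \<open>e\<close> identifies the quotient of
  \<open>A\<close> by its kernel \<open>I\<close> with the complex numbers. The lattice
  \<open>L\<close> is finitely generated and need not be free.\<close>

locale lattice_reduction =
  fixes A :: "'l::field set" and e :: "'l \<Rightarrow> complex" and k :: "complex \<Rightarrow> 'l"
    and n :: nat and G :: "'l Matrix.vec set"
  assumes A: "ring_set A"
    and e_add: "\<And>x y. x \<in> A \<Longrightarrow> y \<in> A \<Longrightarrow> e (x + y) = e x + e y"
    and e_mult: "\<And>x y. x \<in> A \<Longrightarrow> y \<in> A \<Longrightarrow> e (x * y) = e x * e y"
    and k: "\<And>c. k c \<in> A" "\<And>c. e (k c) = c" "k 0 = 0" "k 1 = 1"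
    and G: "finite G" "G \<subseteq> carrier_vec n"
begin

definition "L = vec_span A n G"

definition "I = {a \<in> A. e a = 0}"

definition "IL = vec_span I n L"

lemma A_closed: "0 \<in> A" "1 \<in> A" "x \<in> A \<Longrightarrow> y \<in> A \<Longrightarrow> x + y \<in> A" "x \<in> A \<Longrightarrow> y \<in> A \<Longrightarrow> x * y \<in> A" "x \<in> A \<Longrightarrow> - x \<in> A"
  "x \<in> A \<Longrightarrow> y \<in> A \<Longrightarrow> x - y \<in> A"
  using A by (auto simp: ring_set_def) (metis add_uminus_conv_diff)

lemma e_0: "e 0 = 0" and e_1: "e 1 = 1"
  using k(2)[of 0] k(2)[of 1] k(3,4) by simp_all

lemma e_uminus: "x \<in> A \<Longrightarrow> e (- x) = - e x"
  using e_add[of x "- x"] A_closed(5)[of x] e_0 by (simp add: eq_neg_iff_add_eq_0 add.commute)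

lemma e_diff: "x \<in> A \<Longrightarrow> y \<in> A \<Longrightarrow> e (x - y) = e x - e y"
  using e_add[of x "- y"] A_closed(5)[of y] e_uminus[of y] by simp

lemma e_sum: "(\<And>i. i \<in> J \<Longrightarrow> f i \<in> A) \<Longrightarrow> e (sum f J) = (\<Sum>i\<in>J. e (f i))"
  by (induction J rule: infinite_finite_induct) (auto simp: e_0 e_add ring_set_sum[OF A])

lemma L_carrier: "x \<in> L \<Longrightarrow> x \<in> carrier_vec n"
  unfolding L_def by (rule vec_span_carrier[OF _ G(2)])

lemma L_sub: "L \<subseteq> carrier_vec n" using L_carrier by blast

lemma L_add: "x \<in> L \<Longrightarrow> y \<in> L \<Longrightarrow> x + y \<in> L"
  unfolding L_def by (rule vec_span_add[OF G(2)])

lemma L_scale: "c \<in> A \<Longrightarrow> x \<in> L \<Longrightarrow> c \<cdot>\<^sub>v x \<in> L"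
  unfolding L_def by (rule vec_span_scale[OF G(2)]) (auto simp: A_closed)

lemma L_zero: "0\<^sub>v n \<in> L" unfolding L_def by (rule vec_span.intros(1))

lemma G_L: "g \<in> G \<Longrightarrow> g \<in> L"
  using vec_span_base[OF G(2) A_closed(2), of g] unfolding L_def by simp

lemma I_ideal: "c \<in> A \<Longrightarrow> x \<in> I \<Longrightarrow> c * x \<in> I"
  by (auto simp: I_def A_closed e_mult)

lemma IL_add: "x \<in> IL \<Longrightarrow> y \<in> IL \<Longrightarrow> x + y \<in> IL"
  unfolding IL_def by (rule vec_span_add[OF L_sub])

lemma IL_scale: "c \<in> A \<Longrightarrow> x \<in> IL \<Longrightarrow> c \<cdot>\<^sub>v x \<in> IL"
  unfolding IL_def by (rule vec_span_scale[OF L_sub]) (auto simp: I_ideal)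

lemma IL_zero: "0\<^sub>v n \<in> IL" unfolding IL_def by (rule vec_span.intros(1))

lemma IL_base: "a \<in> I \<Longrightarrow> x \<in> L \<Longrightarrow> a \<cdot>\<^sub>v x \<in> IL"
  unfolding IL_def by (rule vec_span_base[OF L_sub])

lemma IL_L: "x \<in> IL \<Longrightarrow> x \<in> L"
  unfolding IL_def by (induction rule: vec_span.induct) (auto intro!: L_zero L_add L_scale simp: I_def)

lemma IL_carrier: "x \<in> IL \<Longrightarrow> x \<in> carrier_vec n"
  using IL_L L_carrier by blast

lemma IL_diff: "x \<in> IL \<Longrightarrow> y \<in> IL \<Longrightarrow> x - y \<in> IL"
proof -
  assume xy: "x \<in> IL" "y \<in> IL"
  have "x - y = x + (- 1) \<cdot>\<^sub>v y" using IL_carrier[OF xy(1)] IL_carrier[OF xy(2)] by (intro eq_vecI) auto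
  then show ?thesis using IL_add[OF xy(1) IL_scale[OF _ xy(2), of "- 1"]] A_closed by simp
qed

text \<open>Generation is taken modulo \<open>IL\<close> because the aim is a basis of the vector
  space \<open>L\<close> modulo \<open>IL\<close>, not of \<open>L\<close>.\<close>

definition generates :: "'l Matrix.vec set \<Rightarrow> bool" where
  "generates J \<longleftrightarrow> (\<forall>x\<in>L. \<exists>a. (\<forall>v\<in>J. a v \<in> A) \<and> (\<exists>m\<in>IL. x = lcomb n J a id + m))"

lemma generates_G: "generates G"
  unfolding generates_def
proof
  fix x assume "x \<in> L"
  then show "\<exists>a. (\<forall>v\<in>G. a v \<in> A) \<and> (\<exists>m\<in>IL. x = lcomb n G a id + m)"
    unfolding L_def
  proof (induction rule: vec_span.induct)
    case 1
    have "0\<^sub>v n = lcomb n G (\<lambda>_. 0) id + 0\<^sub>v n" by (rule eq_vecI) (auto simp: lcomb_def)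
    then show ?case using IL_zero A_closed(1) by (intro exI[of _ "\<lambda>_. 0"]) blast
  next
    case (2 x c g)
    then obtain a m where a: "\<forall>v\<in>G. a v \<in> A" "m \<in> IL" "x = lcomb n G a id + m" by blast
    have g: "g \<in> carrier_vec n" using 2 G by auto
    have "lcomb n G (\<lambda>v. a v + (if v = g then c else 0)) id = lcomb n G a id + c \<cdot>\<^sub>v g"
    proof (rule eq_vecI)
      fix i assume "i < dim_vec (lcomb n G a id + c \<cdot>\<^sub>v g)"
      then have i: "i < n" using g by simp
      have "(\<Sum>v\<in>G. (a v + (if v = g then c else 0)) * v $ i) = (\<Sum>v\<in>G. a v * v $ i) + (\<Sum>v\<in>G. if v = g then c * v $ i else 0)"
        unfolding sum.distrib[symmetric] by (intro sum.cong) (auto simp: distrib_right)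
      then show "lcomb n G (\<lambda>v. a v + (if v = g then c else 0)) id $ i = (lcomb n G a id + c \<cdot>\<^sub>v g) $ i"
        using i g G(1) 2(3) by (simp add: lcomb_def)
    qed (use g in \<open>simp add: lcomb_def\<close>)
    then have "x + c \<cdot>\<^sub>v g = lcomb n G (\<lambda>v. a v + (if v = g then c else 0)) id + m"
      using g IL_carrier[OF a(2)] unfolding a(3)
      by (intro eq_vecI) (auto simp: lcomb_def)
    moreover have "\<forall>v\<in>G. a v + (if v = g then c else 0) \<in> A" using a(1) 2(2) A_closed by auto
    ultimately show ?case using a(2) by (intro exI[of _ "\<lambda>v. a v + (if v = g then c else 0)"]) blast
  qed
qed

text \<open>A coefficient at \<open>w\<close> with nonzero value would be invertible modulo
  \<open>I\<close>, so \<open>w\<close> could be expressed modulo \<open>IL\<close> by the other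
  elements, contradicting minimality.\<close>

lemma minimal_independent:
  assumes J: "J \<subseteq> G" "generates J" "\<And>J'. J' \<subseteq> G \<Longrightarrow> generates J' \<Longrightarrow> card J \<le> card J'"
    and a: "\<forall>v\<in>J. a v \<in> A" "lcomb n J a id \<in> IL" and w: "w \<in> J"
  shows "e (a w) = 0"
proof (rule ccontr)
  assume nz: "e (a w) \<noteq> 0"
  define c where "c = k (inverse (e (a w)))"
  have c: "c \<in> A" "e c * e (a w) = 1" using nz by (simp_all add: c_def k)
  have fin: "finite J" using J(1) G(1) finite_subset by blast
  have wc: "w \<in> carrier_vec n" "w \<in> L" using w J(1) G G_L by auto
  define J' where "J' = J - {w}"
  have JJ: "J = insert w J'" "w \<notin> J'" "finite J'" using w fin by (auto simp: J'_def)
  have "generates J'"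
    unfolding generates_def
  proof
    fix x assume "x \<in> L"
    then obtain b m where b: "\<forall>v\<in>J. b v \<in> A" "m \<in> IL" "x = lcomb n J b id + m"
      using J(2) unfolding generates_def by blast
    \<comment> \<open>Chosen so that subtracting \<open>r\<close> times the relation brings the
      coefficient of \<open>w\<close> into \<open>I\<close>.\<close>
    define r where "r = b w * c"
    have r: "r \<in> A" using b(1) c(1) w by (auto simp: r_def A_closed)
    define m' where "m' = (b w - r * a w) \<cdot>\<^sub>v w + r \<cdot>\<^sub>v lcomb n J a id + m"
    have "b w - r * a w \<in> I"
      using b(1) a(1) w r c by (auto simp: I_def A_closed e_diff e_mult r_def mult.assoc)
    then have m': "m' \<in> IL"
      unfolding m'_def by (intro IL_add IL_base IL_scale r a(2) b(2) wc)
    have "x = lcomb n J' (\<lambda>v. b v - r * a v) id + m'"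
    proof (rule eq_vecI)
      fix i assume "i < dim_vec (lcomb n J' (\<lambda>v. b v - r * a v) id + m')"
      then have i: "i < n" using IL_carrier[OF m'] by simp
      show "x $ i = (lcomb n J' (\<lambda>v. b v - r * a v) id + m') $ i"
        using i wc(1) IL_carrier[OF m'] IL_carrier[OF b(2)] JJ(2,3) unfolding m'_def b(3) JJ(1)
        by (simp add: lcomb_def algebra_simps sum_subtractf sum_distrib_left)
    qed (use IL_carrier[OF m'] IL_carrier[OF b(2)] b(3) in \<open>auto simp: lcomb_def\<close>)
    moreover have "\<forall>v\<in>J'. b v - r * a v \<in> A" using b(1) a(1) r by (auto simp: J'_def A_closed)
    ultimately show "\<exists>a. (\<forall>v\<in>J'. a v \<in> A) \<and> (\<exists>m\<in>IL. x = lcomb n J' a id + m)"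
      using m' by (intro exI[of _ "\<lambda>v. b v - r * a v"]) blast
  qed
  moreover have "J' \<subseteq> G" using J(1) by (auto simp: J'_def)
  ultimately have "card J \<le> card J'" using J(3) by blast
  then show False using JJ by simp
qed

text \<open>A generating subset of \<open>G\<close> with fewest elements, renumbered by
  \<open>s\<close>. Independence concerns the values of the coefficients under \<open>e\<close>,
  since the coefficients themselves are determined only modulo \<open>I\<close>.\<close>

lemma reduction_basis:
  "\<exists>(d::nat) s. (\<forall>j<d. s j \<in> L) \<and>
     (\<forall>x\<in>L. \<exists>a. (\<forall>j<d. a j \<in> A) \<and> (\<exists>m\<in>IL. x = lcomb n {..<d} a s + m)) \<and>
     (\<forall>a. (\<forall>j<d. a j \<in> A) \<and> lcomb n {..<d} a s \<in> IL \<longrightarrow> (\<forall>j<d. e (a j) = 0))"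
proof -
  define J where "J = arg_min card (\<lambda>J. J \<subseteq> G \<and> generates J)"
  have "(J \<subseteq> G \<and> generates J) \<and> (\<forall>J'. J' \<subseteq> G \<and> generates J' \<longrightarrow> card J \<le> card J')"
    unfolding J_def by (rule arg_min_nat_lemma[of "\<lambda>J. J \<subseteq> G \<and> generates J" G]) (simp add: generates_G)
  then have J: "J \<subseteq> G \<and> generates J" "\<And>J'. J' \<subseteq> G \<Longrightarrow> generates J' \<Longrightarrow> card J \<le> card J'" by blast+
  have fin: "finite J" using J(1) G(1) finite_subset by blast
  obtain s where s: "bij_betw s {..<card J} J"
    using ex_bij_betw_nat_finite[OF fin] by (auto simp: atLeast0LessThan)
  define s' where "s' = inv_into {..<card J} s"
  have re: "lcomb n {..<card J} a s = lcomb n J (a \<circ> s') id" for a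
  proof (rule eq_vecI)
    fix i assume i: "i < dim_vec (lcomb n J (a \<circ> s') id)"
    have "(\<Sum>v\<in>J. a (s' v) * v $ i) = (\<Sum>j<card J. a (s' (s j)) * s j $ i)"
      using sum.reindex_bij_betw[OF s, of "\<lambda>v. a (s' v) * v $ i"] by simp
    also have "\<dots> = (\<Sum>j<card J. a j * s j $ i)"
      using bij_betw_inv_into_left[OF s] by (intro sum.cong) (auto simp: s'_def)
    finally show "lcomb n {..<card J} a s $ i = lcomb n J (a \<circ> s') id $ i"
      using i by (simp add: lcomb_def)
  qed (simp add: lcomb_def)
  have s': "s' (s j) = j" if "j < card J" for j using bij_betw_inv_into_left[OF s] that by (auto simp: s'_def)
  have s'J: "s' v < card J" "s (s' v) = v" if "v \<in> J" for v
    using that s bij_betw_inv_into_right[OF s that] bij_betwE[OF bij_betw_inv_into[OF s]] by (auto simp: s'_def)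
  have sJ: "s j \<in> J" if "j < card J" for j using s that bij_betwE by blast
  show ?thesis
  proof (rule exI[where x = "card J"], rule exI[where x = s], intro conjI allI impI ballI)
    show "s j \<in> L" if "j < card J" for j using sJ[OF that] J(1) G_L by blast
    show "\<exists>a. (\<forall>j<card J. a j \<in> A) \<and> (\<exists>m\<in>IL. x = lcomb n {..<card J} a s + m)" if "x \<in> L" for x
    proof -
      obtain a m where a: "\<forall>v\<in>J. a v \<in> A" "m \<in> IL" "x = lcomb n J a id + m"
        using J(1) \<open>x \<in> L\<close> unfolding generates_def by blast
      have "lcomb n J a id = lcomb n J ((a \<circ> s) \<circ> s') id"
        by (rule eq_vecI) (auto simp: lcomb_def s'J intro!: sum.cong)
      then show ?thesis using a sJ unfolding re by (intro exI[of _ "a \<circ> s"]) auto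
    qed
    show "e (a j) = 0" if "(\<forall>j<card J. a j \<in> A) \<and> lcomb n {..<card J} a s \<in> IL" "j < card J" for a j
    proof -
      have "e ((a \<circ> s') (s j)) = 0"
      proof (rule minimal_independent[of J])
        show "\<forall>v\<in>J. (a \<circ> s') v \<in> A" using that s'J by auto
        show "lcomb n J (a \<circ> s') id \<in> IL" using that re by simp
      qed (use J sJ that in auto)
      then show ?thesis using s' that by simp
    qed
  qed
qed

end

context lattice_reduction
begin

text \<open>\<open>\<pi>\<close> takes coordinates with respect to \<open>s\<close> and evaluates
  them. Two choices of coordinates differ by a relation modulo \<open>IL\<close>, whose coefficients
  vanish under \<open>e\<close>, so \<open>\<pi>\<close> is well defined. The last clause keeps
  coordinates available for computing the action.\<close>

lemma quotient_map:
  "\<exists>(d::nat) \<pi> s. (\<forall>j<d. s j \<in> L) \<and> \<pi> ` L = carrier_vec d \<and>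
     (\<forall>x\<in>L. \<forall>y\<in>L. \<pi> (x + y) = \<pi> x + \<pi> y) \<and>
     (\<forall>a\<in>A. \<forall>x\<in>L. \<pi> (a \<cdot>\<^sub>v x) = e a \<cdot>\<^sub>v \<pi> x) \<and>
     (\<forall>x\<in>L. \<pi> x = 0\<^sub>v d \<longleftrightarrow> x \<in> IL) \<and>
     (\<forall>x\<in>L. \<exists>a. (\<forall>j<d. a j \<in> A) \<and> (\<exists>m\<in>IL. x = lcomb n {..<d} a s + m) \<and>
        \<pi> x = Matrix.vec d (\<lambda>j. e (a j)))"
proof -
  obtain d :: nat and s where s: "\<forall>j<d. s j \<in> L"
    and gen: "\<forall>x\<in>L. \<exists>a. (\<forall>j<d. a j \<in> A) \<and> (\<exists>m\<in>IL. x = lcomb n {..<d} a s + m)"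
    and ind: "\<forall>a. (\<forall>j<d. a j \<in> A) \<and> lcomb n {..<d} a s \<in> IL \<longrightarrow> (\<forall>j<d. e (a j) = 0)"
    using reduction_basis by blast
  define R where "R x a \<longleftrightarrow> (\<forall>j<d. a j \<in> A) \<and> (\<exists>m\<in>IL. x = lcomb n {..<d} a s + m)" for x a
  have RI: "R x a" if "\<And>j. j < d \<Longrightarrow> a j \<in> A" "m \<in> IL" "x = lcomb n {..<d} a s + m" for x a m
    unfolding R_def using that by blast
  define c where "c x = (SOME a. R x a)" for x
  have c: "R x (c x)" if "x \<in> L" for x
  proof -
    have "\<exists>a. R x a" using gen that unfolding R_def by blast
    then show ?thesis unfolding c_def by (rule someI_ex)
  qed
  define \<pi> where "\<pi> x = Matrix.vec d (\<lambda>j. e (c x j))" for x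
  have sc: "s j \<in> carrier_vec n" if "j < d" for j using s that L_carrier by blast
  have key: "\<pi> x = Matrix.vec d (\<lambda>j. e (a j))" if x: "x \<in> L" and a: "R x a" for x a
  proof -
    obtain m where m: "m \<in> IL" "x = lcomb n {..<d} a s + m" using a unfolding R_def by blast
    obtain m' where m': "m' \<in> IL" "x = lcomb n {..<d} (c x) s + m'" using c[OF x] unfolding R_def by blast
    have "lcomb n {..<d} (\<lambda>j. c x j - a j) s = m - m'"
    proof (rule eq_vecI)
      fix i assume "i < dim_vec (m - m')"
      then have i: "i < n" using IL_carrier[OF m'(1)] by simp
      have "(lcomb n {..<d} a s + m) $ i = (lcomb n {..<d} (c x) s + m') $ i" using m m' by simp
      then show "lcomb n {..<d} (\<lambda>j. c x j - a j) s $ i = (m - m') $ i"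
        using i IL_carrier[OF m(1)] IL_carrier[OF m'(1)]
        by (simp add: lcomb_def left_diff_distrib sum_subtractf algebra_simps)
    qed (use IL_carrier[OF m'(1)] in \<open>simp add: lcomb_def\<close>)
    then have "lcomb n {..<d} (\<lambda>j. c x j - a j) s \<in> IL" using IL_diff[OF m(1) m'(1)] by simp
    moreover have A2: "c x j \<in> A" "a j \<in> A" if "j < d" for j using a c[OF x] that by (auto simp: R_def)
    ultimately have "e (c x j - a j) = 0" if "j < d" for j
      using spec[OF ind, of "\<lambda>j. c x j - a j"] that by (simp add: A_closed(6))
    then have "e (c x j) = e (a j)" if "j < d" for j using e_diff[OF A2[OF that]] that by simp
    then show ?thesis by (auto simp: \<pi>_def)
  qed
  have lL: "lcomb n {..<d} a s \<in> L" if "\<forall>j<d. a j \<in> A" for a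
    by (rule lcomb_closed) (use that s sc in \<open>auto intro: L_scale L_zero L_add\<close>)
  have "\<pi> ` L = carrier_vec d"
  proof
    show "\<pi> ` L \<subseteq> carrier_vec d" by (auto simp: \<pi>_def)
    show "carrier_vec d \<subseteq> \<pi> ` L"
    proof
      fix y :: "complex Matrix.vec" assume y: "y \<in> carrier_vec d"
      define a where "a j = k (y $ j)" for j
      define x where "x = lcomb n {..<d} a s"
      have x: "x \<in> L" unfolding x_def by (rule lL) (auto simp: a_def k)
      have "R x a"
        by (rule RI[OF _ IL_zero]) (auto simp: a_def k x_def)
      then have "\<pi> x = y" using key[OF x] y by (auto simp: a_def k)
      then show "y \<in> \<pi> ` L" using x by blast
    qed
  qed
  moreover have "\<pi> (x + y) = \<pi> x + \<pi> y" if xy: "x \<in> L" "y \<in> L" for x y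
  proof -
    obtain m where m: "m \<in> IL" "x = lcomb n {..<d} (c x) s + m" using c[OF xy(1)] unfolding R_def by blast
    obtain m' where m': "m' \<in> IL" "y = lcomb n {..<d} (c y) s + m'" using c[OF xy(2)] unfolding R_def by blast
    have "x + y = lcomb n {..<d} (\<lambda>j. c x j + c y j) s + (m + m')"
      by (subst m(2), subst m'(2)) (rule eq_vecI, use IL_carrier[OF m(1)] IL_carrier[OF m'(1)] in
        \<open>auto simp: lcomb_def distrib_right sum.distrib\<close>)
    moreover have A2: "c x j \<in> A" "c y j \<in> A" if "j < d" for j using c xy that by (auto simp: R_def)
    ultimately have "R (x + y) (\<lambda>j. c x j + c y j)"
      by (intro RI[of _ "m + m'"] IL_add[OF m(1) m'(1)] A_closed(3))
    then show ?thesis using key[OF L_add[OF xy]] A2 by (auto simp: \<pi>_def e_add)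
  qed
  moreover have "\<pi> (a \<cdot>\<^sub>v x) = e a \<cdot>\<^sub>v \<pi> x" if ax: "a \<in> A" "x \<in> L" for a x
  proof -
    obtain m where m: "m \<in> IL" "x = lcomb n {..<d} (c x) s + m" using c[OF ax(2)] unfolding R_def by blast
    have "a \<cdot>\<^sub>v x = lcomb n {..<d} (\<lambda>j. a * c x j) s + a \<cdot>\<^sub>v m"
      by (subst m(2)) (rule eq_vecI, use IL_carrier[OF m(1)] in
        \<open>auto simp: lcomb_def distrib_left sum_distrib_left mult.assoc\<close>)
    moreover have A2: "c x j \<in> A" if "j < d" for j using c ax that by (auto simp: R_def)
    ultimately have "R (a \<cdot>\<^sub>v x) (\<lambda>j. a * c x j)"
      by (intro RI[of _ "a \<cdot>\<^sub>v m"] IL_scale[OF ax(1) m(1)] A_closed(4)[OF ax(1)])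
    then show ?thesis using key[OF L_scale[OF ax]] A2 ax(1) by (auto simp: \<pi>_def e_mult)
  qed
  moreover have "\<pi> x = 0\<^sub>v d \<longleftrightarrow> x \<in> IL" if x: "x \<in> L" for x
  proof
    assume 0: "\<pi> x = 0\<^sub>v d"
    obtain m where m: "m \<in> IL" "x = lcomb n {..<d} (c x) s + m" using c[OF x] unfolding R_def by blast
    have "e (c x j) = 0" if "j < d" for j
    proof -
      have "\<pi> x $ j = 0" using 0 that by simp
      then show ?thesis using that by (simp add: \<pi>_def)
    qed
    then have "c x j \<in> I" if "j < d" for j using c[OF x] that by (auto simp: I_def R_def)
    then have "lcomb n {..<d} (c x) s \<in> IL"
      by (intro lcomb_closed) (use s sc in \<open>auto intro: IL_base IL_zero IL_add\<close>)
    then show "x \<in> IL" using m IL_add by metis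
  next
    assume m: "x \<in> IL"
    have "x = lcomb n {..<d} (\<lambda>_. 0) s + x"
      by (rule eq_vecI) (use IL_carrier[OF m] in \<open>auto simp: lcomb_def\<close>)
    then have "R x (\<lambda>_. 0)" by (intro RI[OF A_closed(1) m])
    then show "\<pi> x = 0\<^sub>v d" using key[OF x] by (auto simp: e_0)
  qed
  moreover have "\<exists>a. (\<forall>j<d. a j \<in> A) \<and> (\<exists>m\<in>IL. x = lcomb n {..<d} a s + m) \<and>
        \<pi> x = Matrix.vec d (\<lambda>j. e (a j))" if "x \<in> L" for x
    using c[OF that] unfolding R_def \<pi>_def by blast
  ultimately show ?thesis using s by (intro exI[of _ d] exI[of _ \<pi>] exI[of _ s]) blast
qed

end

section \<open>The Hecke module structure on the reduced lattice\<close>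

lemma hcarrier_induct:
  fixes a :: "'n::finite aff \<Rightarrow> 'a::comm_ring_1"
  assumes a: "a \<in> hcarrier D A" and A: "0 \<in> A" and P0: "P (\<lambda>_. 0)"
    and step: "\<And>h w c. h \<in> hcarrier D A \<Longrightarrow> P h \<Longrightarrow> w \<in> Wgrp D \<Longrightarrow> c \<in> A \<Longrightarrow> P (\<lambda>u. h u + c * Nb w u)"
  shows "P a"
proof -
  have "P (\<lambda>u. if u \<in> F then a u else 0)" if "F \<subseteq> supp a" "finite F" for F
    using that(2,1)
  proof (induction F)
    case (insert w F)
    define h where "h = (\<lambda>u. if u \<in> F then a u else 0)"
    have "h \<in> hcarrier D A"
      by (rule hcarrierI) (use hcarrierD[OF a] insert A in \<open>auto simp: h_def\<close>)
    moreover have "w \<in> Wgrp D" "a w \<in> A" using hcarrierD[OF a] insert by auto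
    moreover have "P h" using insert by (simp add: h_def)
    ultimately have "P (\<lambda>u. h u + a w * Nb w u)" by (intro step)
    moreover have "(\<lambda>u. h u + a w * Nb w u) = (\<lambda>u. if u \<in> insert w F then a u else 0)"
      by (rule ext) (use insert(2) in \<open>simp add: h_def Nb_def\<close>)
    ultimately show ?case by simp
  qed (simp add: P0)
  from this[of "supp a"] hcarrierD(1)[OF a] have "P (\<lambda>u. if u \<in> supp a then a u else 0)" by simp
  moreover have "(\<lambda>u. if u \<in> supp a then a u else 0) = a" by auto
  ultimately show ?thesis by simp
qed

lemma mat_eq_mult_vecI:
  fixes M N :: "'a::comm_ring_1 mat"
  assumes M: "M \<in> carrier_mat d d" "N \<in> carrier_mat d d" and eq: "\<And>y. y \<in> carrier_vec d \<Longrightarrow> M *\<^sub>v y = N *\<^sub>v y"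
  shows "M = N"
proof (rule eq_matI)
  fix i j assume ij: "i < dim_row N" "j < dim_col N"
  have "(M *\<^sub>v unit_vec d j) $ i = (N *\<^sub>v unit_vec d j) $ i" using eq[of "unit_vec d j"] by simp
  then show "M $$ (i, j) = N $$ (i, j)" using ij M by simp
qed (use M in auto)

text \<open>\<open>\<Psi>\<close> is a unital action over \<open>A\<close> that preserves
  \<open>L\<close>, and the structure constants \<open>con\<close> reduce under \<open>e\<close> to
  those at \<open>p\<close>. The aim is an action of the algebra at \<open>p\<close> on
  \<open>L\<close> modulo \<open>IL\<close>.\<close>

locale hecke_lattice = lattice_reduction A e k n G + hecke H
  for A :: "'l::field set" and e k n G and H :: "('n::finite) affine_hecke" +
  fixes p :: "'n pt" and con :: "'n aff \<Rightarrow> 'n aff \<Rightarrow> 'n aff \<Rightarrow> 'l" and \<Psi> :: "('n aff \<Rightarrow> 'l) \<Rightarrow> 'l mat"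
  assumes p: "p \<in> QC H"
    and con: "x \<in> Wgrp H \<Longrightarrow> y \<in> Wgrp H \<Longrightarrow> con x y u \<in> A"
      "x \<in> Wgrp H \<Longrightarrow> y \<in> Wgrp H \<Longrightarrow> e (con x y u) = mulc_at H p x y u"
    and Psi_carrier: "h \<in> hcarrier H A \<Longrightarrow> \<Psi> h \<in> carrier_mat n n"
    and Psi_add: "h \<in> hcarrier H A \<Longrightarrow> h' \<in> hcarrier H A \<Longrightarrow> \<Psi> (\<lambda>w. h w + h' w) = \<Psi> h + \<Psi> h'"
    and Psi_scale: "c \<in> A \<Longrightarrow> h \<in> hcarrier H A \<Longrightarrow> \<Psi> (\<lambda>w. c * h w) = c \<cdot>\<^sub>m \<Psi> h"
    and Psi_mult: "h \<in> hcarrier H A \<Longrightarrow> h' \<in> hcarrier H A \<Longrightarrow> hmul con h h' \<in> hcarrier H A"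
      "h \<in> hcarrier H A \<Longrightarrow> h' \<in> hcarrier H A \<Longrightarrow> \<Psi> (hmul con h h') = \<Psi> h * \<Psi> h'"
    and Psi_id: "\<Psi> (Nb id) = 1\<^sub>m n"
    and Psi_L: "h \<in> hcarrier H A \<Longrightarrow> z \<in> L \<Longrightarrow> \<Psi> h *\<^sub>v z \<in> L"
begin

abbreviation "HA \<equiv> hcarrier H A"
abbreviation "HC \<equiv> hcarrier H (UNIV :: complex set)"

lemma reduce_carr: "h \<in> HA \<Longrightarrow> (\<lambda>w. e (h w)) \<in> HC"
proof (rule hcarrierI)
  assume h: "h \<in> HA"
  have "supp (\<lambda>w. e (h w)) \<subseteq> supp h" using e_0 by auto
  then show "finite (supp (\<lambda>w. e (h w)))" "supp (\<lambda>w. e (h w)) \<subseteq> Wgrp H"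
    using hcarrierD(1,2)[OF h] finite_subset by blast+
qed auto

lemma Psi_zero: "\<Psi> (\<lambda>_. 0) = 0\<^sub>m n n"
proof -
  have z: "(\<lambda>_. 0) \<in> HA" by (rule hcarrier_zero[OF A])
  have "\<Psi> (\<lambda>w. 0 * 0) = 0 \<cdot>\<^sub>m \<Psi> (\<lambda>_. 0)" by (rule Psi_scale[OF A_closed(1) z])
  also have "\<dots> = 0\<^sub>m n n" using Psi_carrier[OF z] by auto
  finally show ?thesis by simp
qed

lemma Psi_step:
  assumes "h \<in> HA" "w \<in> Wgrp H" "c \<in> A" "x \<in> L"
  shows "\<Psi> (\<lambda>u. h u + c * Nb w u) *\<^sub>v x = \<Psi> h *\<^sub>v x + c \<cdot>\<^sub>v (\<Psi> (Nb w) *\<^sub>v x)"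
proof -
  have N: "Nb w \<in> HA" by (rule hcarrier_Nb[OF A assms(2)])
  have "\<Psi> (\<lambda>u. h u + c * Nb w u) = \<Psi> h + c \<cdot>\<^sub>m \<Psi> (Nb w)"
    by (simp add: Psi_add Psi_scale hcarrier_scale A N assms)
  then show ?thesis
    using Psi_carrier[OF assms(1)] Psi_carrier[OF N] L_carrier[OF assms(4)]
    by (simp add: add_mult_distrib_mat_vec[of _ n n] smult_mat_vec[of _ n n])
qed

lemma Psi_IL:
  assumes h: "h \<in> HA" and x: "x \<in> IL"
  shows "\<Psi> h *\<^sub>v x \<in> IL"
  using x unfolding IL_def
proof (induction rule: vec_span.induct)
  case 1
  have "\<Psi> h *\<^sub>v 0\<^sub>v n = 0\<^sub>v n" using Psi_carrier[OF h] by (intro eq_vecI) auto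
  then show ?case by (simp add: vec_span.intros(1))
next
  case (2 x a g)
  have x: "x \<in> carrier_vec n" using vec_span_carrier[OF 2(1) L_sub] .
  have g: "g \<in> carrier_vec n" using L_carrier[OF 2(3)] .
  have "\<Psi> h *\<^sub>v (x + a \<cdot>\<^sub>v g) = \<Psi> h *\<^sub>v x + a \<cdot>\<^sub>v (\<Psi> h *\<^sub>v g)"
    using Psi_carrier[OF h] x g
    by (simp add: mult_add_distrib_mat_vec[of _ n n] mult_mat_vec[of _ n n])
  then show ?case using vec_span.intros(2)[OF 2(4,2) Psi_L[OF h 2(3)]] by simp
qed

text \<open>Elements whose coefficients vanish under \<open>e\<close> act by zero on the quotient;
  this is why the choice of a lift does not matter.\<close>

lemma Psi_I:
  assumes h: "h \<in> hcarrier H I" and x: "x \<in> L"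
  shows "\<Psi> h *\<^sub>v x \<in> IL"
  using h
proof (rule hcarrier_induct)
  show "0 \<in> I" using A_closed(1) e_0 by (simp add: I_def)
  show "\<Psi> (\<lambda>_. 0) *\<^sub>v x \<in> IL" using L_carrier[OF x] IL_zero by (simp add: Psi_zero zero_mat_vec)
  fix h w c assume h: "h \<in> hcarrier H I" "\<Psi> h *\<^sub>v x \<in> IL" and w: "w \<in> Wgrp H" and c: "c \<in> I"
  have "h \<in> HA" using h(1) by (rule hcarrier_mono) (auto simp: I_def)
  moreover have "c \<in> A" using c by (simp add: I_def)
  ultimately show "\<Psi> (\<lambda>u. h u + c * Nb w u) *\<^sub>v x \<in> IL"
    using h w c x by (auto simp: Psi_step intro!: IL_add IL_base Psi_L hcarrier_Nb A)
qed

lemma e_hmul: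
  assumes h: "h \<in> HA" and h': "h' \<in> HA"
  shows "e (hmul con h h' u) = hmul (mulc_at H p) (\<lambda>w. e (h w)) (\<lambda>w. e (h' w)) u"
proof -
  have W: "x \<in> Wgrp H" if "x \<in> supp h \<or> x \<in> supp h'" for x
    using that hcarrierD(2)[OF h] hcarrierD(2)[OF h'] by blast
  have A1: "h x * h' y * con x y u \<in> A" if "x \<in> supp h" "y \<in> supp h'" for x y
    using W that hcarrierD(3)[OF h] hcarrierD(3)[OF h'] by (auto intro!: A_closed con)
  have "e (hmul con h h' u) = (\<Sum>x\<in>supp h. e (\<Sum>y\<in>supp h'. h x * h' y * con x y u))"
    unfolding hmul_def by (rule e_sum) (use A1 in \<open>auto intro!: ring_set_sum[OF A]\<close>)
  also have "\<dots> = (\<Sum>x\<in>supp h. \<Sum>y\<in>supp h'. e (h x * h' y * con x y u))"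
    by (intro sum.cong refl e_sum) (use A1 in auto)
  also have "\<dots> = (\<Sum>x\<in>supp h. \<Sum>y\<in>supp h'. e (h x) * e (h' y) * mulc_at H p x y u)"
    using W hcarrierD(3)[OF h] hcarrierD(3)[OF h']
    by (intro sum.cong refl) (auto simp: e_mult A_closed con)
  also have "\<dots> = hmul (mulc_at H p) (\<lambda>w. e (h w)) (\<lambda>w. e (h' w)) u"
    by (rule hmul_superset[symmetric]) (use hcarrierD(1)[OF h] hcarrierD(1)[OF h'] e_0 in auto)
  finally show ?thesis .
qed

text \<open>Compatibility is given on the basis elements \<open>Nb w\<close> and extends by
  linearity to all elements over \<open>A\<close>, with coefficients evaluated by
  \<open>e\<close>.\<close>

lemma specialization_act:
  assumes rep: "rep H p d \<rho>" and pc: "\<And>x. x \<in> L \<Longrightarrow> \<pi> x \<in> carrier_vec d"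
    and padd: "\<And>x y. x \<in> L \<Longrightarrow> y \<in> L \<Longrightarrow> \<pi> (x + y) = \<pi> x + \<pi> y"
    and pscale: "\<And>a x. a \<in> A \<Longrightarrow> x \<in> L \<Longrightarrow> \<pi> (a \<cdot>\<^sub>v x) = e a \<cdot>\<^sub>v \<pi> x"
    and pN: "\<And>w x. w \<in> Wgrp H \<Longrightarrow> x \<in> L \<Longrightarrow> \<pi> (\<Psi> (Nb w) *\<^sub>v x) = \<rho> (Nb w) *\<^sub>v \<pi> x"
    and h: "h \<in> HA" and x: "x \<in> L"
  shows "\<pi> (\<Psi> h *\<^sub>v x) = \<rho> (\<lambda>w. e (h w)) *\<^sub>v \<pi> x"
proof -
  interpret R: rep_setup H p d \<rho> using p rep hecke by unfold_locales auto
  show ?thesis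
    using h
  proof (rule hcarrier_induct)
    show "0 \<in> A" by (rule A_closed)
    have "\<pi> (0 \<cdot>\<^sub>v x) = 0\<^sub>v d" using pscale[OF A_closed(1) x] pc[OF x] e_0 by (simp add: zero_smult_vec[of _ d])
    then have "\<pi> (0\<^sub>v n) = 0\<^sub>v d" using L_carrier[OF x] by (simp add: zero_smult_vec[of _ n])
    then show "\<pi> (\<Psi> (\<lambda>_. 0) *\<^sub>v x) = \<rho> (\<lambda>w. e 0) *\<^sub>v \<pi> x"
      using L_carrier[OF x] pc[OF x] by (simp add: Psi_zero zero_mat_vec e_0 R.rho_zero)
    fix h w c assume h: "h \<in> HA" "\<pi> (\<Psi> h *\<^sub>v x) = \<rho> (\<lambda>w. e (h w)) *\<^sub>v \<pi> x" and w: "w \<in> Wgrp H" and c: "c \<in> A"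
    have N: "Nb w \<in> HA" by (rule hcarrier_Nb[OF A w])
    have NC: "Nb w \<in> R.carr" "(\<lambda>u. e c * Nb w u) \<in> R.carr"
      using w by (auto intro!: hcarrier_Nb hcarrier_scale)
    have "\<pi> (\<Psi> (\<lambda>u. h u + c * Nb w u) *\<^sub>v x) = \<rho> (\<lambda>w. e (h w)) *\<^sub>v \<pi> x + e c \<cdot>\<^sub>v (\<rho> (Nb w) *\<^sub>v \<pi> x)"
      using h w c x N by (simp add: Psi_step padd pscale pN Psi_L L_scale)
    also have "\<dots> = (\<rho> (\<lambda>w. e (h w)) + e c \<cdot>\<^sub>m \<rho> (Nb w)) *\<^sub>v \<pi> x"
      using R.rho_carrier[OF reduce_carr[OF h(1)]] R.rho_carrier[OF NC(1)] pc[OF x]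
      by (simp add: add_mult_distrib_mat_vec[of _ d d] smult_mat_vec[of _ d d])
    also have "\<rho> (\<lambda>w. e (h w)) + e c \<cdot>\<^sub>m \<rho> (Nb w) = \<rho> (\<lambda>u. e (h u) + e c * Nb w u)"
      by (simp add: R.rho_add R.rho_scale NC reduce_carr[OF h(1)])
    also have "(\<lambda>u. e (h u) + e c * Nb w u) = (\<lambda>u. e (h u + c * Nb w u))"
    proof
      fix u
      show "e (h u) + e c * Nb w u = e (h u + c * Nb w u)"
        using hcarrierD(3)[OF h(1), of u] c by (cases "u = w") (simp_all add: Nb_def e_add)
    qed
    finally show "\<pi> (\<Psi> (\<lambda>u. h u + c * Nb w u) *\<^sub>v x) = \<rho> (\<lambda>u. e (h u + c * Nb w u)) *\<^sub>v \<pi> x" .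
  qed
qed

text \<open>Coefficients of an element of the algebra at \<open>p\<close> are lifted by
  \<open>k\<close>, and the lift acts on \<open>L\<close> and on its quotient. The point is that the
  resulting operator depends only on the reduced element, so that all algebra relations
  descend.\<close>

lemma specialization_exists:
  "\<exists>(d::nat) \<pi> \<rho>. rep H p d \<rho> \<and> \<pi> ` L = carrier_vec d \<and>
     (\<forall>x\<in>L. \<forall>y\<in>L. \<pi> (x + y) = \<pi> x + \<pi> y) \<and>
     (\<forall>a\<in>A. \<forall>x\<in>L. \<pi> (a \<cdot>\<^sub>v x) = e a \<cdot>\<^sub>v \<pi> x) \<and>
     (\<forall>x\<in>L. \<pi> x = 0\<^sub>v d \<longleftrightarrow> x \<in> IL) \<and>
     (\<forall>w\<in>Wgrp H. \<forall>x\<in>L. \<pi> (\<Psi> (Nb w) *\<^sub>v x) = \<rho> (Nb w) *\<^sub>v \<pi> x)"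
proof -
  obtain d :: nat and \<pi> s where s: "\<forall>j<d. s j \<in> L" and im: "\<pi> ` L = carrier_vec d"
    and padd: "\<forall>x\<in>L. \<forall>y\<in>L. \<pi> (x + y) = \<pi> x + \<pi> y"
    and pscale: "\<forall>a\<in>A. \<forall>x\<in>L. \<pi> (a \<cdot>\<^sub>v x) = e a \<cdot>\<^sub>v \<pi> x"
    and ker: "\<forall>x\<in>L. \<pi> x = 0\<^sub>v d \<longleftrightarrow> x \<in> IL"
    and rep: "\<forall>x\<in>L. \<exists>a. (\<forall>j<d. a j \<in> A) \<and> (\<exists>m\<in>IL. x = lcomb n {..<d} a s + m) \<and>
        \<pi> x = Matrix.vec d (\<lambda>j. e (a j))"
    using quotient_map by (elim exE conjE)
  have pc: "\<pi> x \<in> carrier_vec d" if "x \<in> L" for x using im that by blast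
  \<comment> \<open>The images of the \<open>s j\<close> under \<open>\<pi>\<close> are the unit
    vectors, so these are the columns of the operator induced by \<open>h\<close>.\<close>
  define M where "M h = Matrix.mat d d (\<lambda>(i, j). \<pi> (\<Psi> h *\<^sub>v s j) $ i)" for h
  have Mc: "M h \<in> carrier_mat d d" for h by (simp add: M_def)
  have sc: "s j \<in> carrier_vec n" if "j < d" for j using s that L_carrier by blast
  have Mact: "M h *\<^sub>v \<pi> x = \<pi> (\<Psi> h *\<^sub>v x)" if h: "h \<in> HA" and x: "x \<in> L" for h x
  proof -
    obtain a m where a: "\<forall>j<d. a j \<in> A" and m: "m \<in> IL" "x = lcomb n {..<d} a s + m"
      and px: "\<pi> x = Matrix.vec d (\<lambda>j. e (a j))" using bspec[OF rep x] by (elim exE conjE bexE)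
    have Pc: "\<Psi> h \<in> carrier_mat n n" using Psi_carrier[OF h] .
    have part: "lcomb n {..<q} a s \<in> L \<and> \<pi> (\<Psi> h *\<^sub>v lcomb n {..<q} a s) = Matrix.vec d (\<lambda>i. \<Sum>j<q. e (a j) * \<pi> (\<Psi> h *\<^sub>v s j) $ i)"
      if "q \<le> d" for q
      using that
    proof (induction q)
      case 0
      have "\<Psi> h *\<^sub>v 0\<^sub>v n = 0\<^sub>v n" using Pc by (intro eq_vecI) auto
      moreover have "\<pi> (0\<^sub>v n) = 0\<^sub>v d" using ker L_zero IL_zero by blast
      ultimately show ?case using L_zero by (auto simp: lcomb_empty)
    next
      case (Suc q)
      define y where "y = lcomb n {..<q} a s"
      have y: "y \<in> L" "\<pi> (\<Psi> h *\<^sub>v y) = Matrix.vec d (\<lambda>i. \<Sum>j<q. e (a j) * \<pi> (\<Psi> h *\<^sub>v s j) $ i)"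
        using Suc by (auto simp: y_def)
      have sq: "s q \<in> L" "a q \<in> A" using s a Suc(2) by auto
      have eq: "lcomb n {..<Suc q} a s = y + a q \<cdot>\<^sub>v s q"
        unfolding y_def lessThan_Suc by (rule lcomb_insert) (use L_carrier[OF sq(1)] in auto)
      have "\<Psi> h *\<^sub>v (y + a q \<cdot>\<^sub>v s q) = \<Psi> h *\<^sub>v y + a q \<cdot>\<^sub>v (\<Psi> h *\<^sub>v s q)"
        using Pc L_carrier[OF y(1)] L_carrier[OF sq(1)]
        by (simp add: mult_add_distrib_mat_vec[of _ n n] mult_mat_vec[of _ n n])
      then have "\<pi> (\<Psi> h *\<^sub>v (y + a q \<cdot>\<^sub>v s q)) = \<pi> (\<Psi> h *\<^sub>v y) + e (a q) \<cdot>\<^sub>v \<pi> (\<Psi> h *\<^sub>v s q)"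
        using padd pscale Psi_L[OF h y(1)] Psi_L[OF h sq(1)] sq(2) by (simp add: L_scale)
      also have "\<dots> = Matrix.vec d (\<lambda>i. \<Sum>j<Suc q. e (a j) * \<pi> (\<Psi> h *\<^sub>v s j) $ i)"
        unfolding y(2) using pc[OF Psi_L[OF h sq(1)]] by (intro eq_vecI) auto
      finally show ?case unfolding eq using y(1) sq by (simp add: L_add L_scale)
    qed
    define y where "y = lcomb n {..<d} a s"
    have y: "y \<in> L" "\<pi> (\<Psi> h *\<^sub>v y) = Matrix.vec d (\<lambda>i. \<Sum>j<d. e (a j) * \<pi> (\<Psi> h *\<^sub>v s j) $ i)"
      using part[of d] by (auto simp: y_def)
    have "\<Psi> h *\<^sub>v x = \<Psi> h *\<^sub>v y + \<Psi> h *\<^sub>v m"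
      unfolding m(2) y_def[symmetric] using Pc L_carrier[OF y(1)] IL_carrier[OF m(1)]
      by (rule mult_add_distrib_mat_vec)
    then have "\<pi> (\<Psi> h *\<^sub>v x) = \<pi> (\<Psi> h *\<^sub>v y) + \<pi> (\<Psi> h *\<^sub>v m)"
      using padd Psi_L[OF h y(1)] Psi_L[OF h IL_L[OF m(1)]] by simp
    also have "\<pi> (\<Psi> h *\<^sub>v m) = 0\<^sub>v d" using ker Psi_IL[OF h m(1)] IL_L by blast
    also have "\<pi> (\<Psi> h *\<^sub>v y) + 0\<^sub>v d = M h *\<^sub>v \<pi> x"
      unfolding y(2) px M_def by (intro eq_vecI) (auto simp: scalar_prod_def atLeast0LessThan mult.commute)
    finally show ?thesis by simp
  qed
  \<comment> \<open>Lifts of sums and products need not be sums and products of lifts, as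
    \<open>k\<close> is only known to be a section of \<open>e\<close>. They agree after reduction,
    which this congruence shows to be enough.\<close>
  have Mcong: "M h = M h'" if h: "h \<in> HA" "h' \<in> HA" and eq: "\<And>w. e (h w) = e (h' w)" for h h'
  proof (rule mat_eq_mult_vecI[OF Mc Mc])
    fix y :: "complex Matrix.vec" assume "y \<in> carrier_vec d"
    then obtain x where x: "x \<in> L" "y = \<pi> x" using im by blast
    define g where "g = (\<lambda>w. h w + (- 1) * h' w)"
    have g': "(\<lambda>w. (- 1) * h' w) \<in> HA" using A_closed by (intro hcarrier_scale[OF A] h) auto
    have gA: "g \<in> HA" unfolding g_def by (intro hcarrier_add[OF A] h g')
    have "g w \<in> I" for w
      using hcarrierD(3)[OF h(1), of w] hcarrierD(3)[OF h(2), of w] eq[of w]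
      by (simp add: g_def I_def A_closed e_diff)
    then have "g \<in> hcarrier H I" using hcarrierD(1,2)[OF gA] by (intro hcarrierI)
    then have gm: "\<Psi> g *\<^sub>v x \<in> IL" using x(1) by (rule Psi_I)
    have "(\<lambda>w. g w + h' w) = h" by (auto simp: g_def)
    then have "\<Psi> h = \<Psi> g + \<Psi> h'" using Psi_add[OF gA h(2)] by simp
    then have "\<Psi> h *\<^sub>v x = \<Psi> g *\<^sub>v x + \<Psi> h' *\<^sub>v x"
      using Psi_carrier[OF gA] Psi_carrier[OF h(2)] L_carrier[OF x(1)]
      by (simp add: add_mult_distrib_mat_vec[of _ n n])
    then have "\<pi> (\<Psi> h *\<^sub>v x) = \<pi> (\<Psi> g *\<^sub>v x) + \<pi> (\<Psi> h' *\<^sub>v x)"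
      using padd Psi_L[OF gA x(1)] Psi_L[OF h(2) x(1)] by simp
    also have "\<pi> (\<Psi> g *\<^sub>v x) = 0\<^sub>v d" using ker gm IL_L by blast
    finally show "M h *\<^sub>v y = M h' *\<^sub>v y"
      unfolding x(2) using Mact[OF h(1) x(1)] Mact[OF h(2) x(1)] pc[OF Psi_L[OF h(2) x(1)]] by simp
  qed
  define lift where "lift a = (\<lambda>w. k (a w))" for a :: "'n aff \<Rightarrow> complex"
  have lift: "lift a \<in> HA" "e (lift a w) = a w" if "a \<in> HC" for a w
  proof -
    have "supp (lift a) \<subseteq> supp a" using k(3) by (auto simp: lift_def)
    then show "lift a \<in> HA"
      using hcarrierD(1,2)[OF that] finite_subset k(1) by (intro hcarrierI) (auto simp: lift_def)
  qed (simp add: lift_def k)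
  define \<rho> where "\<rho> a = M (lift a)" for a
  have rho: "\<rho> a = M h" if "h \<in> HA" "\<And>w. a w = e (h w)" for a h
  proof -
    have "a = (\<lambda>w. e (h w))" using that(2) by auto
    then have "a \<in> HC" using reduce_carr[OF that(1)] by simp
    then show ?thesis unfolding \<rho>_def using lift that by (intro Mcong) auto
  qed
  have rho_act: "\<rho> a *\<^sub>v \<pi> x = \<pi> (\<Psi> h *\<^sub>v x)" if "h \<in> HA" "\<And>w. a w = e (h w)" "x \<in> L" for a h x
    using rho[OF that(1,2)] Mact[OF that(1,3)] by simp
  have rho_eqI: "\<rho> a = N" if "N \<in> carrier_mat d d" "\<And>x. x \<in> L \<Longrightarrow> \<rho> a *\<^sub>v \<pi> x = N *\<^sub>v \<pi> x" for a N
  proof (rule mat_eq_mult_vecI[OF _ that(1)])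
    fix y :: "complex Matrix.vec" assume "y \<in> carrier_vec d"
    then obtain x where "x \<in> L" "y = \<pi> x" using im by blast
    then show "\<rho> a *\<^sub>v y = N *\<^sub>v y" using that(2) by simp
  qed (simp add: \<rho>_def Mc)
  have "rep H p d \<rho>"
    unfolding rep_def alg_rep_def
  proof (intro conjI ballI allI)
    show "\<rho> a \<in> carrier_mat d d" for a by (simp add: \<rho>_def Mc)
  next
    fix a b assume ab: "a \<in> HC" "b \<in> HC"
    have la: "lift a \<in> HA" "lift b \<in> HA" using lift ab by auto
    have l: "(\<lambda>w. lift a w + lift b w) \<in> HA" by (intro hcarrier_add[OF A] la)
    have e: "a w + b w = e (lift a w + lift b w)" for w
      using hcarrierD(3)[OF la(1), of w] hcarrierD(3)[OF la(2), of w] by (simp add: e_add lift ab)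
    show "\<rho> (\<lambda>w. a w + b w) = \<rho> a + \<rho> b"
    proof (rule rho_eqI)
      fix x assume x: "x \<in> L"
      have "\<Psi> (\<lambda>w. lift a w + lift b w) *\<^sub>v x = \<Psi> (lift a) *\<^sub>v x + \<Psi> (lift b) *\<^sub>v x"
        using Psi_add[OF la] Psi_carrier[OF la(1)] Psi_carrier[OF la(2)] L_carrier[OF x]
        by (simp add: add_mult_distrib_mat_vec[of _ n n])
      then have "\<rho> (\<lambda>w. a w + b w) *\<^sub>v \<pi> x = M (lift a) *\<^sub>v \<pi> x + M (lift b) *\<^sub>v \<pi> x"
        using rho_act[OF l e x] padd Psi_L la x by (simp add: Mact)
      then show "\<rho> (\<lambda>w. a w + b w) *\<^sub>v \<pi> x = (\<rho> a + \<rho> b) *\<^sub>v \<pi> x"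
        unfolding \<rho>_def by (simp add: add_mult_distrib_mat_vec[OF Mc Mc pc[OF x]])
    qed (auto simp: \<rho>_def Mc)
  next
    fix a c assume a: "a \<in> HC"
    have la: "lift a \<in> HA" using lift a by auto
    have l: "(\<lambda>w. k c * lift a w) \<in> HA" by (intro hcarrier_scale[OF A] la k)
    have e: "c * a w = e (k c * lift a w)" for w
      using hcarrierD(3)[OF la, of w] by (simp add: e_mult lift a k)
    show "\<rho> (\<lambda>w. c * a w) = c \<cdot>\<^sub>m \<rho> a"
    proof (rule rho_eqI)
      fix x assume x: "x \<in> L"
      have "\<Psi> (\<lambda>w. k c * lift a w) *\<^sub>v x = k c \<cdot>\<^sub>v (\<Psi> (lift a) *\<^sub>v x)"
        using Psi_scale[OF k(1) la] Psi_carrier[OF la] L_carrier[OF x]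
        by (simp add: smult_mat_vec[of _ n n])
      then have "\<rho> (\<lambda>w. c * a w) *\<^sub>v \<pi> x = c \<cdot>\<^sub>v (M (lift a) *\<^sub>v \<pi> x)"
        using rho_act[OF l e x] pscale k Psi_L[OF la x] Mact[OF la x] by simp
      then show "\<rho> (\<lambda>w. c * a w) *\<^sub>v \<pi> x = (c \<cdot>\<^sub>m \<rho> a) *\<^sub>v \<pi> x"
        unfolding \<rho>_def by (simp add: smult_mat_vec[OF Mc pc[OF x]])
    qed (auto simp: \<rho>_def Mc)
  next
    fix a b assume ab: "a \<in> HC" "b \<in> HC"
    have la: "lift a \<in> HA" "lift b \<in> HA" using lift ab by auto
    have l: "hmul con (lift a) (lift b) \<in> HA" by (intro Psi_mult la)
    have e: "hmul (mulc_at H p) a b w = e (hmul con (lift a) (lift b) w)" for w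
      by (simp add: e_hmul la lift ab)
    show "\<rho> (hmul (mulc_at H p) a b) = \<rho> a * \<rho> b"
    proof (rule rho_eqI)
      fix x assume x: "x \<in> L"
      have "\<Psi> (hmul con (lift a) (lift b)) *\<^sub>v x = \<Psi> (lift a) *\<^sub>v (\<Psi> (lift b) *\<^sub>v x)"
        using Psi_mult(2)[OF la] Psi_carrier[OF la(1)] Psi_carrier[OF la(2)] L_carrier[OF x]
        by (simp add: assoc_mult_mat_vec[of _ n n _ n])
      then have "\<rho> (hmul (mulc_at H p) a b) *\<^sub>v \<pi> x = M (lift a) *\<^sub>v (M (lift b) *\<^sub>v \<pi> x)"
        using rho_act[OF l e x] Mact[OF la(1) Psi_L[OF la(2) x]] Mact[OF la(2) x] by simp
      then show "\<rho> (hmul (mulc_at H p) a b) *\<^sub>v \<pi> x = (\<rho> a * \<rho> b) *\<^sub>v \<pi> x"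
        unfolding \<rho>_def by (simp add: assoc_mult_mat_vec[OF Mc Mc pc[OF x]])
    qed (auto simp: \<rho>_def intro!: mult_carrier_mat[OF Mc Mc])
  next
    have N: "Nb id \<in> HA" by (rule hcarrier_Nb[OF A]) simp
    have e: "Nb id w = e (Nb id w)" for w :: "'n aff" by (simp add: Nb_def e_0 e_1)
    show "\<rho> (Nb id) = 1\<^sub>m d"
    proof (rule rho_eqI)
      fix x assume x: "x \<in> L"
      show "\<rho> (Nb id) *\<^sub>v \<pi> x = 1\<^sub>m d *\<^sub>v \<pi> x"
        using rho_act[OF N e x] L_carrier[OF x] pc[OF x] by (simp add: Psi_id)
    qed simp
  qed
  moreover have "\<pi> (\<Psi> (Nb w) *\<^sub>v x) = \<rho> (Nb w) *\<^sub>v \<pi> x" if w: "w \<in> Wgrp H" and x: "x \<in> L" for w x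
  proof -
    have N: "Nb w \<in> HA" by (rule hcarrier_Nb[OF A w])
    show ?thesis by (rule rho_act[OF N _ x, symmetric]) (simp add: Nb_def e_0 e_1)
  qed
  ultimately show ?thesis
    using im padd pscale ker by (intro exI[of _ d] exI[of _ \<pi>] exI[of _ \<rho>] conjI ballI) simp_all
qed

end

section \<open>Points of the component on the curve\<close>

text \<open>The representative \<open>f / g\<close> found at \<open>p\<close> satisfies its defining
  identity on the whole torus, so it gives a regular nonzero value of the mass wherever the product
  of \<open>f\<close> and \<open>g\<close> does not vanish.\<close>

lemma Qreg_open:
  assumes R: "R = {v \<in> Qpos H. \<exists>c. c \<noteq> 0 \<and> mass_value H r v c}" and p: "p \<in> R"
  shows "\<exists>f\<in>Lam H. f p \<noteq> 0 \<and> (\<forall>q\<in>Qpos H. f q \<noteq> 0 \<longrightarrow> q \<in> R)"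
proof -
  obtain f g where fg: "f \<in> Lam H" "g \<in> Lam H" "g p \<noteq> 0" "f p \<noteq> 0"
    "\<forall>q\<in>QC H. mass_num H r q * g q = f q * mass_den H r q"
    using p unfolding R mass_value_def by fastforce
  have "q \<in> R" if "q \<in> Qpos H" "f q * g q \<noteq> 0" for q
  proof -
    have "mass_value H r q (f q / g q)"
      using that fg unfolding mass_value_def by (auto simp: Qpos_def)
    then show ?thesis using that unfolding R by (auto intro!: exI[of _ "f q / g q"])
  qed
  moreover have "(\<lambda>q. f q * g q) \<in> Lam H" using fg by (intro laurent.intros)
  ultimately show ?thesis using fg by (intro bexI[of _ "\<lambda>q. f q * g q"]) auto
qed

text \<open>A point of the arc with \<open>f\<close> nonzero lies in \<open>R\<close>; being in the
  closure of \<open>C\<close> as well, it lies in \<open>C\<close> and not in another component. The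
  strict inequalities persist near the end of the arc by continuity, and injectivity of the arc
  yields infinitely many points there.\<close>

lemma points_near_boundary:
  assumes Z: "irreducible_curve H Z"
    and R: "R = {v \<in> Qpos H. \<exists>c. c \<noteq> 0 \<and> mass_value H r v c}" and C: "C \<in> components R"
    and \<gamma>: "arc \<gamma>" "path_image \<gamma> \<subseteq> Z \<inter> closure_Q H C" "pathstart \<gamma> \<in> C" "pathfinish \<gamma> = v0"
    and r: "\<And>y. r y \<in> Lam H" and A: "finite A" "\<And>y. y \<in> A \<Longrightarrow> cmod (r y v0) > 1"
  shows "\<exists>J. infinite J \<and> J \<subseteq> Z \<inter> C \<and> (\<forall>p\<in>J. \<forall>y\<in>A. cmod (r y p) > 1)"
proof -
  have CR: "C \<subseteq> R" using C by (rule in_components_subset)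
  then obtain f where f: "f \<in> Lam H" "f (pathstart \<gamma>) \<noteq> 0" "\<forall>q\<in>Qpos H. f q \<noteq> 0 \<longrightarrow> q \<in> R"
    using Qreg_open[OF R] \<gamma>(3) by blast
  have \<gamma>Z: "\<gamma> s \<in> Z" "\<gamma> s \<in> Qpos H" "\<gamma> s \<in> closure C" if "s \<in> {0..1}" for s
    using \<gamma>(2) that by (auto simp: path_image_def closure_Q_def)
  have "pathstart \<gamma> \<in> Z" using \<gamma>Z(1)[of 0] by (simp add: pathstart_def)
  then have fin: "finite {p \<in> Z. f p = 0}" using curve_zero_set[OF Z f(1)] f(2) by blast
  have inC: "\<gamma> s \<in> C" if "s \<in> {0..1}" "f (\<gamma> s) \<noteq> 0" for s
  proof -
    have p: "\<gamma> s \<in> R" using f(3) \<gamma>Z[OF that(1)] that(2) by blast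
    then obtain g where "g \<in> Lam H" "g (\<gamma> s) \<noteq> 0" "\<forall>q\<in>Qpos H. g q \<noteq> 0 \<longrightarrow> q \<in> R"
      using Qreg_open[OF R] by blast
    moreover have "R \<subseteq> Qpos H" using R by auto
    ultimately show ?thesis using component_absorbs_closure[OF C _ p \<gamma>Z(3)[OF that(1)]] by blast
  qed
  have cont: "continuous_on {0..1} (\<lambda>s. cmod (r y (\<gamma> s)))" for y
  proof (intro continuous_on_norm continuous_on_compose2[OF Lam_continuous[OF r]])
    show "continuous_on {0..1} \<gamma>" using \<gamma>(1) by (simp add: arc_def path_def)
    show "\<gamma> ` {0..1} \<subseteq> QC H" using \<gamma>Z irreducible_curve_QC[OF Z] by blast
  qed
  have "\<forall>\<^sub>F s in at 1 within {0..1}. \<forall>y\<in>A. cmod (r y (\<gamma> s)) > 1"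
  proof (rule eventually_ball_finite[OF A(1)], rule ballI)
    fix y assume y: "y \<in> A"
    have "((\<lambda>s. cmod (r y (\<gamma> s))) \<longlongrightarrow> cmod (r y (\<gamma> 1))) (at 1 within {0..1})"
      using cont[of y] unfolding continuous_on_def by auto
    moreover have "cmod (r y (\<gamma> 1)) > 1" using A(2)[OF y] \<gamma>(4) by (simp add: pathfinish_def)
    ultimately show "\<forall>\<^sub>F s in at 1 within {0..1}. cmod (r y (\<gamma> s)) > 1" by (rule order_tendstoD(1))
  qed
  then obtain \<delta> where \<delta>: "\<delta> > 0" "\<And>s. s \<in> {0..1} \<Longrightarrow> s \<noteq> 1 \<Longrightarrow> dist s 1 < \<delta> \<Longrightarrow> \<forall>y\<in>A. cmod (r y (\<gamma> s)) > 1"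
    unfolding eventually_at by blast
  \<comment> \<open>The end point is left out because \<open>\<delta>\<close> controls only
    parameters different from 1, and halving \<open>\<delta>\<close> makes the distance bound
    strict.\<close>
  define T where "T = {max 0 (1 - \<delta> / 2)..<1}"
  have T: "T \<subseteq> {0..1}" "infinite T" using \<delta>(1) by (auto simp: T_def infinite_Ico)
  have "inj_on \<gamma> T" using \<gamma>(1) T(1) by (auto simp: arc_def intro: inj_on_subset)
  then have "infinite (\<gamma> ` T)" using T(2) finite_imageD by blast
  then have "infinite (\<gamma> ` T - {p \<in> Z. f p = 0})" using fin by simp
  moreover have "\<gamma> ` T - {p \<in> Z. f p = 0} \<subseteq> Z \<inter> C" using T(1) inC \<gamma>Z(1) by blast
  moreover have "\<forall>y\<in>A. cmod (r y p) > 1" if "p \<in> \<gamma> ` T" for p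
  proof -
    obtain s where s: "s \<in> T" "p = \<gamma> s" using \<open>p \<in> \<gamma> ` T\<close> by blast
    then have "dist s 1 < \<delta>" "s \<noteq> 1" using \<delta>(1) by (auto simp: T_def dist_real_def)
    then show ?thesis using \<delta>(2)[of s] s T(1) by blast
  qed
  ultimately show ?thesis by blast
qed

text \<open>The members of \<open>DS\<close> have generic central characters that agree with
  \<open>r\<close> only up to \<open>W0 H\<close>. Moving along the orbit gives all of them the
  central character of the same \<open>r\<close>, so one element can annihilate them
  simultaneously.\<close>

lemma DS_rep:
  assumes hecke: "is_affine_hecke H" and dirac: "is_dirac_induction H B Ind eps" and cc: "is_generic_cc H B Ind eps rb"
    and \<chi>: "\<chi> \<in> DS H B Ind eps rb r p"
  shows "\<exists>d \<rho>. discrete_series H p d \<rho> \<and> \<chi> = chr H \<rho> \<and> central_char H p d \<rho> (\<lambda>x. r x p)"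
proof -
  obtain b where b: "b \<in> B" "W0_orbit H (rb b) = W0_orbit H r" "p \<in> Qreg H b" "\<chi> = (\<lambda>w. of_int (eps b p) * Ind b p w)"
    using \<chi> unfolding DS_def by blast
  have "ds_char H p \<chi>" using dirac b unfolding is_dirac_induction_def by blast
  then obtain d \<rho> where \<rho>: "discrete_series H p d \<rho>" "\<chi> = chr H \<rho>" unfolding ds_char_def by blast
  have c: "central_char H p d \<rho> (\<lambda>x. rb b x p)"
  proof -
    have "\<forall>v\<in>Qreg H b. \<forall>d \<rho>. discrete_series H v d \<rho> \<and> chr H \<rho> = (\<lambda>w. of_int (eps b v) * Ind b v w) \<longrightarrow>
        central_char H v d \<rho> (\<lambda>x. rb b x v)"
      using bspec[OF cc[unfolded is_generic_cc_def] b(1)] by (elim conjE)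
    then show ?thesis using b(3,4) \<rho> by simp
  qed
  have "(\<lambda>x. rb b (ginv id x)) \<in> W0_orbit H (rb b)" using W0.W0_id unfolding W0_orbit_def by blast
  then have "rb b \<in> W0_orbit H (rb b)" by (simp add: inv_id)
  then obtain w where w: "w \<in> W0 H" "rb b = (\<lambda>x. r (ginv w x))"
    unfolding b(2) unfolding W0_orbit_def by blast
  have p: "p \<in> QC H" using b(3) by (simp add: Qreg_def Qpos_def)
  have rep: "rep H p d \<rho>" using \<rho>(1) by (simp add: discrete_series_def irreducible_rep_def)
  interpret rep_setup H p d \<rho> using p rep hecke by unfold_locales auto
  have "inj w" using W0_bij[OF root_datum w(1)] by (rule bij_is_inj)
  then have "(\<lambda>x. rb b x p) \<circ> w = (\<lambda>x. r x p)" by (auto simp: w(2))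
  then show ?thesis using central_char_W0[OF c w(1)] \<rho> by auto
qed

section \<open>The lattices of the model\<close>

lemma is_subfield_Inter: "(\<And>E. E \<in> X \<Longrightarrow> is_subfield E) \<Longrightarrow> is_subfield (\<Inter>X)"
  by (simp add: is_subfield_def)

lemma is_subfield_compositum: "is_subfield (compositum K s F)"
  unfolding compositum_def by (rule is_subfield_Inter) simp

lemma compositum_base: "K \<subseteq> compositum K s F"
  unfolding compositum_def by (rule Inter_greatest) simp

text \<open>The reduction is studied at a point \<open>e0\<close> of the normalization above
  \<open>p0\<close>; \<open>G\<close> is a finite generating set of the lattice
  \<open>Llat m i\<close> over the integral closure.\<close>

locale model_setup = sigma_setup H Z U "emb m" Sg I
  for H :: "('n::finite) affine_hecke" and Z U :: "'n pt set" and m :: "('n, 'l::alg_closed_field) model"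
    and Sg :: "'n aff \<Rightarrow> 'n pt \<Rightarrow> complex" and I :: "'n pt set" +
  fixes i :: nat and e0 :: "'l \<Rightarrow> complex" and p0 :: "'n pt" and G :: "'l Matrix.vec set"
  assumes model: "is_model H U Sg m" and i: "i < Lnum m" and e0: "above H U m e0 p0"
    and lattice: "finite G" "G \<subseteq> vecs_over (LL H U m) (Ldim m i)" "Llat m i = vec_span (Rtilde H U m) (Ldim m i) G"
begin

lemma S_eq: "Sig H m Sg = S"
  by (auto simp: Sig_def S_def)

abbreviation "A \<equiv> Rtilde H U m"
abbreviation "F \<equiv> LL H U m"
abbreviation "la \<equiv> left_act H con S"
abbreviation "\<Psi> h \<equiv> Liso m (la h) i"

lemma LL_subfield: "is_subfield F" and reg_LL: "reg_ring H U (emb m) \<subseteq> F"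
proof -
  show "is_subfield F" unfolding LL_def by (rule is_subfield_compositum)
  have "reg_ring H U (emb m) \<subseteq> KK H U m"
  proof
    fix x assume x: "x \<in> reg_ring H U (emb m)"
    have "1 \<in> reg_ring H U (emb m)" using ring_set_reg by (simp add: ring_set_def)
    moreover have "x = x / 1" "(1 :: 'l) \<noteq> 0" by simp_all
    ultimately show "x \<in> KK H U m" unfolding KK_def fraction_field_def using x by blast
  qed
  then show "reg_ring H U (emb m) \<subseteq> F" unfolding LL_def using compositum_base by blast
qed

lemma ring_A: "ring_set A" and reg_A: "reg_ring H U (emb m) \<subseteq> A" and A_LL: "A \<subseteq> F"
  unfolding Rtilde_def
  using ring_set_integral_closure[OF ring_set_reg LL_subfield reg_LL]
  by (auto simp: integral_closure_in_def)

lemma ring_F: "ring_set F"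
  by (rule ring_set_subfield[OF LL_subfield])

lemma con_reg: "x \<in> Wgrp H \<Longrightarrow> y \<in> Wgrp H \<Longrightarrow> con x y u \<in> reg_ring H U (emb m)"
  unfolding mulc_on_def reg_ring_def by (intro imageI mulc_reg)

sublocale T: traced_structure_constants H con S
  by (rule traced)

lemma la_Mmod: "ring_set X \<Longrightarrow> h \<in> hcarrier H X \<Longrightarrow> la h \<in> Mmod H U m Sg X"
  unfolding Mmod_def S_eq by (rule left_act_sub_bimodule)

lemma p0: "p0 \<in> U" "p0 \<in> QC H"
  using e0 UQC by (auto simp: above_def)

lemma e0_reg: "f \<in> Reg \<Longrightarrow> e0 (emb m f) = f p0"
  using e0 by (auto simp: above_def)

lemma decomposition: "matrix_decomposition F (Mmod H U m Sg F) (mprod m) (Lnum m) (Ldim m) (\<lambda>_. F) (Liso m)"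
  using model by (simp add: is_model_def)

lemma Liso:
  assumes "f \<in> Mmod H U m Sg F" "g \<in> Mmod H U m Sg F"
  shows Liso_carrier: "Liso m f i \<in> carrier_mat (Ldim m i) (Ldim m i)"
    and Liso_add: "Liso m (\<lambda>w. f w + g w) i = Liso m f i + Liso m g i"
    and Liso_mult: "Liso m (mprod m f g) i = Liso m f i * Liso m g i"
    and Liso_scale: "c \<in> F \<Longrightarrow> Liso m (\<lambda>w. c * f w) i = c \<cdot>\<^sub>m Liso m f i"
  using decomposition assms i unfolding matrix_decomposition_def mats_over_def by blast+

lemma mprod_la: "a \<in> hcarrier H F \<Longrightarrow> b \<in> hcarrier H F \<Longrightarrow> mprod m (la a) (la b) = la (hmul con a b)"
  using model by (simp add: is_model_def S_eq)

text \<open>As \<open>\<Sigma>\<close> is a trace, every element of \<open>M \<otimes> \<LL>\<close> has the form \<open>h\<Sigma>\<close>; so \<open>\<Sigma>\<close> is its unit element.\<close>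
lemma Psi_Nb_id: "\<Psi> (Nb id) = 1\<^sub>m (Ldim m i)"
proof -
  have one: "1\<^sub>m n \<in> mats_over F n" for n
    using ring_F unfolding mats_over_def elements_mat_def by (auto simp: ring_set_def)
  then obtain f where f: "f \<in> Mmod H U m Sg F" "\<forall>j<Lnum m. Liso m f j = 1\<^sub>m (Ldim m j)"
    using decomposition unfolding matrix_decomposition_def
    by (elim conjE allE[of _ "\<lambda>j. 1\<^sub>m (Ldim m j)"]) auto
  obtain h where h: "h \<in> hcarrier H F" "f = la h"
    using T.sub_bimodule_left_act[OF ring_F _ f(1)[unfolded Mmod_def S_eq]] con_reg reg_LL by blast
  have N: "Nb id \<in> hcarrier H F" by (rule hcarrier_Nb[OF ring_F]) simp
  have M: "la (Nb id) \<in> Mmod H U m Sg F" by (rule la_Mmod[OF ring_F N])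
  have "mprod m (la (Nb id)) f = f"
    using mprod_la[OF N h(1)] h T.hmul_id_left[OF hcarrier_UNIV[OF h(1)]] by simp
  then have "\<Psi> (Nb id) * Liso m f i = Liso m f i" using Liso_mult[OF M f(1)] by simp
  then show ?thesis using f(2) i Liso_carrier[OF M M] by simp
qed

definition "kc c = emb m (on_set U (\<lambda>_. c))"

lemma e0_Utilde: "e0 \<in> Utilde H U m"
  using e0 by (simp add: above_def)

sublocale lattice_reduction A e0 kc "Ldim m i" G
proof
  show "ring_set A" by (rule ring_A)
  show "e0 (x + y) = e0 x + e0 y" "e0 (x * y) = e0 x * e0 y" if "x \<in> A" "y \<in> A" for x y
    using e0_Utilde that unfolding Utilde_def by auto
  show "kc c \<in> A" for c
    using reg_A regular_const[OF UQC, of c] unfolding kc_def reg_ring_def by blast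
  show "e0 (kc c) = c" for c using e0_Utilde unfolding Utilde_def kc_def by blast
  have "on_set U (\<lambda>_. 0) = (\<lambda>_. 0)" by (auto simp: on_set_def)
  then show "kc 0 = 0" by (simp add: kc_def k_zero)
  show "kc 1 = 1" by (simp add: kc_def k_one)
  show "finite G" by (rule lattice)
  show "G \<subseteq> carrier_vec (Ldim m i)" using lattice(2) by (auto simp: vecs_over_def)
qed

lemma Llat_eq: "Llat m i = L"
  unfolding L_def lattice(3) ..

text \<open>Multiplicativity and unitality come from the splitting over \<open>LL\<close>, into
  which \<open>A\<close> embeds; stability of the lattice is the model's condition on
  \<open>Mmod\<close> over \<open>A\<close>, which contains every \<open>la h\<close> with
  coefficients in \<open>A\<close>.\<close>

sublocale hecke_lattice A e0 kc "Ldim m i" G H p0 con "\<lambda>h. \<Psi> h"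
proof
  have HF: "h \<in> hcarrier H F" if "h \<in> hcarrier H A" for h using that A_LL by (rule hcarrier_mono)
  show "p0 \<in> QC H" by (rule p0)
  show "con x y u \<in> A" if "x \<in> Wgrp H" "y \<in> Wgrp H" for x y u using con_reg[OF that] reg_A by blast
  show "e0 (con x y u) = mulc_at H p0 x y u" if "x \<in> Wgrp H" "y \<in> Wgrp H" for x y u
    using e0_reg[OF mulc_reg[OF that]] p0 by (simp add: mulc_on_def mulc_at_def on_set_def)
  show "\<Psi> h \<in> carrier_mat (Ldim m i) (Ldim m i)" if "h \<in> hcarrier H A" for h
    using Liso_carrier la_Mmod[OF ring_F HF[OF that]] by blast
  show "\<Psi> (\<lambda>w. h w + h' w) = \<Psi> h + \<Psi> h'" if "h \<in> hcarrier H A" "h' \<in> hcarrier H A" for h h'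
    using T.left_act_add[OF hcarrier_UNIV[OF that(1)] hcarrier_UNIV[OF that(2)]]
      Liso_add[OF la_Mmod[OF ring_F HF[OF that(1)]] la_Mmod[OF ring_F HF[OF that(2)]]] by simp
  show "\<Psi> (\<lambda>w. c * h w) = c \<cdot>\<^sub>m \<Psi> h" if "c \<in> A" "h \<in> hcarrier H A" for c h
    using T.left_act_scale[OF hcarrier_UNIV[OF that(2)]] A_LL that(1)
      Liso_scale[OF la_Mmod[OF ring_F HF[OF that(2)]] la_Mmod[OF ring_F HF[OF that(2)]]] by auto
  show "hmul con h h' \<in> hcarrier H A" if "h \<in> hcarrier H A" "h' \<in> hcarrier H A" for h h'
    using con_reg reg_A by (intro T.hmul_closed ring_A that) blast
  show "\<Psi> (hmul con h h') = \<Psi> h * \<Psi> h'" if "h \<in> hcarrier H A" "h' \<in> hcarrier H A" for h h'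
    using mprod_la[OF HF[OF that(1)] HF[OF that(2)]]
      Liso_mult[OF la_Mmod[OF ring_F HF[OF that(1)]] la_Mmod[OF ring_F HF[OF that(2)]]] by simp
  show "\<Psi> (Nb id) = 1\<^sub>m (Ldim m i)" by (rule Psi_Nb_id)
  show "\<Psi> h *\<^sub>v z \<in> L" if "h \<in> hcarrier H A" "z \<in> L" for h z
  proof -
    have "\<forall>j<Lnum m. is_lattice A F (Ldim m j) (Llat m j) \<and>
        (\<forall>f\<in>Mmod H U m Sg A. \<forall>x\<in>Llat m j. Liso m f j *\<^sub>v x \<in> Llat m j)"
      using model unfolding is_model_def by (elim conjE)
    then show ?thesis using i la_Mmod[OF ring_A that(1)] that(2) unfolding Llat_eq[symmetric] by blast
  qed
qed

lemma is_specialization_iff: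
  "is_specialization H U Sg m i e0 p0 d \<rho> \<longleftrightarrow> rep H p0 d \<rho> \<and>
     (\<exists>\<pi>. \<pi> ` L = carrier_vec d \<and> (\<forall>x\<in>L. \<forall>y\<in>L. \<pi> (x + y) = \<pi> x + \<pi> y) \<and>
        (\<forall>a\<in>A. \<forall>x\<in>L. \<pi> (a \<cdot>\<^sub>v x) = e0 a \<cdot>\<^sub>v \<pi> x) \<and> (\<forall>x\<in>L. \<pi> x = 0\<^sub>v d \<longleftrightarrow> x \<in> IL) \<and>
        (\<forall>w\<in>Wgrp H. \<forall>x\<in>L. \<pi> (\<Psi> (Nb w) *\<^sub>v x) = \<rho> (Nb w) *\<^sub>v \<pi> x))"
  unfolding is_specialization_def Llat_eq S_eq IL_def I_def ..

text \<open>\<open>spec_char\<close> is a choice among characters of specializations, so it carries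
  information only once one of them exists.\<close>

lemma ex_specialization: "\<exists>d \<rho>. is_specialization H U Sg m i e0 p0 d \<rho>"
  unfolding is_specialization_iff using specialization_exists by blast

text \<open>The vanishing at the points of \<open>J\<close> makes the element \<open>la g\<close> of
  the model zero, so \<open>g\<close> acts by zero on the lattice. The value of the family at
  \<open>p0\<close> is the reduction of \<open>g\<close> and acts by zero on the quotient.\<close>

lemma specialization_annihilated:
  assumes sp: "is_specialization H U Sg m i e0 p0 d \<rho>"
    and X: "finite X" "X \<subseteq> Wgrp H" and h: "\<And>y. h y \<in> Lam H" "\<And>y. y \<notin> X \<Longrightarrow> h y = (\<lambda>_. 0)"
    and J: "infinite J" "J \<subseteq> U"
    and zero: "\<And>p w. p \<in> J \<Longrightarrow> w \<in> Wgrp H \<Longrightarrow>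
      fun_eval (\<lambda>w. Sg w p) (hmul (mulc_at H p) (Nb w) (\<lambda>y. h y p)) = 0"
  shows "\<rho> (\<lambda>y. h y p0) = 0\<^sub>m d d"
proof -
  define g where "g = (\<lambda>y. emb m (on_set U (h y)))"
  have off: "g y = 0" if "y \<notin> X" for y
  proof -
    have "on_set U (h y) = (\<lambda>_. 0)" using h(2)[OF that] by (simp add: on_set_def fun_eq_iff)
    then show ?thesis by (simp add: g_def k_zero)
  qed
  have gA: "g \<in> HA"
  proof (rule hcarrierI)
    have "supp g \<subseteq> X" using off by blast
    then show "finite (supp g)" "supp g \<subseteq> Wgrp H" using X finite_subset by blast+
    show "g w \<in> A" for w
      using reg_A Lam_regular[OF h(1) UQC] unfolding g_def reg_ring_def by blast
  qed
  have eg: "e0 (g y) = h y p0" for y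
    using e0_reg[OF Lam_regular[OF h(1) UQC, of y]] p0 by (simp add: g_def on_set_def)
  have "la g = (\<lambda>_. 0)" unfolding g_def by (rule left_act_zero[OF X h J zero])
  moreover have "la (\<lambda>_. 0) = (\<lambda>_. 0)"
    by (auto simp: T.left_act_eq hcarrier_zero hmul_zero_right)
  ultimately have Pg: "\<Psi> g = 0\<^sub>m (Ldim m i) (Ldim m i)" using Psi_zero by simp
  have rep: "rep H p0 d \<rho>" using sp by (simp add: is_specialization_iff)
  obtain \<pi> where im: "\<pi> ` L = carrier_vec d" and padd: "\<forall>x\<in>L. \<forall>y\<in>L. \<pi> (x + y) = \<pi> x + \<pi> y"
    and ps: "\<forall>a\<in>A. \<forall>x\<in>L. \<pi> (a \<cdot>\<^sub>v x) = e0 a \<cdot>\<^sub>v \<pi> x" and ker: "\<forall>x\<in>L. \<pi> x = 0\<^sub>v d \<longleftrightarrow> x \<in> IL"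
    and pN: "\<forall>w\<in>Wgrp H. \<forall>x\<in>L. \<pi> (\<Psi> (Nb w) *\<^sub>v x) = \<rho> (Nb w) *\<^sub>v \<pi> x"
    using sp unfolding is_specialization_iff by (elim conjE exE)
  interpret R: rep_setup H p0 d \<rho> using p0 rep hecke by unfold_locales auto
  have hC: "(\<lambda>y. h y p0) \<in> R.carr" using reduce_carr[OF gA] eg by simp
  show ?thesis
  proof (rule mat_eq_mult_vecI[OF R.rho_carrier[OF hC]])
    fix y :: "complex Matrix.vec" assume y: "y \<in> carrier_vec d"
    then obtain x where x: "x \<in> L" "y = \<pi> x" using im by blast
    have "\<pi> (\<Psi> g *\<^sub>v x) = \<rho> (\<lambda>w. e0 (g w)) *\<^sub>v \<pi> x"
      by (rule specialization_act[OF rep _ _ _ _ gA x(1)]) (use im padd ps pN in auto)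
    moreover have "\<Psi> g *\<^sub>v x = 0\<^sub>v (Ldim m i)" using L_carrier[OF x(1)] by (simp add: Pg zero_mat_vec)
    moreover have "\<pi> (0\<^sub>v (Ldim m i)) = 0\<^sub>v d" using ker L_zero IL_zero by blast
    ultimately show "\<rho> (\<lambda>y. h y p0) *\<^sub>v y = 0\<^sub>m d d *\<^sub>v y"
      using x(2) y by (simp add: eg zero_mat_vec)
  qed simp
qed

end

section \<open>The annihilating product as a Laurent family, and temperedness\<close>

lemma (in hecke) qel_Lam:
  assumes r: "\<And>y. r y \<in> Lam H"
  shows "(\<lambda>p. qel H p x (\<lambda>z. r z p) A w) \<in> Lam H"
proof -
  have "(\<lambda>p. (- 1) ^ card B * r (\<Sum>B) p * theta_at H p (int (card A - card B) *s x) w) \<in> Lam H" for B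
    unfolding theta_at_def by (intro laurent.intros(5) Lam_cmult r theta_Lam)
  then show ?thesis unfolding qel_def by (rule Lam_sum)
qed

text \<open>Bounds the support uniformly in \<open>p\<close>, since the identity principle is
  applied to a sum over one finite index set.\<close>

lemma (in hecke) qel_off:
  assumes "finite A" "w \<notin> (\<Union>B\<in>Pow A. {u. theta H (int (card A - card B) *s x) u \<noteq> (\<lambda>_. 0)})"
  shows "(\<lambda>p. qel H p x (\<lambda>z. r z p) A w) = (\<lambda>_. 0)"
proof
  fix p
  show "qel H p x (\<lambda>z. r z p) A w = 0"
    unfolding qel_def theta_at_def using assms by (intro sum.neutral) auto
qed

theorem corollary3p13:
  fixes H :: "('n::finite) affine_hecke"
    and B :: "('n aff \<Rightarrow> complex) set set"
    and Ind :: "('n aff \<Rightarrow> complex) set \<Rightarrow> 'n pt \<Rightarrow> 'n aff \<Rightarrow> complex"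
    and eps :: "('n aff \<Rightarrow> complex) set \<Rightarrow> 'n pt \<Rightarrow> int"
    and rb :: "('n aff \<Rightarrow> complex) set \<Rightarrow> 'n lat \<Rightarrow> 'n pt \<Rightarrow> complex"
    and b :: "('n aff \<Rightarrow> complex) set"
    and C Z U :: "'n pt set" and v0 :: "'n pt"
    and Sg :: "'n aff \<Rightarrow> 'n pt \<Rightarrow> complex"
    and m :: "('n, 'l::alg_closed_field) model"
    and eC :: int and IndC :: "'n aff \<Rightarrow> complex"
  assumes hecke: "is_affine_hecke H"
    and Bgm: "is_Bgm H B"
    and dirac: "is_dirac_induction H B Ind eps"
    and cc: "is_generic_cc H B Ind eps rb"
    and b: "b \<in> B"
    and C: "C \<in> components (Qreg H b)"
    and eC: "\<forall>v\<in>C. eps b v = eC"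
    and v0: "v0 \<in> boundary_Q H C"
    and curve: "admissible_curve H C v0 Z"
    and U: "smooth_open_nbhd H C Z U"
    and Sigma: "is_Sigma H B Ind eps rb (rb b) C Z U Sg"
    and model: "is_model H U Sg m"
    and limit: "is_limit_ind H Ind eps b C v0 Z U Sg m eC IndC"
  shows "tempered_char H v0 (\<lambda>w. of_int eC * IndC w)"
proof -
  define r where "r = rb b"
  have Zc: "irreducible_curve H Z" using curve by (simp add: admissible_curve_def)
  have UZ: "U \<subseteq> Z" and clU: "Z \<inter> closure_Q H C \<subseteq> U" using U by (auto simp: smooth_open_nbhd_def)
  have Qr: "Qreg H b = {v \<in> Qpos H. \<exists>c. c \<noteq> 0 \<and> mass_value H r v c}" and "r \<in> generic_points H"
    using cc b by (auto simp: is_generic_cc_def generic_residual_def r_def)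
  then have r: "r y \<in> Lam H" "r 0 = on_set (QC H) (\<lambda>_. 1)" "r (y + z) = (\<lambda>p. r y p * r z p)" for y z
    by (auto simp: generic_points_def)
  have torus: "(\<lambda>z. r z p) \<in> torus" if "p \<in> QC H" for p
    using that by (simp add: torus_def r(2,3)) (simp add: on_set_def)
  obtain v e e0 \<gamma> \<gamma>' i where l: "v \<in> Z \<inter> C" "arc \<gamma>" "path_image \<gamma> \<subseteq> Z \<inter> closure_Q H C"
    "pathstart \<gamma> = v" "pathfinish \<gamma> = v0" "pathfinish \<gamma>' = e0" "\<forall>t\<in>{0..1}. above H U m (\<gamma>' t) (\<gamma> t)"
    "i < Lnum m" "\<forall>w. of_int eC * IndC w = spec_char H U Sg m i e0 v0 w"
    using limit unfolding is_limit_ind_def by (elim exE conjE)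
  have e0: "above H U m e0 v0"
    using l(5,6,7) by (auto simp: pathfinish_def)
  have CQ: "C \<subseteq> Qpos H" using in_components_subset[OF C] by (auto simp: Qreg_def)
  then have CU: "Z \<inter> C \<subseteq> U" using clU closure_subset[of C] by (auto simp: closure_Q_def)
  have CQC: "Z \<inter> C \<subseteq> QC H" using CQ by (auto simp: Qpos_def)
  note near = points_near_boundary[OF Zc Qr C l(2,3) _ l(5) r(1)]
  have start: "pathstart \<gamma> \<in> C" using l(1,4) by simp
  have Sg: "Sg w \<in> regular_functions H U" "\<And>v. v \<in> Z \<inter> C \<Longrightarrow> Sg w v =
      (\<Sum>\<chi>\<in>DS H B Ind eps rb r v. complex_of_real (fdeg H v \<chi> / cmod (mass H r v)) * \<chi> w)"
    if "w \<in> Wgrp H" for w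
    using Sigma that by (auto simp: is_Sigma_def r_def)
  interpret hecke H using hecke by unfold_locales
  \<comment> \<open>No inequality is imposed here: infinitely many points of \<open>C\<close> on the
    curve are enough to make \<Sigma> a trace.\<close>
  obtain I where I: "infinite I" "I \<subseteq> Z \<inter> C" using near[OF start, of "{}"] by auto
  have emb: "ring_embedding H U (emb m)" using model by (simp add: is_model_def)
  have tr: "fun_eval (\<lambda>w. Sg w p) (mulc_at H p x y) = fun_eval (\<lambda>w. Sg w p) (mulc_at H p y x)"
    if "p \<in> I" "x \<in> Wgrp H" "y \<in> Wgrp H" for p x y
  proof (rule character_sum_trace[where Sg = Sg and X = "DS H B Ind eps rb r p", OF _ Sg(2)])
    show "p \<in> QC H" "p \<in> Z \<inter> C" using that(1) I(2) CQC by blast+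
    show "\<exists>d \<rho>. rep H p d \<rho> \<and> \<chi> = chr H \<rho>" if "\<chi> \<in> DS H B Ind eps rb r p" for \<chi>
      using DS_rep[OF hecke dirac cc that] unfolding discrete_series_def irreducible_rep_def by blast
  qed (use that in auto)
  have "is_lattice (Rtilde H U m) (LL H U m) (Ldim m i) (Llat m i)"
    using model l(8) by (simp add: is_model_def)
  then obtain G where G: "finite G" "G \<subseteq> vecs_over (LL H U m) (Ldim m i)" "Llat m i = vec_span (Rtilde H U m) (Ldim m i) G"
    unfolding is_lattice_def by (elim exE conjE)
  interpret M: model_setup H Z U m Sg I i e0 v0 G
  proof unfold_locales
    show "I \<subseteq> U" using I(2) CU by blast
  qed (use Zc UZ emb Sg(1) I(1) tr model l(8) e0 G in auto)
  have "\<exists>\<chi> d \<rho>. is_specialization H U Sg m i e0 v0 d \<rho> \<and> \<chi> = chr H \<rho>" using M.ex_specialization by blast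
  then have "\<exists>d \<rho>. is_specialization H U Sg m i e0 v0 d \<rho> \<and> spec_char H U Sg m i e0 v0 = chr H \<rho>"
    unfolding spec_char_def by (rule someI_ex)
  then obtain d \<rho> where sp: "is_specialization H U Sg m i e0 v0 d \<rho>" "spec_char H U Sg m i e0 v0 = chr H \<rho>"
    by blast
  have rep: "rep H v0 d \<rho>" using sp(1) by (simp add: is_specialization_def)
  interpret R: rep_setup H v0 d \<rho> using M.p0 rep by unfold_locales auto
  have "cmod (s x) \<le> 1" if s: "weight H v0 d \<rho> s" and x: "dominant H x" for s x
  proof -
    \<comment> \<open>Values of modulus exactly 1 at \<open>v0\<close> belong to \<open>A\<close>:
      nearby they may lie on either side of the unit circle, whereas the strict inequality outside
      \<open>A\<close> persists near \<open>v0\<close>.\<close>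
    define A where "A = {y \<in> orb H x. cmod (r y v0) \<le> 1}"
    have fin: "finite (orb H x)" by (rule finite_orb[OF root_datum])
    then have A: "finite A" "A \<subseteq> orb H x" by (auto simp: A_def)
    have bad: "finite (orb H x - A)" "\<And>y. y \<in> orb H x - A \<Longrightarrow> cmod (r y v0) > 1"
      using fin by (auto simp: A_def)
    \<comment> \<open>Unlike \<open>I\<close>, this set of points depends on \<open>x\<close>,
      through the distance from \<open>v0\<close> at which the factors outside \<open>A\<close> stay
      invertible.\<close>
    obtain J where J: "infinite J" "J \<subseteq> Z \<inter> C" "\<forall>p\<in>J. \<forall>y\<in>orb H x - A. cmod (r y p) > 1"
      using near[OF start bad] by blast
    define X where "X = (\<Union>B\<in>Pow A. {u. theta H (int (card A - card B) *s x) u \<noteq> (\<lambda>_. 0)})"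
    have "\<rho> (\<lambda>w. qel H v0 x (\<lambda>z. r z v0) A w) = 0\<^sub>m d d"
    proof (rule M.specialization_annihilated[OF sp(1), of X "\<lambda>w p. qel H p x (\<lambda>z. r z p) A w" J])
      show "finite X" "X \<subseteq> Wgrp H" using A(1) finite_theta theta_Wgrp unfolding X_def by blast+
      show "(\<lambda>p. qel H p x (\<lambda>z. r z p) A w) \<in> Lam H" for w by (rule qel_Lam[OF r(1)])
      show "(\<lambda>p. qel H p x (\<lambda>z. r z p) A w) = (\<lambda>_. 0)" if "w \<notin> X" for w
        using qel_off[OF A(1)] that unfolding X_def by blast
      show "infinite J" "J \<subseteq> U" using J CU by blast+
      fix p w assume p: "p \<in> J" and w: "w \<in> Wgrp H"
      have pQ: "p \<in> QC H" "p \<in> Z \<inter> C" using p J(2) CQC by blast+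
      show "fun_eval (\<lambda>w. Sg w p) (hmul (mulc_at H p) (Nb w) (qel H p x (\<lambda>z. r z p) A)) = 0"
      proof (rule character_sum_vanish[where Sg = Sg and X = "DS H B Ind eps rb r p", OF pQ(1) Sg(2)[OF _ pQ(2)] _ w qel_carr])
        fix \<chi> assume "\<chi> \<in> DS H B Ind eps rb r p"
        from DS_rep[OF hecke dirac cc this] obtain d' \<rho>' where
          ds: "discrete_series H p d' \<rho>'" "\<chi> = chr H \<rho>'" "central_char H p d' \<rho>' (\<lambda>z. r z p)"
          by blast
        have rep': "rep H p d' \<rho>'" using ds(1) by (simp add: discrete_series_def irreducible_rep_def)
        interpret P: rep_setup H p d' \<rho>' using pQ(1) rep' by unfold_locales auto
        have "\<rho>' (qel H p x (\<lambda>z. r z p) A) = 0\<^sub>m d' d'"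
          by (rule P.discrete_series_qel[OF ds(1,3) x A(2)]) (use J(3) p in blast)
        then show "\<exists>d \<rho>. rep H p d \<rho> \<and> \<chi> = chr H \<rho> \<and> \<rho> (qel H p x (\<lambda>z. r z p) A) = 0\<^sub>m d d"
          using rep' ds(2) by blast
      qed
    qed
    then obtain y where "y \<in> A" "s x = r y v0"
      using R.weight_root_of_qel[OF torus[OF M.p0(2)] _ A(1) s] by auto
    then show ?thesis by (simp add: A_def)
  qed
  then have "tempered H v0 d \<rho>" using rep by (simp add: tempered_def)
  moreover have "(\<lambda>w. of_int eC * IndC w) = chr H \<rho>" using l(9) sp(2) by auto
  ultimately show ?thesis unfolding tempered_char_def by blast
qed

end
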